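(* Let $S$ be a well-termed local set theory in a local language $\mathcal L$, let $X=\{x:\alpha\}$ where $\alpha$ is a formula whose unique free variable $x$ has type $\mathbf A$, let $f:U_{\mathbf B}\to X$ be an $S$-bijection, let $\tau_f$ be a term (in a variable $u$ of type $\mathbf B$) representing $f$ (i.e. $i_X\circ f=(u\mapsto\tau_f)$), and let $\vartheta,\gamma$ be formulae. Writing $(-)^\natural$ for the preimage translation along $f^{-1}:X\to U_{\mathbf B}$ replacing $u$ by $x$, one has $\vdash_S(\vartheta\,\square\,\gamma)^\natural=\vartheta^\natural\,\square\,\gamma^\natural$ for every binary logical connective $\square$ (namely $\wedge,\vee,\Rightarrow,\Leftrightarrow$), and $\vdash_S(\neg\vartheta)^\natural=\neg\vartheta^\natural$. Moreover, if $u$ is free in $\vartheta$ but $x$ is not, then $\vdash_S\forall u\vartheta=\forall x\in X.\vartheta^\natural$ and $\vdash_S\exists u\vartheta=\exists x\in X.\vartheta^\natural$.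
   Context: Local languages and local set theories are in the sense of J. L. Bell (Toposes and Local Set Theories), with Bell's defined intuitionistic connectives and quantifiers; $\forall x\in X.\beta$ abbreviates $\forall x(x\in X\Rightarrow\beta)$ and $\exists x\in X.\beta$ abbreviates $\exists x(x\in X\wedge\beta)$; $\Gamma\vdash_S\alpha$ denotes derivability in $S$. An $S$-set is a closed term of power type; $U_{\mathbf A}=\{x_{\mathbf A}:true\}$. An $S$-function $f:X\to Y$ is a triple $(|f|,X,Y)$ with $\vdash_S|f|\in Y^X$; these form the topos $\mathscr T(S)$ with $\mathit\Omega=U_{\mathbf\Omega}$; an $S$-bijection is an isomorphism there. $(\langle x_1,\dots,x_n\rangle\mapsto\tau)$ is the $S$-function with graph $\{\langle\langle x_1,\dots,x_n\rangle,\tau\rangle:\langle x_1,\dots,x_n\rangle\in X\}$; $i_X=(x\mapsto x):X\to U_{\mathbf A}$. $S$ is well-termed if whenever $\vdash_S\exists!x\beta$ there is a term $\tau$ whose free variables are those of $\beta$ other than $x$ with $\vdash_S\beta(x/\tau)$. For $g:Z\to\mathit\Omega$, $g^\natural(z)$ is the formula $\langle z,true\rangle\in|g|$. Preimage translation along $h:P\to Q$ replacing a variable $q$ by a variable $p$: for a list $\bm q=x_1,\dots,x_n,q$ containing the free variables of $\vartheta$ and $q$, and $\bm p=x_1,\dots,x_n,p$, $\vartheta^\natural_h:=\big((\langle\bm q\rangle\mapsto\vartheta)\circ(1\times i_Q)\circ(1\times h)\big)^\natural(\langle\bm p\rangle)$.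
   Formalization: The equalities for ⇒, ⇔ and ¬ are proved under the hypothesis x∈X (x∈X ⊢_S …), since without it they fail: θ^♮ entails x∈X, so for X={true}⊂Ω and θ=false, (¬θ)^♮ is x∈X while ¬θ^♮ is true; ∧, ∨, ∀, ∃ are as stated. *)

theory Defs
  imports Main
begin

section \<open>Local languages\<close>

text \<open>
  Only products of length at least two are formed by \<open>Prod\<close>; the usual conventions that the
  empty product is \<open>One\<close> and the one-factor product of \<open>A\<close> is \<open>A\<close> are built into \<open>prod_ty\<close>
  (and \<open>tup\<close> for terms).
\<close>

datatype 'g ty = One | Omega | Ground 'g | Prod "'g ty list" | Pow (un_Pow: "'g ty")

text \<open>Variables and function symbols carry their types; \<open>(f, A, B)\<close> is \<open>f : A \<rightarrow> B\<close>.\<close>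

type_synonym 'g var = "nat \<times> 'g ty"

record ('g, 'f) language =
  ground_types :: "'g set"
  fun_symbols :: "('f \<times> 'g ty \<times> 'g ty) set"

datatype ('g, 'f) trm =
    Var "'g var"
  | Star
  | Compr "'g var" "('g, 'f) trm"
  | App 'f "'g ty" "'g ty" "('g, 'f) trm"
  | Tup "('g, 'f) trm list"
  | Proj nat "('g, 'f) trm"
  | Eq "('g, 'f) trm" "('g, 'f) trm"
  | Mem "('g, 'f) trm" "('g, 'f) trm"

fun wf_ty :: "('g, 'f) language \<Rightarrow> 'g ty \<Rightarrow> bool" where
  "wf_ty L One \<longleftrightarrow> True"
| "wf_ty L Omega \<longleftrightarrow> True"
| "wf_ty L (Ground g) \<longleftrightarrow> g \<in> ground_types L"
| "wf_ty L (Prod As) \<longleftrightarrow> 2 \<le> length As \<and> (\<forall>A \<in> set As. wf_ty L A)"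
| "wf_ty L (Pow A) \<longleftrightarrow> wf_ty L A"

definition local_language :: "('g, 'f) language \<Rightarrow> bool" where
  "local_language L \<longleftrightarrow> (\<forall>(f, A, B) \<in> fun_symbols L. wf_ty L A \<and> wf_ty L B)"

abbreviation wf_var :: "('g, 'f) language \<Rightarrow> 'g var \<Rightarrow> bool" where
  "wf_var L x \<equiv> wf_ty L (snd x)"

text \<open>\<open>Proj i\<close> counts components from 0.\<close>

fun ty_of :: "('g, 'f) trm \<Rightarrow> 'g ty" where
  "ty_of (Var x) = snd x"
| "ty_of Star = One"
| "ty_of (Compr x \<phi>) = Pow (snd x)"
| "ty_of (App f A B t) = B"
| "ty_of (Tup ts) = Prod (map ty_of ts)"
| "ty_of (Proj i t) = (case ty_of t of Prod As \<Rightarrow> As ! i | _ \<Rightarrow> undefined)"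
| "ty_of (Eq s t) = Omega"
| "ty_of (Mem s t) = Omega"

fun wf_trm :: "('g, 'f) language \<Rightarrow> ('g, 'f) trm \<Rightarrow> bool" where
  "wf_trm L (Var x) \<longleftrightarrow> wf_var L x"
| "wf_trm L Star \<longleftrightarrow> True"
| "wf_trm L (Compr x \<phi>) \<longleftrightarrow> wf_var L x \<and> wf_trm L \<phi> \<and> ty_of \<phi> = Omega"
| "wf_trm L (App f A B t) \<longleftrightarrow> (f, A, B) \<in> fun_symbols L \<and> wf_trm L t \<and> ty_of t = A"
| "wf_trm L (Tup ts) \<longleftrightarrow> 2 \<le> length ts \<and> (\<forall>t \<in> set ts. wf_trm L t)"
| "wf_trm L (Proj i t) \<longleftrightarrow> wf_trm L t \<and> (\<exists>As. ty_of t = Prod As \<and> i < length As)"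
| "wf_trm L (Eq s t) \<longleftrightarrow> wf_trm L s \<and> wf_trm L t \<and> ty_of s = ty_of t"
| "wf_trm L (Mem s t) \<longleftrightarrow> wf_trm L s \<and> wf_trm L t \<and> ty_of t = Pow (ty_of s)"

definition wf_fm :: "('g, 'f) language \<Rightarrow> ('g, 'f) trm \<Rightarrow> bool" where
  "wf_fm L \<phi> \<longleftrightarrow> wf_trm L \<phi> \<and> ty_of \<phi> = Omega"

fun fv :: "('g, 'f) trm \<Rightarrow> 'g var set" where
  "fv (Var x) = {x}"
| "fv Star = {}"
| "fv (Compr x \<phi>) = fv \<phi> - {x}"
| "fv (App f A B t) = fv t"
| "fv (Tup ts) = (\<Union>t \<in> set ts. fv t)"
| "fv (Proj i t) = fv t"
| "fv (Eq s t) = fv s \<union> fv t"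
| "fv (Mem s t) = fv s \<union> fv t"

text \<open>A number exceeding the index of every variable (of whatever type) in the finite set \<open>V\<close>.\<close>

definition fresh :: "'g var set \<Rightarrow> nat" where
  "fresh V = (LEAST n. \<forall>(m, A) \<in> V. m < n)"

definition fresh_vars :: "'g var set \<Rightarrow> 'g ty list \<Rightarrow> 'g var list" where
  "fresh_vars V As = zip [fresh V ..< fresh V + length As] As"

text \<open>
  Simultaneous capture-avoiding substitution. A bound variable is renamed only if it would
  capture, so on terms that are free for the substituted variables this is literal replacement.
\<close>

fun ssubst :: "('g var \<Rightarrow> ('g, 'f) trm) \<Rightarrow> ('g, 'f) trm \<Rightarrow> ('g, 'f) trm" where
  "ssubst \<theta> (Var x) = \<theta> x"
| "ssubst \<theta> Star = Star"
| "ssubst \<theta> (Compr x \<phi>) =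
    (let V = (\<Union>y \<in> fv \<phi> - {x}. fv (\<theta> y));
         x' = (if x \<in> V then (fresh V, snd x) else x)
     in Compr x' (ssubst (\<theta>(x := Var x')) \<phi>))"
| "ssubst \<theta> (App f A B t) = App f A B (ssubst \<theta> t)"
| "ssubst \<theta> (Tup ts) = Tup (map (ssubst \<theta>) ts)"
| "ssubst \<theta> (Proj i t) = Proj i (ssubst \<theta> t)"
| "ssubst \<theta> (Eq s t) = Eq (ssubst \<theta> s) (ssubst \<theta> t)"
| "ssubst \<theta> (Mem s t) = Mem (ssubst \<theta> s) (ssubst \<theta> t)"

definition subst :: "'g var \<Rightarrow> ('g, 'f) trm \<Rightarrow> ('g, 'f) trm \<Rightarrow> ('g, 'f) trm" where
  "subst x \<sigma> t = ssubst (Var(x := \<sigma>)) t"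

fun prod_ty :: "'g ty list \<Rightarrow> 'g ty" where
  "prod_ty [] = One"
| "prod_ty [A] = A"
| "prod_ty As = Prod As"

fun tup :: "('g, 'f) trm list \<Rightarrow> ('g, 'f) trm" where
  "tup [] = Star"
| "tup [t] = t"
| "tup ts = Tup ts"

section \<open>Logical operations\<close>

definition Iff :: "('g, 'f) trm \<Rightarrow> ('g, 'f) trm \<Rightarrow> ('g, 'f) trm" where
  "Iff \<phi> \<psi> = Eq \<phi> \<psi>"

definition Tru :: "('g, 'f) trm" where
  "Tru = Eq Star Star"

definition And :: "('g, 'f) trm \<Rightarrow> ('g, 'f) trm \<Rightarrow> ('g, 'f) trm" where
  "And \<phi> \<psi> = Eq (Tup [\<phi>, \<psi>]) (Tup [Tru, Tru])"

definition Imp :: "('g, 'f) trm \<Rightarrow> ('g, 'f) trm \<Rightarrow> ('g, 'f) trm" where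
  "Imp \<phi> \<psi> = Iff (And \<phi> \<psi>) \<phi>"

definition Forall :: "'g var \<Rightarrow> ('g, 'f) trm \<Rightarrow> ('g, 'f) trm" where
  "Forall x \<phi> = Eq (Compr x \<phi>) (Compr x Tru)"

definition Fls :: "('g, 'f) trm" where
  "Fls = Forall (0, Omega) (Var (0, Omega))"

definition Neg :: "('g, 'f) trm \<Rightarrow> ('g, 'f) trm" where
  "Neg \<phi> = Imp \<phi> Fls"

definition Or :: "('g, 'f) trm \<Rightarrow> ('g, 'f) trm \<Rightarrow> ('g, 'f) trm" where
  "Or \<phi> \<psi> =
    (let w = (fresh (fv \<phi> \<union> fv \<psi>), Omega)
     in Forall w (Imp (And (Imp \<phi> (Var w)) (Imp \<psi> (Var w))) (Var w)))"

definition Exists :: "'g var \<Rightarrow> ('g, 'f) trm \<Rightarrow> ('g, 'f) trm" where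
  "Exists x \<phi> =
    (let w = (fresh (insert x (fv \<phi>)), Omega)
     in Forall w (Imp (Forall x (Imp \<phi> (Var w))) (Var w)))"

definition Exists1 :: "'g var \<Rightarrow> ('g, 'f) trm \<Rightarrow> ('g, 'f) trm" where
  "Exists1 x \<phi> =
    (let y = (fresh (insert x (fv \<phi>)), snd x)
     in Exists x (And \<phi> (Forall y (Imp (subst x (Var y) \<phi>) (Eq (Var x) (Var y))))))"

definition Forall_in :: "'g var \<Rightarrow> ('g, 'f) trm \<Rightarrow> ('g, 'f) trm \<Rightarrow> ('g, 'f) trm" where
  "Forall_in x X \<phi> = Forall x (Imp (Mem (Var x) X) \<phi>)"

definition Exists_in :: "'g var \<Rightarrow> ('g, 'f) trm \<Rightarrow> ('g, 'f) trm \<Rightarrow> ('g, 'f) trm" where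
  "Exists_in x X \<phi> = Exists x (And (Mem (Var x) X) \<phi>)"

definition Exists1_in :: "'g var \<Rightarrow> ('g, 'f) trm \<Rightarrow> ('g, 'f) trm \<Rightarrow> ('g, 'f) trm" where
  "Exists1_in x X \<phi> = Exists1 x (And (Mem (Var x) X) \<phi>)"

fun Conj :: "('g, 'f) trm list \<Rightarrow> ('g, 'f) trm" where
  "Conj [] = Tru"
| "Conj [\<phi>] = \<phi>"
| "Conj (\<phi> # \<phi>s) = And \<phi> (Conj \<phi>s)"

section \<open>Local set theories\<close>

type_synonym ('g, 'f) sequent = "('g, 'f) trm set \<times> ('g, 'f) trm"

text \<open>
  Because substitution is capture-avoiding, the ``free for'' provisos of the equality axiom and
  of the substitution rule are not needed. The proviso in \<open>cut\<close> is essential: types may be empty.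
\<close>

inductive derives ::
  "('g, 'f) language \<Rightarrow> ('g, 'f) sequent set \<Rightarrow> ('g, 'f) trm set \<Rightarrow> ('g, 'f) trm \<Rightarrow> bool"
  for L :: "('g, 'f) language" and S :: "('g, 'f) sequent set" where
  ax: "(\<Gamma>, \<phi>) \<in> S \<Longrightarrow> derives L S \<Gamma> \<phi>"
| tautology: "wf_fm L \<phi> \<Longrightarrow> derives L S {\<phi>} \<phi>"
| unity: "derives L S {} (Eq (Var (n, One)) Star)"
| equality: "\<lbrakk>wf_var L x; snd y = snd x; snd z = snd x; wf_fm L \<phi>\<rbrakk> \<Longrightarrow>
    derives L S {Eq (Var x) (Var y), subst z (Var x) \<phi>} (subst z (Var y) \<phi>)"
| projection: "\<lbrakk>2 \<le> length xs; \<forall>x \<in> set xs. wf_var L x; i < length xs\<rbrakk> \<Longrightarrow>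
    derives L S {} (Eq (Proj i (Tup (map Var xs))) (Var (xs ! i)))"
| pairing: "\<lbrakk>wf_var L x; snd x = Prod As\<rbrakk> \<Longrightarrow>
    derives L S {} (Eq (Var x) (Tup (map (\<lambda>i. Proj i (Var x)) [0 ..< length As])))"
| comprehension: "\<lbrakk>wf_var L x; wf_fm L \<phi>\<rbrakk> \<Longrightarrow>
    derives L S {} (Iff (Mem (Var x) (Compr x \<phi>)) \<phi>)"
| thinning: "\<lbrakk>derives L S \<Gamma> \<phi>; wf_fm L \<psi>\<rbrakk> \<Longrightarrow> derives L S (insert \<psi> \<Gamma>) \<phi>"
| cut: "\<lbrakk>derives L S \<Gamma> \<phi>; derives L S (insert \<phi> \<Gamma>) \<psi>; fv \<phi> \<subseteq> (\<Union>\<chi> \<in> \<Gamma>. fv \<chi>) \<union> fv \<psi>\<rbrakk> \<Longrightarrow>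
    derives L S \<Gamma> \<psi>"
| substitution: "\<lbrakk>derives L S \<Gamma> \<phi>; wf_trm L \<tau>; ty_of \<tau> = snd x\<rbrakk> \<Longrightarrow>
    derives L S (subst x \<tau> ` \<Gamma>) (subst x \<tau> \<phi>)"
| extensionality: "\<lbrakk>derives L S \<Gamma> (Iff (Mem (Var x) \<sigma>) (Mem (Var x) \<tau>));
    x \<notin> (\<Union>\<chi> \<in> \<Gamma>. fv \<chi>) \<union> fv \<sigma> \<union> fv \<tau>\<rbrakk> \<Longrightarrow>
    derives L S \<Gamma> (Eq \<sigma> \<tau>)"
| equivalence: "\<lbrakk>derives L S (insert \<phi> \<Gamma>) \<psi>; derives L S (insert \<psi> \<Gamma>) \<phi>\<rbrakk> \<Longrightarrow>
    derives L S \<Gamma> (Iff \<phi> \<psi>)"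

definition wf_sequent :: "('g, 'f) language \<Rightarrow> ('g, 'f) sequent \<Rightarrow> bool" where
  "wf_sequent L s \<longleftrightarrow> finite (fst s) \<and> (\<forall>\<chi> \<in> fst s. wf_fm L \<chi>) \<and> wf_fm L (snd s)"

definition local_set_theory :: "('g, 'f) language \<Rightarrow> ('g, 'f) sequent set \<Rightarrow> bool" where
  "local_set_theory L S \<longleftrightarrow>
    (\<forall>s \<in> S. wf_sequent L s) \<and> (\<forall>\<Gamma> \<phi>. derives L S \<Gamma> \<phi> \<longrightarrow> (\<Gamma>, \<phi>) \<in> S)"

definition well_termed :: "('g, 'f) language \<Rightarrow> ('g, 'f) sequent set \<Rightarrow> bool" where
  "well_termed L S \<longleftrightarrow>
    (\<forall>x \<beta>. wf_var L x \<and> wf_fm L \<beta> \<and> derives L S {} (Exists1 x \<beta>) \<longrightarrow>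
      (\<exists>\<tau>. wf_trm L \<tau> \<and> ty_of \<tau> = snd x \<and> fv \<tau> = fv \<beta> - {x} \<and>
        derives L S {} (subst x \<tau> \<beta>)))"

section \<open>Sets and functions of a local set theory\<close>

definition s_set :: "('g, 'f) language \<Rightarrow> ('g, 'f) trm \<Rightarrow> bool" where
  "s_set L X \<longleftrightarrow> wf_trm L X \<and> fv X = {} \<and> (\<exists>A. ty_of X = Pow A)"

abbreviation elem_ty :: "('g, 'f) trm \<Rightarrow> 'g ty" where
  "elem_ty X \<equiv> un_Pow (ty_of X)"

definition Univ :: "'g ty \<Rightarrow> ('g, 'f) trm" where
  "Univ A = Compr (0, A) Tru"

definition Subset :: "('g, 'f) trm \<Rightarrow> ('g, 'f) trm \<Rightarrow> ('g, 'f) trm" where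
  "Subset X Y =
    (let x = (fresh (fv X \<union> fv Y), elem_ty X) in Forall_in x X (Mem (Var x) Y))"

text \<open>
  \<open>Set_of xs t \<phi>\<close> is \<open>{t : \<phi>}\<close>, that is \<open>{z : \<exists>x\<^sub>1 \<dots> \<exists>x\<^sub>n (z = t \<and> \<phi>)}\<close>, where \<open>xs\<close> lists
  the free variables of \<open>t\<close>.
\<close>

definition Set_of :: "'g var list \<Rightarrow> ('g, 'f) trm \<Rightarrow> ('g, 'f) trm \<Rightarrow> ('g, 'f) trm" where
  "Set_of xs t \<phi> =
    (let z = (fresh (set xs \<union> fv t \<union> fv \<phi>), ty_of t)
     in Compr z (foldr Exists xs (And (Eq (Var z) t) \<phi>)))"

definition Prod_set :: "('g, 'f) trm list \<Rightarrow> ('g, 'f) trm" where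
  "Prod_set Xs =
    (let xs = fresh_vars (\<Union>X \<in> set Xs. fv X) (map elem_ty Xs)
     in Set_of xs (tup (map Var xs)) (Conj (map2 (\<lambda>x X. Mem (Var x) X) xs Xs)))"

text \<open>\<open>Fun_set X Y\<close> is \<open>Y\<close> to the power \<open>X\<close>: the set of \<open>w \<subseteq> X \<times> Y\<close> with
  \<open>\<forall>x \<in> X. \<exists>!y \<in> Y. \<langle>x, y\<rangle> \<in> w\<close>.\<close>

definition Fun_set :: "('g, 'f) trm \<Rightarrow> ('g, 'f) trm \<Rightarrow> ('g, 'f) trm" where
  "Fun_set X Y =
    (let n = fresh (fv X \<union> fv Y);
         w = (n, Pow (Prod [elem_ty X, elem_ty Y]));
         x = (n + 1, elem_ty X);
         y = (n + 2, elem_ty Y)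
     in Compr w (And (Subset (Var w) (Prod_set [X, Y]))
          (Forall_in x X (Exists1_in y Y (Mem (Tup [Var x, Var y]) (Var w))))))"

record ('g, 'f) sfun =
  graph :: "('g, 'f) trm"
  src :: "('g, 'f) trm"
  tgt :: "('g, 'f) trm"

definition s_function ::
  "('g, 'f) language \<Rightarrow> ('g, 'f) sequent set \<Rightarrow> ('g, 'f) sfun \<Rightarrow> bool" where
  "s_function L S f \<longleftrightarrow> s_set L (graph f) \<and> s_set L (src f) \<and> s_set L (tgt f) \<and>
    derives L S {} (Mem (graph f) (Fun_set (src f) (tgt f)))"

text \<open>Equality of arrows in the topos of sets: provable equality of all three components.\<close>

definition s_eq ::
  "('g, 'f) language \<Rightarrow> ('g, 'f) sequent set \<Rightarrow> ('g, 'f) sfun \<Rightarrow> ('g, 'f) sfun \<Rightarrow> bool" where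
  "s_eq L S f g \<longleftrightarrow> derives L S {} (Eq (graph f) (graph g)) \<and>
    derives L S {} (Eq (src f) (src g)) \<and> derives L S {} (Eq (tgt f) (tgt g))"

text \<open>\<open>maps_to xs t X Y\<close> is \<open>(\<langle>x\<^sub>1, \<dots>, x\<^sub>n\<rangle> \<mapsto> t) : X \<rightarrow> Y\<close>.\<close>

definition maps_to ::
  "'g var list \<Rightarrow> ('g, 'f) trm \<Rightarrow> ('g, 'f) trm \<Rightarrow> ('g, 'f) trm \<Rightarrow> ('g, 'f) sfun" where
  "maps_to xs t X Y =
    \<lparr>graph = Set_of xs (Tup [tup (map Var xs), t]) (Mem (tup (map Var xs)) X),
     src = X, tgt = Y\<rparr>"

definition s_id :: "('g, 'f) trm \<Rightarrow> ('g, 'f) sfun" where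
  "s_id X = (let x = (fresh (fv X), elem_ty X) in maps_to [x] (Var x) X X)"

definition incl :: "('g, 'f) trm \<Rightarrow> ('g, 'f) sfun" where
  "incl X = (let x = (fresh (fv X), elem_ty X) in maps_to [x] (Var x) X (Univ (elem_ty X)))"

definition s_comp :: "('g, 'f) sfun \<Rightarrow> ('g, 'f) sfun \<Rightarrow> ('g, 'f) sfun" where
  "s_comp g f =
    (let n = fresh (fv (graph f) \<union> fv (graph g));
         x = (n, elem_ty (src f));
         y = (n + 1, elem_ty (tgt f));
         z = (n + 2, elem_ty (tgt g))
     in \<lparr>graph = Set_of [x, z] (Tup [Var x, Var z])
           (Exists y (And (Mem (Tup [Var x, Var y]) (graph f))
                          (Mem (Tup [Var y, Var z]) (graph g)))),
         src = src f, tgt = tgt g\<rparr>)"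

text \<open>The product \<open>f\<^sub>1 \<times> \<dots> \<times> f\<^sub>n\<close>, sending \<open>\<langle>x\<^sub>1, \<dots>, x\<^sub>n\<rangle>\<close> to \<open>\<langle>f\<^sub>1(x\<^sub>1), \<dots>, f\<^sub>n(x\<^sub>n)\<rangle>\<close>.\<close>

definition s_prod :: "('g, 'f) sfun list \<Rightarrow> ('g, 'f) sfun" where
  "s_prod fs =
    (let vs = fresh_vars (\<Union>f \<in> set fs. fv (graph f))
                (map (\<lambda>f. elem_ty (src f)) fs @ map (\<lambda>f. elem_ty (tgt f)) fs);
         xs = take (length fs) vs;
         ys = drop (length fs) vs
     in \<lparr>graph = Set_of vs (Tup [tup (map Var xs), tup (map Var ys)])
           (Conj (map2 (\<lambda>(x, y) f. Mem (Tup [Var x, Var y]) (graph f)) (zip xs ys) fs)),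
         src = Prod_set (map src fs), tgt = Prod_set (map tgt fs)\<rparr>)"

definition s_inverse ::
  "('g, 'f) language \<Rightarrow> ('g, 'f) sequent set \<Rightarrow> ('g, 'f) sfun \<Rightarrow> ('g, 'f) sfun \<Rightarrow> bool" where
  "s_inverse L S f g \<longleftrightarrow> s_function L S f \<and> s_function L S g \<and> src g = tgt f \<and> tgt g = src f \<and>
    s_eq L S (s_comp g f) (s_id (src f)) \<and> s_eq L S (s_comp f g) (s_id (tgt f))"

definition s_bijection ::
  "('g, 'f) language \<Rightarrow> ('g, 'f) sequent set \<Rightarrow> ('g, 'f) sfun \<Rightarrow> bool" where
  "s_bijection L S f \<longleftrightarrow> (\<exists>g. s_inverse L S f g)"

section \<open>Preimage translation\<close>

text \<open>
  For \<open>g : Z \<rightarrow> \<Omega>\<close> the formula \<open>natural g z\<close> implies \<open>z \<in> Z\<close>. Hence translation along a map with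
  domain \<open>P\<close> commutes with \<open>And\<close> and \<open>Or\<close> outright, but with \<open>Imp\<close>, \<open>Iff\<close> and \<open>Neg\<close> only under the
  hypothesis \<open>p \<in> P\<close>.
\<close>

definition natural :: "('g, 'f) sfun \<Rightarrow> ('g, 'f) trm \<Rightarrow> ('g, 'f) trm" where
  "natural g z = Mem (Tup [z, Tru]) (graph g)"

text \<open>\<open>var_list L xs q \<theta>\<close>: the list \<open>x\<^sub>1, \<dots>, x\<^sub>n, q\<close> is admissible for translating \<open>\<theta>\<close>.\<close>

definition var_list ::
  "('g, 'f) language \<Rightarrow> 'g var list \<Rightarrow> 'g var \<Rightarrow> ('g, 'f) trm \<Rightarrow> bool" where
  "var_list L xs q \<theta> \<longleftrightarrow> distinct (xs @ [q]) \<and> (\<forall>y \<in> set (xs @ [q]). wf_var L y) \<and>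
    fv \<theta> \<subseteq> set (xs @ [q])"

text \<open>
  The translation of \<open>\<theta>\<close> along \<open>h : P \<rightarrow> Q\<close> replacing \<open>q\<close> by \<open>p\<close>, formed with the list
  \<open>x\<^sub>1, \<dots>, x\<^sub>n, q\<close>. Products are flat, so the identity on the first \<open>n\<close> factors is given as the
  \<open>n\<close> identities of the universal sets. Note that \<open>p\<close> may also occur among the \<open>x\<^sub>i\<close>.
\<close>

definition preimage ::
  "'g var list \<Rightarrow> 'g var \<Rightarrow> 'g var \<Rightarrow> ('g, 'f) sfun \<Rightarrow> ('g, 'f) trm \<Rightarrow> ('g, 'f) trm" where
  "preimage xs q p h \<theta> =
    (let ids = map (\<lambda>y. s_id (Univ (snd y))) xs
     in natural
          (s_comp (s_comp (maps_to (xs @ [q]) \<theta> (Univ (prod_ty (map snd (xs @ [q])))) (Univ Omega))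
                          (s_prod (ids @ [incl (tgt h)])))
                  (s_prod (ids @ [h])))
          (tup (map Var (xs @ [p]))))"

end

theory Submission
  imports Defs
begin

text \<open>
  Derivability is organised as a Kripke-Joyal style forcing relation: a stage is a finite set of
  hypotheses, its elements are the terms whose variables occur in it, and later stages add hypotheses.
  The clauses for the connectives and quantifiers under an arbitrary environment of terms turn
  derivations into ordinary reasoning about stages. Unwinding composites and products of graphs,
  the translation of \<open>\<theta>\<close> holds at \<open>x\<close> iff locally there is \<open>v\<close> with
  \<open>\<langle>x, v\<rangle> \<in> |f\<^bsup>-1\<^esup>|\<close> and \<open>\<theta>(u/v)\<close>. Such \<open>v\<close> is unique, it exists exactly for \<open>x \<in> X\<close>, and every
  \<open>v\<close> arises from some \<open>x\<close>; all of this follows from the two equations saying that \<open>f\<^bsup>-1\<^esup>\<close> is inverse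
  to \<open>f\<close>. Hence the translation commutes with everything whose truth is determined by later stages.
\<close>

section \<open>Substitution\<close>

text \<open>Two features of the calculus shape the proof. Bound variables are concrete names and no
  rule renames them, so composing two substitutions may change the names in a term. That the results
  are provably equal requires extensionality, and is therefore available only after equality of sets
  has been analysed. For this reason replacement of equals by equals is first proved for contexts
  whose hole lies outside all abstractions, and in general only later. Existence and disjunction are
  encoded by quantifying over truth values. A stage that forces an existential formula thus yields
  no witness there, only the right to assume one at later stages while proving some formula. Every
  decomposition of a composite or a product of graphs is accordingly an elimination rule with an
  arbitrary goal formula. This is enough because the goals that occur (equations, memberships,
  instances of a translation) are themselves formulae.\<close>

lemma finite_fv [simp]: "finite (fv t)"
  by (induction t) auto

lemma less_fresh:
  assumes "finite V" "v \<in> V"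
  shows "fst v < fresh V"
proof -
  \<comment> \<open>The minimum that defines \<open>fresh\<close> ranges over a nonempty set because
    the indices in \<open>V\<close> are bounded.\<close>
  have "\<forall>(m, A) \<in> V. m < Suc (Max (fst ` V))"
    using assms(1) by (metis (no_types, lifting) Max_ge case_prodI2 finite_imageI fst_conv image_eqI le_imp_less_Suc)
  then have "\<forall>(m, A) \<in> V. m < fresh V"
    unfolding fresh_def by (rule LeastI)
  with assms(2) show ?thesis by auto
qed

lemma fresh_notin: "finite V \<Longrightarrow> (fresh V, A) \<notin> V"
  using less_fresh by fastforce

lemma fresh_plus_notin: "finite V \<Longrightarrow> (fresh V + k, A) \<notin> V"
  using less_fresh by fastforce

text \<open>The bound variable that \<open>ssubst\<close> uses below a \<open>Compr\<close>, made a
  constant so that the substituted body can be mentioned without the local definitions of the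
  recursive equation.\<close>

definition binder_renaming :: "('g var \<Rightarrow> ('g, 'f) trm) \<Rightarrow> 'g var \<Rightarrow> ('g, 'f) trm \<Rightarrow> 'g var" where
  "binder_renaming \<theta> x \<phi> =
    (let V = (\<Union>y \<in> fv \<phi> - {x}. fv (\<theta> y)) in if x \<in> V then (fresh V, snd x) else x)"

lemma ssubst_Compr:
  "ssubst \<theta> (Compr x \<phi>) =
    Compr (binder_renaming \<theta> x \<phi>) (ssubst (\<theta>(x := Var (binder_renaming \<theta> x \<phi>))) \<phi>)"
  by (simp add: binder_renaming_def Let_def)

declare ssubst.simps(3) [simp del]

lemma snd_binder_renaming [simp]: "snd (binder_renaming \<theta> x \<phi>) = snd x"
  by (simp add: binder_renaming_def Let_def)

text \<open>A bound variable is kept only when no image contains it, and otherwise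
  \<open>fresh\<close> exceeds every index in the finite set of variables to be avoided.\<close>

lemma binder_renaming_notin:
  assumes "y \<in> fv \<phi>" "y \<noteq> x"
  shows "binder_renaming \<theta> x \<phi> \<notin> fv (\<theta> y)"
proof -
  let ?V = "\<Union>y \<in> fv \<phi> - {x}. fv (\<theta> y)"
  have "binder_renaming \<theta> x \<phi> \<notin> ?V"
    using fresh_notin[of ?V "snd x"] by (auto simp: binder_renaming_def Let_def)
  with assms show ?thesis by auto
qed

text \<open>Literal equality holds because the new bound variable is computed from the images of
  free variables alone, on which both substitutions agree.\<close>

lemma ssubst_cong: "\<forall>y \<in> fv t. \<sigma> y = \<rho> y \<Longrightarrow> ssubst \<sigma> t = ssubst \<rho> t"
proof (induction t arbitrary: \<sigma> \<rho>)
  case (Compr x \<phi>)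
  have eq: "binder_renaming \<sigma> x \<phi> = binder_renaming \<rho> x \<phi>"
    using Compr.prems by (simp add: binder_renaming_def)
  show ?case
    unfolding ssubst_Compr eq using Compr.prems by (simp add: Compr.IH)
next
  case (Tup ts)
  have "ssubst \<sigma> t = ssubst \<rho> t" if "t \<in> set ts" for t
    using that Tup.prems by (intro Tup.IH) simp_all
  then show ?case by simp
next
  case (App f A B t)
  then show ?case by (simp add: App.IH[of \<sigma> \<rho>])
next
  case (Proj i t)
  then show ?case by (simp add: Proj.IH[of \<sigma> \<rho>])
next
  case (Eq s t)
  then show ?case by (simp add: ball_Un Eq.IH[of \<sigma> \<rho>])
next
  case (Mem s t)
  then show ?case by (simp add: ball_Un Mem.IH[of \<sigma> \<rho>])
qed simp_all

lemma ssubst_Var [simp]: "ssubst Var t = t"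
proof (induction t)
  case (Compr x \<phi>)
  have "binder_renaming Var x \<phi> = x"
    by (auto simp: binder_renaming_def Let_def)
  then show ?case by (simp add: ssubst_Compr Compr.IH)
qed (auto simp: map_idI)

lemma ssubst_ident: "\<forall>y \<in> fv t. \<sigma> y = Var y \<Longrightarrow> ssubst \<sigma> t = t"
  using ssubst_cong[of t \<sigma> Var] by simp

lemma ssubst_closed: "fv t = {} \<Longrightarrow> ssubst \<sigma> t = t"
  by (rule ssubst_ident) auto

lemma subst_ident: "x \<notin> fv t \<Longrightarrow> subst x s t = t"
  unfolding subst_def by (rule ssubst_ident) auto

lemma fv_ssubst: "fv (ssubst \<sigma> t) = (\<Union>y \<in> fv t. fv (\<sigma> y))"
proof (induction t arbitrary: \<sigma>)
  case (Compr x \<phi>)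
  let ?x = "binder_renaming \<sigma> x \<phi>"
  have "fv (ssubst \<sigma> (Compr x \<phi>)) = (\<Union>y \<in> fv \<phi>. fv ((\<sigma>(x := Var ?x)) y)) - {?x}"
    by (simp only: ssubst_Compr fv.simps Compr.IH)
  also have "\<dots> = (\<Union>y \<in> fv \<phi> - {x}. fv (\<sigma> y) - {?x})"
    by (auto split: if_splits)
  \<comment> \<open>None of these images contains the new bound variable, so deleting it removes
    nothing.\<close>
  also have "\<dots> = (\<Union>y \<in> fv \<phi> - {x}. fv (\<sigma> y))"
    using binder_renaming_notin[of _ \<phi> x \<sigma>] by (intro SUP_cong refl Diff_insert0[of _ _ "{}", simplified]) simp
  finally show ?case by simp
qed simp_all

lemma ty_of_ssubst:
  "\<forall>y \<in> fv t. ty_of (\<sigma> y) = snd y \<Longrightarrow> ty_of (ssubst \<sigma> t) = ty_of t"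
proof (induction t arbitrary: \<sigma>)
  case (Tup ts)
  have "ty_of (ssubst \<sigma> t) = ty_of t" if "t \<in> set ts" for t
    using that Tup.prems by (intro Tup.IH) simp_all
  then show ?case by simp
qed (simp_all add: ssubst_Compr)

lemma wf_ssubst:
  "wf_trm L t \<Longrightarrow> \<forall>y \<in> fv t. wf_trm L (\<sigma> y) \<and> ty_of (\<sigma> y) = snd y \<Longrightarrow>
    wf_trm L (ssubst \<sigma> t)"
proof (induction t arbitrary: \<sigma>)
  case (Compr x \<phi>)
  let ?\<sigma> = "\<sigma>(x := Var (binder_renaming \<sigma> x \<phi>))"
  have *: "\<forall>y \<in> fv \<phi>. wf_trm L (?\<sigma> y) \<and> ty_of (?\<sigma> y) = snd y"
    using Compr.prems by simp
  then have "ty_of (ssubst ?\<sigma> \<phi>) = ty_of \<phi>"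
    by (intro ty_of_ssubst) simp
  moreover have "wf_trm L (ssubst ?\<sigma> \<phi>)"
    using Compr.prems(1) * by (intro Compr.IH) simp_all
  ultimately show ?case
    using Compr.prems(1) by (simp add: ssubst_Compr)
qed (simp_all add: ty_of_ssubst)

lemma wf_var_fv: "wf_trm L t \<Longrightarrow> v \<in> fv t \<Longrightarrow> wf_var L v"
  by (induction t) auto

lemma wf_ty_ty_of:
  assumes "local_language L"
  shows "wf_trm L t \<Longrightarrow> wf_ty L (ty_of t)"
proof (induction t)
  case (App f A B t)
  then show ?case using assms by (auto simp: local_language_def)
qed auto

lemma fv_subst: "fv (subst z s t) = (fv t - {z}) \<union> (if z \<in> fv t then fv s else {})"
proof -
  have "fv (subst z s t) = (\<Union>y \<in> fv t. if y = z then fv s else {y})"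
    unfolding subst_def fv_ssubst by (rule SUP_cong) simp_all
  then show ?thesis by (auto split: if_splits)
qed

text \<open>Composition of substitutions commutes on the nose only as long as no binder gets renamed.\<close>

fun outside_binders :: "'g var \<Rightarrow> ('g, 'f) trm \<Rightarrow> bool" where
  "outside_binders z (Compr x \<phi>) \<longleftrightarrow> z \<notin> fv (Compr x \<phi>)"
| "outside_binders z (App f A B t) \<longleftrightarrow> outside_binders z t"
| "outside_binders z (Tup ts) \<longleftrightarrow> (\<forall>t \<in> set ts. outside_binders z t)"
| "outside_binders z (Proj i t) \<longleftrightarrow> outside_binders z t"
| "outside_binders z (Eq s t) \<longleftrightarrow> outside_binders z s \<and> outside_binders z t"
| "outside_binders z (Mem s t) \<longleftrightarrow> outside_binders z s \<and> outside_binders z t"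
| "outside_binders z _ \<longleftrightarrow> True"

lemma outside_binders_notin: "z \<notin> fv t \<Longrightarrow> outside_binders z t"
  by (induction t) auto

text \<open>\<open>z\<close> is not free in any outermost abstraction of \<open>t\<close>, so the
  inner substitution leaves these abstractions alone and renames nothing; elsewhere the two
  substitutions compose literally.\<close>

lemma ssubst_subst_Var:
  assumes "outside_binders z t" "x \<notin> fv t"
  shows "ssubst \<rho> (subst z (Var x) t) = ssubst (\<rho>(z := \<rho> x)) t"
  using assms
proof (induction t)
  case (Compr y \<phi>)
  then have "subst z (Var x) (Compr y \<phi>) = Compr y \<phi>"
    by (intro subst_ident) simp
  with Compr.prems show ?case
    by (auto intro: ssubst_cong)
qed (auto simp: subst_def)

lemma subst_subst_Var:
  assumes "outside_binders z t" "x \<notin> fv t"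
  shows "subst x s (subst z (Var x) t) = subst z s t"
  unfolding subst_def[of x] ssubst_subst_Var[OF assms]
  unfolding subst_def using assms by (intro ssubst_cong) auto

lemma obtain_fresh_var:
  fixes V :: "'g var set"
  assumes "finite V"
  obtains z where "z \<notin> V" "snd z = A"
  using fresh_notin[OF assms] by (metis snd_conv)

section \<open>Derivability at a stage\<close>

definition fvs :: "('g, 'f) trm set \<Rightarrow> 'g var set" where
  "fvs \<Gamma> = (\<Union>\<chi> \<in> \<Gamma>. fv \<chi>)"

lemma fvs_mono: "\<Gamma> \<subseteq> \<Delta> \<Longrightarrow> fvs \<Gamma> \<subseteq> fvs \<Delta>"
  by (auto simp: fvs_def)

lemma fvs_insert [simp]: "fvs (insert \<phi> \<Gamma>) = fv \<phi> \<union> fvs \<Gamma>"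
  by (simp add: fvs_def)

lemma fvs_empty [simp]: "fvs {} = {}"
  by (simp add: fvs_def)

lemma fvs_Un [simp]: "fvs (\<Gamma> \<union> \<Delta>) = fvs \<Gamma> \<union> fvs \<Delta>"
  by (simp add: fvs_def)

lemma wf_fm_simps [simp]:
  "wf_fm L (Eq s t) \<longleftrightarrow> wf_trm L s \<and> wf_trm L t \<and> ty_of s = ty_of t"
  "wf_fm L (Mem s t) \<longleftrightarrow> wf_trm L s \<and> wf_trm L t \<and> ty_of t = Pow (ty_of s)"
  "wf_fm L (Var x) \<longleftrightarrow> wf_var L x \<and> snd x = Omega"
  by (auto simp: wf_fm_def)

lemma wf_trm_Compr [simp]: "wf_trm L (Compr x \<phi>) \<longleftrightarrow> wf_var L x \<and> wf_fm L \<phi>"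
  by (simp add: wf_fm_def)

declare wf_trm.simps(3) [simp del]

locale local_set_theory_in =
  fixes L :: "('g, 'f) language" and S :: "('g, 'f) sequent set"
  assumes local_language: "local_language L" and local_set_theory: "local_set_theory L S"
begin

definition stage :: "('g, 'f) trm set \<Rightarrow> bool" where
  "stage \<Gamma> \<longleftrightarrow> finite \<Gamma> \<and> (\<forall>\<chi> \<in> \<Gamma>. wf_fm L \<chi>)"

definition later :: "('g, 'f) trm set \<Rightarrow> ('g, 'f) trm set \<Rightarrow> bool" (infix "\<preceq>" 50) where
  "\<Gamma> \<preceq> \<Delta> \<longleftrightarrow> stage \<Delta> \<and> \<Gamma> \<subseteq> \<Delta>"

definition elt :: "('g, 'f) trm set \<Rightarrow> 'g ty \<Rightarrow> ('g, 'f) trm \<Rightarrow> bool" where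
  "elt \<Gamma> A t \<longleftrightarrow> wf_trm L t \<and> ty_of t = A \<and> fv t \<subseteq> fvs \<Gamma>"

text \<open>
  Types may be empty, so a variable can only be used once it occurs in the sequent. Demanding that
  the variables of the formula occur in the hypotheses makes \<open>cut\<close> unconditional; trivial hypotheses
  \<open>x = x\<close> serve to declare variables.
\<close>

definition forces :: "('g, 'f) trm set \<Rightarrow> ('g, 'f) trm \<Rightarrow> bool" (infix "||-" 50) where
  "\<Gamma> ||- \<phi> \<longleftrightarrow> derives L S \<Gamma> \<phi> \<and> fv \<phi> \<subseteq> fvs \<Gamma>"

lemma derives_wf:
  assumes "derives L S \<Gamma> \<phi>"
  shows "stage \<Gamma>" "wf_fm L \<phi>"
  using assms local_set_theory
  unfolding local_set_theory_def wf_sequent_def stage_def by fastforce+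

lemma forces_stage: "\<Gamma> ||- \<phi> \<Longrightarrow> stage \<Gamma>"
  unfolding forces_def using derives_wf(1) by blast

lemma forces_elt: "\<Gamma> ||- \<phi> \<Longrightarrow> elt \<Gamma> Omega \<phi>"
  unfolding forces_def elt_def using derives_wf(2) wf_fm_def by blast

lemma later_stage: "\<Gamma> \<preceq> \<Delta> \<Longrightarrow> stage \<Delta>"
  by (simp add: later_def)

lemma later_refl [simp]: "\<Gamma> \<preceq> \<Gamma> \<longleftrightarrow> stage \<Gamma>"
  by (simp add: later_def)

lemma later_trans: "\<Gamma> \<preceq> \<Delta> \<Longrightarrow> \<Delta> \<preceq> \<Theta> \<Longrightarrow> \<Gamma> \<preceq> \<Theta>"
  by (auto simp: later_def)

lemma later_insert: "stage \<Gamma> \<Longrightarrow> wf_fm L \<phi> \<Longrightarrow> \<Gamma> \<preceq> insert \<phi> \<Gamma>"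
  by (auto simp: later_def stage_def)

lemma elt_mono: "elt \<Gamma> A t \<Longrightarrow> \<Gamma> \<preceq> \<Delta> \<Longrightarrow> elt \<Delta> A t"
  unfolding elt_def later_def using fvs_mono by blast

lemma wf_fm_elt: "elt \<Gamma> Omega \<phi> \<Longrightarrow> wf_fm L \<phi>"
  by (simp add: elt_def wf_fm_def)

lemma derives_mono:
  assumes "derives L S \<Gamma> \<phi>" "\<Gamma> \<subseteq> \<Delta>" "stage \<Delta>"
  shows "derives L S \<Delta> \<phi>"
proof -
  have "derives L S (\<Gamma> \<union> \<Theta>) \<phi>" if "finite \<Theta>" "\<Theta> \<subseteq> \<Delta>" for \<Theta>
    using that
  proof (induction \<Theta>)
    case empty
    show ?case using assms(1) by simp
  next
    case (insert \<psi> \<Theta>)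
    then have "wf_fm L \<psi>" using assms(3) by (auto simp: stage_def)
    with insert show ?case by (auto intro: thinning)
  qed
  from this[of \<Delta>] assms show ?thesis
    by (auto simp: stage_def Un_absorb1)
qed

lemma forces_mono: "\<Gamma> ||- \<phi> \<Longrightarrow> \<Gamma> \<preceq> \<Delta> \<Longrightarrow> \<Delta> ||- \<phi>"
  unfolding forces_def later_def using derives_mono fvs_mono by blast

lemma forces_theorem: "derives L S {} \<phi> \<Longrightarrow> stage \<Gamma> \<Longrightarrow> fv \<phi> \<subseteq> fvs \<Gamma> \<Longrightarrow> \<Gamma> ||- \<phi>"
  unfolding forces_def using derives_mono by blast

lemma forces_hyp:
  assumes "stage \<Gamma>" "\<phi> \<in> \<Gamma>"
  shows "\<Gamma> ||- \<phi>"
proof -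
  have "derives L S {\<phi>} \<phi>" using assms by (intro tautology) (auto simp: stage_def)
  then have "derives L S \<Gamma> \<phi>" by (rule derives_mono) (use assms in auto)
  then show ?thesis using assms(2) by (auto simp: forces_def fvs_def)
qed

lemma forces_cut:
  assumes "\<Gamma> ||- \<phi>" "insert \<phi> \<Gamma> ||- \<psi>"
  shows "\<Gamma> ||- \<psi>"
  using assms cut[of L S \<Gamma> \<phi> \<psi>] by (auto simp: forces_def fvs_def)

lemma derives_subst_theorem:
  "derives L S {} \<phi> \<Longrightarrow> wf_trm L \<tau> \<Longrightarrow> ty_of \<tau> = snd x \<Longrightarrow> derives L S {} (subst x \<tau> \<phi>)"
  by (drule substitution) auto

text \<open>There is no reflexivity axiom: it comes from transporting \<open>\<pi>\<^sub>0\<langle>x, x\<rangle> = x\<close> along itself.\<close>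

lemma derives_refl:
  assumes "wf_trm L t"
  shows "derives L S {} (Eq t t)"
proof -
  let ?A = "ty_of t"
  define x y z where "x = (0::nat, ?A)" and "y = (1::nat, ?A)" and "z = (2::nat, ?A)"
  have wf: "wf_ty L ?A" using assms local_language by (rule wf_ty_ty_of[rotated])
  have ne: "x \<noteq> y" "x \<noteq> z" "y \<noteq> z" by (auto simp: x_def y_def z_def)
  define p :: "('g, 'f) trm" where "p = Proj 0 (Tup [Var x, Var x])"
  have p: "derives L S {} (Eq p (Var x))"
    using projection[of "[x, x]" L 0 S] wf by (simp add: p_def x_def)
  have "derives L S {Eq (Var y) (Var x), subst z (Var y) (Eq (Var z) (Var x))}
      (subst z (Var x) (Eq (Var z) (Var x)))"
    using wf by (intro derives.equality) (auto simp: x_def y_def z_def)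
  then have "derives L S {Eq (Var y) (Var x)} (Eq (Var x) (Var x))"
    using ne by (simp add: subst_def)
  then have "derives L S (subst y p ` {Eq (Var y) (Var x)}) (subst y p (Eq (Var x) (Var x)))"
    by (rule substitution) (use wf in \<open>auto simp: p_def x_def y_def\<close>)
  then have "derives L S {Eq p (Var x)} (Eq (Var x) (Var x))"
    using ne by (simp add: subst_def)
  \<comment> \<open>The proviso of \<open>cut\<close> is met since \<open>x\<close>, the only
    variable of the cut formula, occurs in the conclusion.\<close>
  with p have "derives L S {} (Eq (Var x) (Var x))"
    by (rule cut) (simp add: p_def)
  then have "derives L S {} (subst x t (Eq (Var x) (Var x)))"
    by (rule derives_subst_theorem) (use assms in \<open>auto simp: x_def\<close>)
  then show ?thesis by (simp add: subst_def)
qed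

lemma forces_refl: "stage \<Gamma> \<Longrightarrow> elt \<Gamma> A t \<Longrightarrow> \<Gamma> ||- Eq t t"
  by (rule forces_theorem) (auto simp: elt_def intro: derives_refl)

definition declare_vars :: "'g var set \<Rightarrow> ('g, 'f) trm set" where
  "declare_vars V = (\<lambda>v. Eq (Var v) (Var v)) ` V"

lemma fvs_declare_vars [simp]: "fvs (declare_vars V) = V"
  by (auto simp: fvs_def declare_vars_def)

lemma stage_declare_vars: "finite V \<Longrightarrow> \<forall>v \<in> V. wf_var L v \<Longrightarrow> stage (declare_vars V)"
  by (auto simp: stage_def declare_vars_def)

text \<open>A declaration \<open>v = v\<close> is provable, so it can be cut away; the proviso of
  \<open>cut\<close> demands that \<open>v\<close> still occurs in the remaining sequent, whence the
  bound on \<open>V\<close>.\<close>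

lemma derives_undeclare:
  assumes "finite V" "\<forall>v \<in> V. wf_var L v" "V \<subseteq> fvs \<Gamma> \<union> fv \<phi>"
    and "derives L S (\<Gamma> \<union> declare_vars V) \<phi>"
  shows "derives L S \<Gamma> \<phi>"
  using assms
proof (induction V)
  case empty
  then show ?case by (simp add: declare_vars_def)
next
  case (insert v V)
  let ?\<Delta> = "\<Gamma> \<union> declare_vars V"
  have "stage ?\<Delta>"
    using derives_wf(1)[OF insert.prems(3)] by (auto simp: stage_def declare_vars_def)
  then have "derives L S ?\<Delta> (Eq (Var v) (Var v))"
    using insert.prems(1) by (intro derives_mono[OF derives_refl]) auto
  moreover have "derives L S (insert (Eq (Var v) (Var v)) ?\<Delta>) \<phi>"
    using insert.prems(3) by (simp add: declare_vars_def)
  ultimately have "derives L S ?\<Delta> \<phi>"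
    by (rule cut) (use insert.prems(2) in \<open>auto simp: fvs_def\<close>)
  then show ?case using insert by simp
qed

text \<open>The passage from stages back to the calculus: declaring the variables of
  \<open>\<phi>\<close> gives a stage to which the assumption applies, and afterwards the
  declarations can be cut away since their variables occur in \<open>\<phi>\<close>.\<close>

lemma derives_forces:
  assumes "stage \<Gamma>" "wf_fm L \<phi>"
    and "\<And>\<Delta>. \<Gamma> \<preceq> \<Delta> \<Longrightarrow> fv \<phi> \<subseteq> fvs \<Delta> \<Longrightarrow> \<Delta> ||- \<phi>"
  shows "derives L S \<Gamma> \<phi>"
proof (rule derives_undeclare)
  have wf: "\<forall>v \<in> fv \<phi>. wf_var L v"
    using assms(2) wf_var_fv unfolding wf_fm_def by blast
  then show "\<forall>v \<in> fv \<phi>. wf_var L v" .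
  have "\<Gamma> \<preceq> \<Gamma> \<union> declare_vars (fv \<phi>)"
    using assms(1) stage_declare_vars[OF _ wf] by (auto simp: later_def stage_def)
  then show "derives L S (\<Gamma> \<union> declare_vars (fv \<phi>)) \<phi>"
    using assms(3) by (simp add: forces_def)
qed auto

text \<open>The axiom \<open>equality\<close> speaks about variables only. It is used for two fresh
  variables, which are then replaced by \<open>s\<close> and \<open>t\<close>; the restriction on
  \<open>z\<close> makes the resulting double substitutions compute literally.\<close>

lemma forces_leibniz_outside_binders:
  assumes "outside_binders z \<phi>" "wf_fm L \<phi>" "ty_of s = snd z"
    and st: "\<Gamma> ||- Eq s t" and s: "\<Gamma> ||- subst z s \<phi>"
  shows "\<Gamma> ||- subst z t \<phi>"
proof -
  define V where "V = insert z (fv \<phi> \<union> fv s \<union> fv t)"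
  define x y where "x = (fresh V, snd z)" and "y = (fresh V + 1, snd z)"
  have "x \<notin> V" "y \<notin> V" "x \<noteq> y"
    unfolding x_def y_def by (rule fresh_notin fresh_plus_notin; simp add: V_def)+ simp
  then have x: "x \<notin> fv \<phi>" "x \<notin> fv s" "x \<notin> fv t" "x \<noteq> z" "z \<noteq> x"
    and y: "y \<notin> fv \<phi>" "y \<notin> fv s" "y \<notin> fv t" "y \<noteq> z" "z \<noteq> y" and xy: "x \<noteq> y" "y \<noteq> x"
    by (auto simp: V_def)
  have wf: "wf_trm L s" "wf_trm L t" "ty_of t = snd z"
    using forces_elt[OF st] assms(3) by (auto simp: elt_def)
  have wz: "wf_ty L (snd z)"
    using wf_ty_ty_of[OF local_language wf(1)] assms(3) by simp
  have 1: "subst x s (subst z (Var x) \<phi>) = subst z s \<phi>"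
    "subst x s (subst z (Var y) \<phi>) = subst z (Var y) \<phi>"
    "subst y t (subst z s \<phi>) = subst z s \<phi>"
    "subst y t (subst z (Var y) \<phi>) = subst z t \<phi>"
    using assms(1) x y xy by (auto intro!: subst_subst_Var subst_ident simp: fv_subst split: if_splits)
  have "derives L S {Eq (Var x) (Var y), subst z (Var x) \<phi>} (subst z (Var y) \<phi>)"
    using wz assms(2) by (intro derives.equality) (auto simp: x_def y_def)
  then have "derives L S (subst x s ` {Eq (Var x) (Var y), subst z (Var x) \<phi>})
      (subst x s (subst z (Var y) \<phi>))"
    by (rule substitution) (use wf assms(3) in \<open>auto simp: x_def\<close>)
  then have "derives L S {Eq s (Var y), subst z s \<phi>} (subst z (Var y) \<phi>)"
    using xy by (simp add: 1) (simp add: subst_def)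
  then have "derives L S (subst y t ` {Eq s (Var y), subst z s \<phi>}) (subst y t (subst z (Var y) \<phi>))"
    by (rule substitution) (use wf in \<open>auto simp: y_def\<close>)
  moreover have "subst y t (Eq s (Var y)) = Eq s t"
    using y subst_ident[of y s t] by (simp add: subst_def)
  ultimately have D: "derives L S {Eq s t, subst z s \<phi>} (subst z t \<phi>)"
    by (simp add: 1)
  have "fv \<phi> - {z} \<subseteq> fvs \<Gamma>" "fv t \<subseteq> fvs \<Gamma>"
    using forces_elt[OF s] forces_elt[OF st] by (auto simp: elt_def fv_subst split: if_splits)
  then have fv: "fv (subst z t \<phi>) \<subseteq> fvs \<Gamma>"
    by (auto simp: fv_subst)
  let ?\<Delta> = "insert (Eq s t) \<Gamma>"
  have \<Delta>: "\<Gamma> \<preceq> ?\<Delta>" "?\<Delta> \<preceq> insert (subst z s \<phi>) ?\<Delta>"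
    using forces_stage[OF st] wf_fm_elt[OF forces_elt[OF st]] wf_fm_elt[OF forces_elt[OF s]]
    by (auto simp: later_def stage_def)
  have "insert (subst z s \<phi>) ?\<Delta> ||- subst z t \<phi>"
    using derives_mono[OF D _ later_stage[OF \<Delta>(2)]] fv by (auto simp: forces_def)
  with forces_mono[OF s \<Delta>(1)] have "?\<Delta> ||- subst z t \<phi>"
    by (rule forces_cut)
  with st show ?thesis by (rule forces_cut)
qed

lemma forces_eqD:
  assumes "\<Gamma> ||- Eq \<phi> \<psi>" "\<Gamma> ||- \<phi>"
  shows "\<Gamma> ||- \<psi>"
proof -
  have "ty_of \<phi> = Omega" using forces_elt[OF assms(2)] by (simp add: elt_def)
  \<comment> \<open>The context is a bare variable of type \<open>Omega\<close>.\<close>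
  then show ?thesis
    using forces_leibniz_outside_binders[of "(0, Omega)" "Var (0, Omega)" \<phi> \<Gamma> \<psi>] assms
    by (simp add: subst_def)
qed

lemma forces_elt_Eq:
  assumes "\<Gamma> ||- Eq s t"
  shows "elt \<Gamma> (ty_of s) s" "elt \<Gamma> (ty_of s) t"
  using forces_elt[OF assms] by (auto simp: elt_def)

lemma forces_sym:
  assumes "\<Gamma> ||- Eq s t"
  shows "\<Gamma> ||- Eq t s"
proof -
  obtain z where z: "z \<notin> fv s" "snd z = ty_of s"
    using obtain_fresh_var[OF finite_fv] by blast
  note st = forces_elt_Eq[OF assms]
  have "\<Gamma> ||- subst z t (Eq (Var z) s)"
  proof (rule forces_leibniz_outside_binders[OF _ _ _ assms])
    show "\<Gamma> ||- subst z s (Eq (Var z) s)"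
      using forces_refl[OF forces_stage[OF assms] st(1)] subst_ident[OF z(1)]
      by (simp add: subst_def)
    show "wf_fm L (Eq (Var z) s)"
      using st(1) z wf_ty_ty_of[OF local_language] by (auto simp: elt_def)
  qed (use z in \<open>auto intro: outside_binders_notin\<close>)
  then show ?thesis using subst_ident[OF z(1), of t] by (simp add: subst_def)
qed

lemma forces_trans:
  assumes "\<Gamma> ||- Eq r s" "\<Gamma> ||- Eq s t"
  shows "\<Gamma> ||- Eq r t"
proof -
  obtain z where z: "z \<notin> fv r" "snd z = ty_of s"
    using obtain_fresh_var[OF finite_fv] by blast
  note st = forces_elt_Eq[OF assms(1)]
  have "\<Gamma> ||- subst z t (Eq r (Var z))"
  proof (rule forces_leibniz_outside_binders[OF _ _ _ assms(2)])
    show "\<Gamma> ||- subst z s (Eq r (Var z))"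
      using assms(1) subst_ident[OF z(1)] by (simp add: subst_def)
    show "wf_fm L (Eq r (Var z))"
      using st z wf_ty_ty_of[OF local_language] by (auto simp: elt_def)
  qed (use z in \<open>auto intro: outside_binders_notin\<close>)
  then show ?thesis using subst_ident[OF z(1), of t] by (simp add: subst_def)
qed

text \<open>Leibniz replacement in the context \<open>C(z/s) = C\<close>, whose instance at
  \<open>s\<close> is reflexivity. Since \<open>z\<close> is not free in \<open>s\<close>, the left
  side does not react to the second substitution.\<close>

lemma forces_cong_outside_binders:
  assumes st: "\<Gamma> ||- Eq s t" and z: "z \<notin> fv s" "snd z = ty_of s"
    and C: "outside_binders z C" "wf_trm L C" "fv C - {z} \<subseteq> fvs \<Gamma>"
  shows "\<Gamma> ||- Eq (subst z s C) (subst z t C)"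
proof -
  let ?C = "subst z s C"
  note elt = forces_elt_Eq[OF st]
  have C': "wf_trm L ?C" "ty_of ?C = ty_of C"
    unfolding subst_def using C(2) z elt wf_var_fv[OF C(2)]
    by (auto simp: elt_def intro!: wf_ssubst ty_of_ssubst)
  have "fv ?C \<subseteq> fvs \<Gamma>"
    using C(3) elt by (auto simp: fv_subst elt_def)
  with C' have "elt \<Gamma> (ty_of C) ?C" by (simp add: elt_def)
  have nz: "z \<notin> fv ?C" using z(1) by (auto simp: fv_subst)
  have "\<Gamma> ||- subst z t (Eq ?C C)"
  proof (rule forces_leibniz_outside_binders[OF _ _ _ st])
    show "\<Gamma> ||- subst z s (Eq ?C C)"
      using forces_refl[OF forces_stage[OF st] \<open>elt \<Gamma> (ty_of C) ?C\<close>] subst_ident[OF nz, of s]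
      by (simp add: subst_def)
  qed (use C C' z outside_binders_notin[OF nz] in auto)
  then show ?thesis using subst_ident[OF nz, of t] by (simp add: subst_def)
qed


section \<open>Congruence rules, and equality analysed type by type\<close>

lemma wf_ty_elt: "elt \<Gamma> A t \<Longrightarrow> wf_ty L A"
  using wf_ty_ty_of[OF local_language] by (auto simp: elt_def)

lemma finite_fvs: "stage \<Gamma> \<Longrightarrow> finite (fvs \<Gamma>)"
  by (simp add: stage_def fvs_def)

lemma forces_cong_App:
  assumes "\<Gamma> ||- Eq s t" "(f, ty_of s, B) \<in> fun_symbols L"
  shows "\<Gamma> ||- Eq (App f (ty_of s) B s) (App f (ty_of s) B t)"
proof -
  obtain z where z: "z \<notin> fv s" "snd z = ty_of s"
    using obtain_fresh_var[OF finite_fv] by blast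
  show ?thesis
    using forces_cong_outside_binders[OF assms(1) z, of "App f (ty_of s) B (Var z)"] assms(2) z
      wf_ty_elt[OF forces_elt_Eq(1)[OF assms(1)]]
    by (simp add: subst_def)
qed

lemma forces_cong_Proj:
  assumes "\<Gamma> ||- Eq s t" "ty_of s = Prod As" "i < length As"
  shows "\<Gamma> ||- Eq (Proj i s) (Proj i t)"
proof -
  obtain z where z: "z \<notin> fv s" "snd z = ty_of s"
    using obtain_fresh_var[OF finite_fv] by blast
  show ?thesis
    using forces_cong_outside_binders[OF assms(1) z, of "Proj i (Var z)"] assms z
      wf_ty_elt[OF forces_elt_Eq(1)[OF assms(1)]]
    by (simp add: subst_def)
qed

lemma forces_cong_Mem:
  assumes st: "\<Gamma> ||- Eq s t" and XY: "\<Gamma> ||- Eq X Y" and ty: "ty_of X = Pow (ty_of s)"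
  shows "\<Gamma> ||- Eq (Mem s X) (Mem t Y)"
proof -
  obtain z where z: "z \<notin> fv s \<union> fv X" "snd z = ty_of s"
    using obtain_fresh_var[of "fv s \<union> fv X"] by auto
  obtain w where w: "w \<notin> fv t \<union> fv X" "snd w = ty_of X"
    using obtain_fresh_var[of "fv t \<union> fv X"] by auto
  note elts = forces_elt_Eq[OF st] forces_elt_Eq[OF XY]
  have "\<Gamma> ||- Eq (subst z s (Mem (Var z) X)) (subst z t (Mem (Var z) X))"
    using z ty elts wf_ty_elt[OF elts(1)]
    by (intro forces_cong_outside_binders[OF st]) (auto simp: elt_def outside_binders_notin)
  then have "\<Gamma> ||- Eq (Mem s X) (Mem t X)"
    using z subst_ident[of z X] by (simp add: subst_def)
  moreover have "\<Gamma> ||- Eq (subst w X (Mem t (Var w))) (subst w Y (Mem t (Var w)))"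
    using w ty elts wf_ty_elt[OF elts(3)]
    by (intro forces_cong_outside_binders[OF XY]) (auto simp: elt_def outside_binders_notin)
  then have "\<Gamma> ||- Eq (Mem t X) (Mem t Y)"
    using w subst_ident[of w t] by (simp add: subst_def)
  ultimately show ?thesis by (rule forces_trans)
qed

lemma forces_cong_Eq:
  assumes st: "\<Gamma> ||- Eq s t" and st': "\<Gamma> ||- Eq s' t'" and ty: "ty_of s = ty_of s'"
  shows "\<Gamma> ||- Eq (Eq s s') (Eq t t')"
proof -
  obtain z where z: "z \<notin> fv s \<union> fv s'" "snd z = ty_of s"
    using obtain_fresh_var[of "fv s \<union> fv s'"] by auto
  obtain w where w: "w \<notin> fv t \<union> fv s'" "snd w = ty_of s'"
    using obtain_fresh_var[of "fv t \<union> fv s'"] by auto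
  note elts = forces_elt_Eq[OF st] forces_elt_Eq[OF st']
  have "\<Gamma> ||- Eq (subst z s (Eq (Var z) s')) (subst z t (Eq (Var z) s'))"
    using z ty elts wf_ty_elt[OF elts(1)]
    by (intro forces_cong_outside_binders[OF st]) (auto simp: elt_def outside_binders_notin)
  then have "\<Gamma> ||- Eq (Eq s s') (Eq t s')"
    using z subst_ident[of z s'] by (simp add: subst_def)
  moreover have "\<Gamma> ||- Eq (subst w s' (Eq t (Var w))) (subst w t' (Eq t (Var w)))"
    using w ty elts wf_ty_elt[OF elts(3)]
    by (intro forces_cong_outside_binders[OF st']) (auto simp: elt_def outside_binders_notin)
  then have "\<Gamma> ||- Eq (Eq t s') (Eq t t')"
    using w subst_ident[of w t] by (simp add: subst_def)
  ultimately show ?thesis by (rule forces_trans)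
qed

lemma forces_Mem_cong:
  assumes "\<Gamma> ||- Mem s X" "\<Gamma> ||- Eq s t" "\<Gamma> ||- Eq X Y"
  shows "\<Gamma> ||- Mem t Y"
  using forces_elt[OF assms(1)]
  by (intro forces_eqD[OF forces_cong_Mem[OF assms(2,3)] assms(1)]) (simp add: elt_def)

lemma elt_Tup:
  "elt \<Gamma> (Prod As) (Tup ts) \<longleftrightarrow> 2 \<le> length ts \<and> list_all2 (elt \<Gamma>) As ts"
proof
  assume "elt \<Gamma> (Prod As) (Tup ts)"
  then show "2 \<le> length ts \<and> list_all2 (elt \<Gamma>) As ts"
    by (force simp: elt_def list_all2_conv_all_nth)
next
  assume "2 \<le> length ts \<and> list_all2 (elt \<Gamma>) As ts"
  then show "elt \<Gamma> (Prod As) (Tup ts)"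
    by (auto simp: elt_def list_all2_conv_all_nth in_set_conv_nth subset_iff intro!: nth_equalityI; blast)
qed

text \<open>The components are exchanged one at a time, along tuples that begin with terms of
  \<open>ts\<close> and end with terms of \<open>ss\<close>; each exchange is a congruence in a
  context with a single hole.\<close>

lemma forces_cong_Tup:
  assumes len: "length ts = length ss" "2 \<le> length ss"
    and eq: "\<And>i. i < length ss \<Longrightarrow> \<Gamma> ||- Eq (ss ! i) (ts ! i)"
  shows "\<Gamma> ||- Eq (Tup ss) (Tup ts)"
proof -
  note elts = forces_elt_Eq[OF eq]
  have ss: "elt \<Gamma> (Prod (map ty_of ss)) (Tup ss)"
    using len elts(1) by (simp add: elt_Tup list_all2_conv_all_nth)
  have st: "stage \<Gamma>" using forces_stage[OF eq[of 0]] len by fastforce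
  have wfs: "wf_trm L t" "fv t \<subseteq> fvs \<Gamma>" if "t \<in> set ss \<union> set ts" for t
    using that elts len by (auto simp: in_set_conv_nth elt_def)
  have "\<Gamma> ||- Eq (Tup ss) (Tup (take k ts @ drop k ss))" if "k \<le> length ss" for k
    using that
  proof (induction k)
    case 0
    show ?case using forces_refl[OF st ss] by simp
  next
    case (Suc k)
    have "finite (\<Union>t \<in> set ss \<union> set ts. fv t)" by simp
    then obtain z where z: "z \<notin> (\<Union>t \<in> set ss \<union> set ts. fv t)" "snd z = ty_of (ss ! k)"
      by (rule obtain_fresh_var)
    define C where "C = Tup (take k ts @ Var z # drop (Suc k) ss)"
    have sub: "set (take k ts) \<subseteq> set ts" "set (drop (Suc k) ss) \<subseteq> set ss"
      by (rule set_take_subset set_drop_subset)+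
    have id: "subst z r t = t" if "t \<in> set (take k ts) \<union> set (drop (Suc k) ss)" for r t
      using that z sub by (intro subst_ident) blast
    have C: "subst z r C = Tup (take k ts @ r # drop (Suc k) ss)" for r
      using id by (simp add: C_def subst_def map_idI)
    have "\<Gamma> ||- Eq (subst z (ss ! k) C) (subst z (ts ! k) C)"
    proof (rule forces_cong_outside_binders[OF eq])
      show "z \<notin> fv (ss ! k)" using z Suc.prems by (metis UN_I UnI1 Suc_le_lessD nth_mem)
      show "outside_binders z C"
        using z sub by (auto simp: C_def intro!: outside_binders_notin)
      show "wf_trm L C"
        using Suc.prems len z wfs sub wf_ty_elt[OF elts(1)[of k]] by (auto simp: C_def)
      show "fv C - {z} \<subseteq> fvs \<Gamma>"
        using wfs(2) sub by (simp add: C_def) blast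
    qed (use Suc.prems z in auto)
    moreover have "ss ! k # drop (Suc k) ss = drop k ss"
      using Suc.prems by (simp add: Cons_nth_drop_Suc)
    moreover have "take k ts @ ts ! k # drop (Suc k) ss = take (Suc k) ts @ drop (Suc k) ss"
      using Suc.prems len by (simp add: take_Suc_conv_app_nth)
    ultimately have "\<Gamma> ||- Eq (Tup (take k ts @ drop k ss)) (Tup (take (Suc k) ts @ drop (Suc k) ss))"
      by (simp add: C)
    with Suc show ?case by (blast intro: forces_trans Suc_leD)
  qed
  from this[of "length ss"] len show ?thesis by simp
qed

text \<open>The axiom \<open>projection\<close> covers tuples of variables only. The variables are
  replaced by the terms one after another; they are fresh for all of \<open>ts\<close>, so a later
  replacement does not disturb a term already inserted.\<close>

lemma derives_Proj_Tup:
  assumes "wf_trm L (Tup ts)" "i < length ts"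
  shows "derives L S {} (Eq (Proj i (Tup ts)) (ts ! i))"
proof -
  let ?n = "length ts"
  define N where "N = fresh (fv (Tup ts))"
  define xs where "xs = zip [N ..< N + ?n] (map ty_of ts)"
  have len: "length xs = ?n" by (simp add: xs_def)
  have nth: "xs ! k = (N + k, ty_of (ts ! k))" if "k < ?n" for k
    using that by (simp add: xs_def)
  have new: "xs ! k \<notin> fv t" if "k < ?n" "t \<in> set ts" for k t
  proof -
    have "xs ! k \<notin> fv (Tup ts)"
      unfolding nth[OF that(1)] N_def by (rule fresh_plus_notin) simp
    with that(2) show ?thesis by simp
  qed
  define mix :: "nat \<Rightarrow> ('g, 'f) trm list" where "mix k = take k ts @ map Var (drop k xs)" for k
  have "derives L S {} (Eq (Proj i (Tup (mix k))) (mix k ! i))" if "k \<le> ?n" for k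
    using that
  proof (induction k)
    case 0
    have "\<forall>x \<in> set xs. wf_var L x"
      using assms(1) nth len wf_ty_ty_of[OF local_language]
      by (metis in_set_conv_nth snd_conv wf_trm.simps(5))
    then have "derives L S {} (Eq (Proj i (Tup (map Var xs))) (Var (xs ! i)))"
      using assms len by (intro projection) auto
    then show ?case using assms(2) len by (simp add: mix_def)
  next
    case (Suc k)
    have step: "map (subst (xs ! k) (ts ! k)) (mix k) = mix (Suc k)"
    proof (rule nth_equalityI)
      fix j assume j: "j < length (map (subst (xs ! k) (ts ! k)) (mix k))"
      then have "j < ?n" using Suc.prems len by (simp add: mix_def)
      consider "j < k" | "j = k" | "j > k" by linarith
      then show "map (subst (xs ! k) (ts ! k)) (mix k) ! j = mix (Suc k) ! j"
      proof cases
        case 1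
        then show ?thesis
          using j \<open>j < ?n\<close> Suc.prems len new[of k "ts ! j"]
          by (simp add: mix_def nth_append subst_ident)
      next
        case 2
        then show ?thesis
          using j \<open>j < ?n\<close> Suc.prems len by (simp add: mix_def nth_append subst_def)
      next
        case 3
        then have "xs ! j \<noteq> xs ! k" using nth \<open>j < ?n\<close> Suc.prems by simp
        with 3 show ?thesis
          using j \<open>j < ?n\<close> Suc.prems len by (simp add: mix_def nth_append subst_def)
      qed
    qed (use Suc.prems len in \<open>simp add: mix_def\<close>)
    have "derives L S {} (subst (xs ! k) (ts ! k) (Eq (Proj i (Tup (mix k))) (mix k ! i)))"
      using Suc assms nth by (intro derives_subst_theorem) auto
    moreover have "i < length (mix k)" using assms(2) len Suc.prems by (simp add: mix_def)
    then have "subst (xs ! k) (ts ! k) (mix k ! i) = mix (Suc k) ! i"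
      using step by (metis nth_map)
    ultimately show ?case
      using step by (simp add: subst_def[abs_def])
  qed
  from this[of ?n] len show ?thesis by (simp add: mix_def)
qed

lemma forces_Tup_eq_iff:
  assumes "stage \<Gamma>" "elt \<Gamma> (Prod As) (Tup ss)" "elt \<Gamma> (Prod As) (Tup ts)"
  shows "\<Gamma> ||- Eq (Tup ss) (Tup ts) \<longleftrightarrow> (\<forall>i < length ss. \<Gamma> ||- Eq (ss ! i) (ts ! i))"
proof
  have len: "length ss = length As" "length ts = length As" "2 \<le> length As"
    using assms(2,3) by (auto simp: elt_Tup dest: list_all2_lengthD)
  show "\<Gamma> ||- Eq (Tup ss) (Tup ts)" if "\<forall>i < length ss. \<Gamma> ||- Eq (ss ! i) (ts ! i)"
    using that len by (intro forces_cong_Tup) auto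
  show "\<forall>i < length ss. \<Gamma> ||- Eq (ss ! i) (ts ! i)" if eq: "\<Gamma> ||- Eq (Tup ss) (Tup ts)"
  proof (intro allI impI)
    fix i assume i: "i < length ss"
    have "\<Gamma> ||- Eq (Proj i (Tup rs)) (rs ! i)" if "elt \<Gamma> (Prod As) (Tup rs)" "i < length rs" for rs
    proof (rule forces_theorem)
      show "derives L S {} (Eq (Proj i (Tup rs)) (rs ! i))"
        using that by (intro derives_Proj_Tup) (simp_all add: elt_def)
      have "elt \<Gamma> (As ! i) (rs ! i)"
        using that by (simp add: elt_Tup list_all2_nthD2)
      then show "fv (Eq (Proj i (Tup rs)) (rs ! i)) \<subseteq> fvs \<Gamma>"
        using that by (simp add: elt_def)
    qed (rule assms(1))
    note proj = this[OF assms(2) i] this[OF assms(3)]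
    have "\<Gamma> ||- Eq (Proj i (Tup ss)) (Proj i (Tup ts))"
      using i by (intro forces_cong_Proj[OF eq]) auto
    then show "\<Gamma> ||- Eq (ss ! i) (ts ! i)"
      using proj i len forces_trans forces_sym by metis
  qed
qed

text \<open>Adding \<open>\<phi>\<close> or \<open>\<psi>\<close> as a hypothesis gives the generic
  stage at which it holds, and agreement at these two stages supplies the premises of the rule
  \<open>equivalence\<close>.\<close>

lemma forces_eq_Omega_iff:
  assumes "stage \<Gamma>" "elt \<Gamma> Omega \<phi>" "elt \<Gamma> Omega \<psi>"
  shows "\<Gamma> ||- Eq \<phi> \<psi> \<longleftrightarrow> (\<forall>\<Delta>. \<Gamma> \<preceq> \<Delta> \<longrightarrow> (\<Delta> ||- \<phi> \<longleftrightarrow> \<Delta> ||- \<psi>))"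
proof
  show "\<forall>\<Delta>. \<Gamma> \<preceq> \<Delta> \<longrightarrow> (\<Delta> ||- \<phi> \<longleftrightarrow> \<Delta> ||- \<psi>)" if "\<Gamma> ||- Eq \<phi> \<psi>"
    using forces_mono[OF that] forces_eqD forces_sym by meson
  assume *: "\<forall>\<Delta>. \<Gamma> \<preceq> \<Delta> \<longrightarrow> (\<Delta> ||- \<phi> \<longleftrightarrow> \<Delta> ||- \<psi>)"
  have "\<Gamma> \<preceq> insert \<phi> \<Gamma>" "\<Gamma> \<preceq> insert \<psi> \<Gamma>"
    using assms later_insert wf_fm_elt by blast+
  with * have "insert \<phi> \<Gamma> ||- \<psi>" "insert \<psi> \<Gamma> ||- \<phi>"
    using forces_hyp later_stage by blast+
  then have "derives L S \<Gamma> (Iff \<phi> \<psi>)"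
    by (intro equivalence) (auto simp: forces_def)
  with assms show "\<Gamma> ||- Eq \<phi> \<psi>"
    by (simp add: forces_def Iff_def elt_def)
qed

text \<open>A fresh variable, declared by adding \<open>z = z\<close>, is a generic element:
  agreement on it yields the premise of \<open>extensionality\<close>. The declaration can be cut
  away because \<open>z\<close> occurs in the equation of the two membership formulae.\<close>

lemma forces_set_eq_iff:
  assumes "stage \<Gamma>" "elt \<Gamma> (Pow A) X" "elt \<Gamma> (Pow A) Y"
  shows "\<Gamma> ||- Eq X Y \<longleftrightarrow> (\<forall>\<Delta> s. \<Gamma> \<preceq> \<Delta> \<longrightarrow> elt \<Delta> A s \<longrightarrow> (\<Delta> ||- Mem s X \<longleftrightarrow> \<Delta> ||- Mem s Y))"
proof
  show "\<forall>\<Delta> s. \<Gamma> \<preceq> \<Delta> \<longrightarrow> elt \<Delta> A s \<longrightarrow> (\<Delta> ||- Mem s X \<longleftrightarrow> \<Delta> ||- Mem s Y)" if "\<Gamma> ||- Eq X Y"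
    using that by (meson forces_Mem_cong forces_mono forces_refl forces_sym later_stage)
  assume *: "\<forall>\<Delta> s. \<Gamma> \<preceq> \<Delta> \<longrightarrow> elt \<Delta> A s \<longrightarrow> (\<Delta> ||- Mem s X \<longleftrightarrow> \<Delta> ||- Mem s Y)"
  obtain z where z: "z \<notin> fvs \<Gamma>" "snd z = A"
    using obtain_fresh_var[OF finite_fvs[OF assms(1)]] by blast
  have wf: "wf_ty L A" using wf_ty_elt[OF assms(2)] by simp
  let ?\<Delta> = "\<Gamma> \<union> declare_vars {z}"
  have \<Delta>: "\<Gamma> \<preceq> ?\<Delta>"
    using assms(1) wf z(2) by (auto simp: later_def stage_def declare_vars_def)
  have zelt: "elt ?\<Delta> A (Var z)" using z wf by (simp add: elt_def)
  have mem: "elt ?\<Delta> Omega (Mem (Var z) X)" "elt ?\<Delta> Omega (Mem (Var z) Y)"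
    using zelt assms(2,3) by (auto simp: elt_def)
  have "?\<Delta> ||- Eq (Mem (Var z) X) (Mem (Var z) Y)"
    unfolding forces_eq_Omega_iff[OF later_stage[OF \<Delta>] mem]
    using * later_trans[OF \<Delta>] elt_mono[OF zelt] by blast
  then have "derives L S \<Gamma> (Eq (Mem (Var z) X) (Mem (Var z) Y))"
    using wf by (intro derives_undeclare[of "{z}" \<Gamma>]) (simp_all add: wf z(2) forces_def)
  then have "derives L S \<Gamma> (Eq X Y)"
    using z assms(2,3) by (intro extensionality[of L S \<Gamma> z]) (auto simp: Iff_def elt_def fvs_def)
  then show "\<Gamma> ||- Eq X Y" using assms(2,3) by (simp add: forces_def elt_def)
qed

text \<open>The axiom \<open>comprehension\<close> treats only the bound variable itself;
  substituting \<open>s\<close> for \<open>x\<close> does not affect the set, in which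
  \<open>x\<close> is not free.\<close>

lemma forces_Mem_Compr_iff:
  assumes "stage \<Gamma>" "wf_fm L \<phi>" "elt \<Gamma> (snd x) s" "fv \<phi> - {x} \<subseteq> fvs \<Gamma>"
  shows "\<Gamma> ||- Mem s (Compr x \<phi>) \<longleftrightarrow> \<Gamma> ||- subst x s \<phi>"
proof -
  have wf: "wf_var L x" using wf_ty_elt[OF assms(3)] .
  have "derives L S {} (subst x s (Eq (Mem (Var x) (Compr x \<phi>)) \<phi>))"
    using comprehension[OF wf assms(2), of S] assms(3)
    by (intro derives_subst_theorem) (auto simp: elt_def Iff_def)
  moreover have "subst x s (Compr x \<phi>) = Compr x \<phi>"
    by (rule subst_ident) simp
  ultimately have "derives L S {} (Eq (Mem s (Compr x \<phi>)) (subst x s \<phi>))"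
    by (simp add: subst_def)
  then have "\<Gamma> ||- Eq (Mem s (Compr x \<phi>)) (subst x s \<phi>)"
    using assms by (intro forces_theorem) (auto simp: elt_def fv_subst split: if_splits)
  then show ?thesis using forces_eqD forces_sym by blast
qed


section \<open>Environments and the composition of substitutions\<close>

definition typed :: "('g var \<Rightarrow> ('g, 'f) trm) \<Rightarrow> 'g var set \<Rightarrow> bool" where
  "typed \<sigma> W \<longleftrightarrow> (\<forall>y \<in> W. wf_trm L (\<sigma> y) \<and> ty_of (\<sigma> y) = snd y)"

definition env :: "('g, 'f) trm set \<Rightarrow> ('g var \<Rightarrow> ('g, 'f) trm) \<Rightarrow> 'g var set \<Rightarrow> bool" where
  "env \<Gamma> \<sigma> W \<longleftrightarrow> (\<forall>y \<in> W. elt \<Gamma> (snd y) (\<sigma> y))"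

lemma env_typed: "env \<Gamma> \<sigma> W \<Longrightarrow> typed \<sigma> W"
  by (simp add: env_def typed_def elt_def)

lemma env_mono: "env \<Gamma> \<sigma> W \<Longrightarrow> \<Gamma> \<preceq> \<Delta> \<Longrightarrow> env \<Delta> \<sigma> W"
  unfolding env_def using elt_mono by blast

lemma env_subset: "env \<Gamma> \<sigma> W \<Longrightarrow> W' \<subseteq> W \<Longrightarrow> env \<Gamma> \<sigma> W'"
  by (auto simp: env_def)

lemma env_upd: "env \<Gamma> \<sigma> (W - {x}) \<Longrightarrow> elt \<Gamma> (snd x) t \<Longrightarrow> env \<Gamma> (\<sigma>(x := t)) W"
  by (simp add: env_def)

lemma elt_ssubst: "wf_trm L t \<Longrightarrow> env \<Gamma> \<sigma> (fv t) \<Longrightarrow> elt \<Gamma> (ty_of t) (ssubst \<sigma> t)"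
  by (simp add: env_def elt_def fv_ssubst wf_ssubst ty_of_ssubst UN_subset_iff)

lemma elt_ssubst_fm: "wf_fm L \<phi> \<Longrightarrow> env \<Gamma> \<sigma> (fv \<phi>) \<Longrightarrow> elt \<Gamma> Omega (ssubst \<sigma> \<phi>)"
  using elt_ssubst[of \<phi> \<Gamma> \<sigma>] by (simp add: wf_fm_def)

lemma typed_Var: "wf_trm L t \<Longrightarrow> typed Var (fv t)"
  using wf_var_fv[of L t] by (simp add: typed_def)

lemma wf_ssubst_typed:
  assumes "wf_trm L t" "typed \<sigma> (fv t)"
  shows "wf_trm L (ssubst \<sigma> t)" "ty_of (ssubst \<sigma> t) = ty_of t"
  using assms by (simp_all add: typed_def wf_ssubst ty_of_ssubst)

text \<open>
  Composition of substitutions holds only up to renaming of bound variables, hence as a provable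
  equality of terms.
\<close>

definition composes :: "('g, 'f) trm \<Rightarrow> bool" where
  "composes t \<longleftrightarrow> (\<forall>\<sigma> \<rho>. typed \<sigma> (fv t) \<longrightarrow> typed \<rho> (\<Union>y \<in> fv t. fv (\<sigma> y)) \<longrightarrow>
    derives L S {} (Eq (ssubst \<rho> (ssubst \<sigma> t)) (ssubst (\<lambda>y. ssubst \<rho> (\<sigma> y)) t)))"

lemma composesD:
  "composes t \<Longrightarrow> typed \<sigma> (fv t) \<Longrightarrow> typed \<rho> (\<Union>y \<in> fv t. fv (\<sigma> y)) \<Longrightarrow>
    derives L S {} (Eq (ssubst \<rho> (ssubst \<sigma> t)) (ssubst (\<lambda>y. ssubst \<rho> (\<sigma> y)) t))"
  by (simp add: composes_def)

lemma derives_eq_forces_iff: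
  assumes "derives L S {} (Eq \<phi> \<psi>)" "stage \<Gamma>" "fv \<phi> \<subseteq> fvs \<Gamma>" "fv \<psi> \<subseteq> fvs \<Gamma>"
  shows "\<Gamma> ||- \<phi> \<longleftrightarrow> \<Gamma> ||- \<psi>"
  using forces_theorem[OF assms(1,2)] assms(3,4) forces_eqD forces_sym by (metis Un_least fv.simps(7))

text \<open>The substitution has already renamed the bound variable to \<open>x'\<close>, so
  instantiating it by \<open>s\<close> is a second substitution; \<open>composes\<close> merges the
  two. It is a hypothesis on \<open>\<phi>\<close> because this lemma enters the induction that
  establishes \<open>composes\<close>.\<close>

lemma forces_Mem_ssubst_Compr_composes:
  assumes C: "composes \<phi>" and "stage \<Gamma>" "wf_fm L \<phi>" "env \<Gamma> \<sigma> (fv \<phi> - {x})" "elt \<Gamma> (snd x) s"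
  shows "\<Gamma> ||- Mem s (ssubst \<sigma> (Compr x \<phi>)) \<longleftrightarrow> \<Gamma> ||- ssubst (\<sigma>(x := s)) \<phi>"
proof -
  define x' where "x' = binder_renaming \<sigma> x \<phi>"
  have x': "snd x' = snd x" by (simp add: x'_def)
  have new: "x' \<notin> fv (\<sigma> y)" if "y \<in> fv \<phi>" "y \<noteq> x" for y
    unfolding x'_def using that by (rule binder_renaming_notin)
  let ?\<sigma> = "\<sigma>(x := Var x')" and ?\<rho> = "Var(x' := s)"
  have s: "wf_trm L s" "ty_of s = snd x" using assms(5) by (auto simp: elt_def)
  have wx: "wf_ty L (snd x)" using wf_ty_elt[OF assms(5)] .
  have ty: "typed ?\<sigma> (fv \<phi>)"
    using env_typed[OF assms(4)] wx x' by (simp add: typed_def)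
  have wf: "wf_fm L (ssubst ?\<sigma> \<phi>)"
    using wf_ssubst_typed[OF _ ty] assms(3) by (simp add: wf_fm_def)
  have tr: "typed ?\<rho> (\<Union>y \<in> fv \<phi>. fv (?\<sigma> y))"
    using typed_Var[of "ssubst ?\<sigma> \<phi>"] wf s x' by (simp add: typed_def wf_fm_def fv_ssubst)
  have eq: "ssubst (\<lambda>y. ssubst ?\<rho> (?\<sigma> y)) \<phi> = ssubst (\<sigma>(x := s)) \<phi>"
    using new subst_ident[of x' _ s] by (intro ssubst_cong) (simp add: subst_def)
  have fv: "fv (ssubst (\<sigma>(x := s)) \<phi>) \<subseteq> fvs \<Gamma>"
    using elt_ssubst_fm[OF assms(3) env_upd[OF assms(4,5)]] by (simp add: elt_def)
  have D: "derives L S {} (Eq (subst x' s (ssubst ?\<sigma> \<phi>)) (ssubst (\<sigma>(x := s)) \<phi>))"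
    using composesD[OF C ty tr] unfolding eq subst_def .
  have fv': "fv (subst x' s (ssubst ?\<sigma> \<phi>)) = fv (ssubst (\<sigma>(x := s)) \<phi>)"
    unfolding eq[symmetric] by (simp add: subst_def fv_ssubst)
  have fvc: "fv (ssubst ?\<sigma> \<phi>) - {x'} \<subseteq> fvs \<Gamma>"
    using assms(4) by (auto simp: fv_ssubst env_def elt_def split: if_splits; blast)
  have "\<Gamma> ||- Mem s (ssubst \<sigma> (Compr x \<phi>)) \<longleftrightarrow> \<Gamma> ||- subst x' s (ssubst ?\<sigma> \<phi>)"
    unfolding ssubst_Compr x'_def[symmetric]
    using assms(2,5) wf fvc x' by (intro forces_Mem_Compr_iff) auto
  also have "\<dots> \<longleftrightarrow> \<Gamma> ||- ssubst (\<sigma>(x := s)) \<phi>"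
    using derives_eq_forces_iff[OF D assms(2)] fv fv' by simp
  finally show ?thesis .
qed

lemma typed_comp:
  assumes "typed \<sigma> W" "typed \<rho> (\<Union>y \<in> W. fv (\<sigma> y))"
  shows "typed (\<lambda>y. ssubst \<rho> (\<sigma> y)) W"
  unfolding typed_def
proof
  fix y assume "y \<in> W"
  then have "wf_trm L (\<sigma> y)" "ty_of (\<sigma> y) = snd y" "typed \<rho> (fv (\<sigma> y))"
    using assms unfolding typed_def by blast+
  then show "wf_trm L (ssubst \<rho> (\<sigma> y)) \<and> ty_of (ssubst \<rho> (\<sigma> y)) = snd y"
    by (simp add: wf_ssubst_typed)
qed

text \<open>Both sides are sets, compared by their members at later stages, which removes the
  abstractions and with them the differing bound variables. Three uses of the hypothesis on
  \<open>\<phi>\<close> then bring both memberships to the same instance of the body.\<close>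

lemma composes_Compr:
  assumes C: "composes \<phi>" and wf: "wf_fm L \<phi>" and wx: "wf_var L x"
  shows "composes (Compr x \<phi>)"
  unfolding composes_def
proof (intro allI impI)
  fix \<sigma> \<rho>
  assume ts: "typed \<sigma> (fv (Compr x \<phi>))" and tr: "typed \<rho> (\<Union>y \<in> fv (Compr x \<phi>). fv (\<sigma> y))"
  let ?c = "\<lambda>y. ssubst \<rho> (\<sigma> y)"
  let ?l = "ssubst \<rho> (ssubst \<sigma> (Compr x \<phi>))" and ?r = "ssubst ?c (Compr x \<phi>)"
  have wfc: "wf_trm L (Compr x \<phi>)" using wf wx by simp
  have tr': "typed \<rho> (fv (ssubst \<sigma> (Compr x \<phi>)))" using tr by (simp add: fv_ssubst)
  have tc: "typed ?c (fv (Compr x \<phi>))"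
    using ts tr by (rule typed_comp)
  have wfl: "wf_trm L ?l" "ty_of ?l = Pow (snd x)"
    using wf_ssubst_typed[OF wf_ssubst_typed(1)[OF wfc ts] tr'] wf_ssubst_typed(2)[OF wfc ts] by simp_all
  have wfr: "wf_trm L ?r" "ty_of ?r = Pow (snd x)"
    using wf_ssubst_typed[OF wfc tc] by simp_all
  have fvlr: "fv ?l = fv ?r" by (simp add: fv_ssubst)
  define x' where "x' = binder_renaming \<sigma> x \<phi>"
  define \<phi>' where "\<phi>' = ssubst (\<sigma>(x := Var x')) \<phi>"
  define x'' where "x'' = binder_renaming \<rho> x' \<phi>'"
  have snds: "snd x' = snd x" "snd x'' = snd x" by (simp_all add: x'_def x''_def)
  have l: "?l = Compr x'' (ssubst (\<rho>(x' := Var x'')) \<phi>')"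
    unfolding ssubst_Compr x'_def[symmetric] \<phi>'_def[symmetric] x''_def[symmetric] ..
  have new': "x' \<notin> fv (\<sigma> y)" if "y \<in> fv \<phi>" "y \<noteq> x" for y
    unfolding x'_def using that by (rule binder_renaming_notin)
  have fv\<phi>': "z \<in> fv \<phi>'" if "y \<in> fv \<phi>" "y \<noteq> x" "z \<in> fv (\<sigma> y)" for y z
    unfolding \<phi>'_def fv_ssubst using that by (intro UN_I[of y]) auto
  have new'': "x'' \<notin> fv (\<rho> z)" if "y \<in> fv \<phi>" "y \<noteq> x" "z \<in> fv (\<sigma> y)" for y z
    unfolding x''_def using fv\<phi>'[OF that] new'[OF that(1,2)] that(3)
    by (intro binder_renaming_notin) auto
  let ?\<sigma>1 = "\<sigma>(x := Var x')" and ?\<rho>1 = "\<rho>(x' := Var x'')"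
  let ?c1 = "\<lambda>y. ssubst ?\<rho>1 (?\<sigma>1 y)"
  have ts1: "typed ?\<sigma>1 (fv \<phi>)"
    using ts wx snds by (simp add: typed_def)
  have tr1: "typed ?\<rho>1 (\<Union>y \<in> fv \<phi>. fv (?\<sigma>1 y))"
    using tr wx snds by (simp add: typed_def)
  \<comment> \<open>Since \<open>x'\<close> occurs in no image under \<open>\<sigma>\<close> of
    another free variable of the body, the update of \<open>\<rho>\<close> at \<open>x'\<close> is
    visible only at \<open>x\<close>.\<close>
  have c1: "?c1 y = (?c(x := Var x'')) y" if "y \<in> fv \<phi>" for y
    using new'[OF that] by (cases "y = x") (auto intro!: ssubst_cong)
  have E1: "derives L S {} (Eq (ssubst ?\<rho>1 \<phi>') (ssubst ?c1 \<phi>))"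
    unfolding \<phi>'_def by (rule composesD[OF C ts1 tr1])
  have tc1: "typed ?c1 (fv \<phi>)"
    unfolding typed_def
  proof
    fix y assume "y \<in> fv \<phi>"
    then show "wf_trm L (?c1 y) \<and> ty_of (?c1 y) = snd y"
      using tc wx snds unfolding c1[OF \<open>y \<in> fv \<phi>\<close>] by (simp add: typed_def)
  qed
  show "derives L S {} (Eq ?l ?r)"
  proof (rule derives_forces)
    fix \<Gamma> assume "{} \<preceq> \<Gamma>" and fv: "fv (Eq ?l ?r) \<subseteq> fvs \<Gamma>"
    then have \<Gamma>: "stage \<Gamma>" by (simp add: later_stage)
    have elts: "elt \<Gamma> (Pow (snd x)) ?l" "elt \<Gamma> (Pow (snd x)) ?r"
      using wfl wfr fv by (auto simp: elt_def)
    have ec: "env \<Gamma> ?c (fv \<phi> - {x})"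
      using tc fv by (auto simp: env_def typed_def elt_def fv_ssubst UN_subset_iff; blast)
    show "\<Gamma> ||- Eq ?l ?r"
      unfolding forces_set_eq_iff[OF \<Gamma> elts]
    proof (intro allI impI)
      fix \<Delta> s assume \<Delta>: "\<Gamma> \<preceq> \<Delta>" and s: "elt \<Delta> (snd x) s"
      note st = later_stage[OF \<Delta>]
      note ecd = env_mono[OF ec \<Delta>]
      have ws: "wf_trm L s" "ty_of s = snd x''" using s snds by (auto simp: elt_def)
      have wfb: "wf_fm L (ssubst ?\<rho>1 \<phi>')"
        using derives_wf(2)[OF E1] wf_ssubst_typed(2)[OF _ tc1] wf by (simp add: wf_fm_def)
      have "\<Delta> ||- Mem s ?l \<longleftrightarrow> \<Delta> ||- subst x'' s (ssubst ?\<rho>1 \<phi>')"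
        unfolding l
      proof (rule forces_Mem_Compr_iff[OF st wfb])
        show "elt \<Delta> (snd x'') s" using s snds by simp
        show "fv (ssubst ?\<rho>1 \<phi>') - {x''} \<subseteq> fvs \<Delta>"
          using elt_mono[OF elts(1) \<Delta>] unfolding l by (simp add: elt_def)
      qed
      have D1: "derives L S {} (Eq (subst x'' s (ssubst ?\<rho>1 \<phi>')) (subst x'' s (ssubst ?c1 \<phi>)))"
        using derives_subst_theorem[OF E1 ws] by (simp add: subst_def)
      have tv: "typed (Var(x'' := s)) (\<Union>y \<in> fv \<phi>. fv (?c1 y))"
        using typed_Var[of "ssubst ?c1 \<phi>"] wf_ssubst_typed(1)[OF _ tc1] wf ws
        unfolding fv_ssubst[symmetric] by (simp add: typed_def wf_fm_def)
      \<comment> \<open>The second renaming avoided the images under the composite, so putting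
        \<open>s\<close> for \<open>x''\<close> acts only where \<open>x\<close> stood.\<close>
      have eq: "ssubst (\<lambda>y. ssubst (Var(x'' := s)) (?c1 y)) \<phi> = ssubst (?c(x := s)) \<phi>"
      proof (rule ssubst_cong, intro ballI)
        fix y assume y: "y \<in> fv \<phi>"
        show "ssubst (Var(x'' := s)) (?c1 y) = (?c(x := s)) y"
        proof (cases "y = x")
          case False
          then have "x'' \<notin> fv (ssubst \<rho> (\<sigma> y))"
            using new''[OF y] by (auto simp: fv_ssubst)
          then show ?thesis
            using False subst_ident[of x'' _ s] unfolding c1[OF y] by (simp add: subst_def)
        qed (simp add: c1[OF y])
      qed
      have D2: "derives L S {} (Eq (subst x'' s (ssubst ?c1 \<phi>)) (ssubst (?c(x := s)) \<phi>))"
        using composesD[OF C tc1 tv] unfolding eq subst_def .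
      have fv2: "fv (ssubst (?c(x := s)) \<phi>) \<subseteq> fvs \<Delta>"
        using elt_ssubst_fm[OF wf env_upd[OF ecd s]] by (simp add: elt_def)
      have fv1: "fv (subst x'' s (ssubst ?c1 \<phi>)) = fv (ssubst (?c(x := s)) \<phi>)"
        unfolding eq[symmetric] by (simp add: subst_def fv_ssubst)
      have fv0: "fv (subst x'' s (ssubst ?\<rho>1 \<phi>')) = fv (subst x'' s (ssubst ?c1 \<phi>))"
        unfolding \<phi>'_def by (simp add: subst_def fv_ssubst)
      have "\<Delta> ||- Mem s ?l \<longleftrightarrow> \<Delta> ||- subst x'' s (ssubst ?\<rho>1 \<phi>')" by fact
      also have "\<dots> \<longleftrightarrow> \<Delta> ||- subst x'' s (ssubst ?c1 \<phi>)"
        using derives_eq_forces_iff[OF D1 st] fv0 fv1 fv2 by simp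
      also have "\<dots> \<longleftrightarrow> \<Delta> ||- ssubst (?c(x := s)) \<phi>"
        using derives_eq_forces_iff[OF D2 st] fv1 fv2 by simp
      also have "\<dots> \<longleftrightarrow> \<Delta> ||- Mem s ?r"
        using forces_Mem_ssubst_Compr_composes[OF C st wf ecd s] by simp
      finally show "\<Delta> ||- Mem s ?l \<longleftrightarrow> \<Delta> ||- Mem s ?r" .
    qed
  qed (use wfl wfr in \<open>simp_all add: stage_def\<close>)
qed

text \<open>The typing conditions of \<open>composes\<close>, localised to a stage that declares the
  variables of the composite, so that the congruence rules can be applied there.\<close>

definition composable ::
  "('g, 'f) trm set \<Rightarrow> ('g var \<Rightarrow> ('g, 'f) trm) \<Rightarrow> ('g var \<Rightarrow> ('g, 'f) trm) \<Rightarrow> 'g var set \<Rightarrow> bool"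
  where "composable \<Gamma> \<sigma> \<rho> W \<longleftrightarrow> typed \<sigma> W \<and> typed \<rho> (\<Union>y \<in> W. fv (\<sigma> y)) \<and>
    (\<forall>y \<in> W. fv (ssubst \<rho> (\<sigma> y)) \<subseteq> fvs \<Gamma>)"

lemma composable_subset: "composable \<Gamma> \<sigma> \<rho> W \<Longrightarrow> W' \<subseteq> W \<Longrightarrow> composable \<Gamma> \<sigma> \<rho> W'"
  unfolding composable_def typed_def by blast

lemma composesI:
  assumes "wf_trm L t"
    and "\<And>\<Gamma> \<sigma> \<rho>. stage \<Gamma> \<Longrightarrow> composable \<Gamma> \<sigma> \<rho> (fv t) \<Longrightarrow>
      \<Gamma> ||- Eq (ssubst \<rho> (ssubst \<sigma> t)) (ssubst (\<lambda>y. ssubst \<rho> (\<sigma> y)) t)"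
  shows "composes t"
  unfolding composes_def
proof (intro allI impI)
  fix \<sigma> \<rho> assume ty: "typed \<sigma> (fv t)" "typed \<rho> (\<Union>y \<in> fv t. fv (\<sigma> y))"
  show "derives L S {} (Eq (ssubst \<rho> (ssubst \<sigma> t)) (ssubst (\<lambda>y. ssubst \<rho> (\<sigma> y)) t))"
  proof (rule derives_forces)
    show "wf_fm L (Eq (ssubst \<rho> (ssubst \<sigma> t)) (ssubst (\<lambda>y. ssubst \<rho> (\<sigma> y)) t))"
      using ty wf_ssubst_typed[OF assms(1) ty(1)] wf_ssubst_typed[OF assms(1) typed_comp[OF ty]]
      by (simp add: wf_ssubst_typed fv_ssubst)
    fix \<Gamma> assume "{} \<preceq> \<Gamma>"
      "fv (Eq (ssubst \<rho> (ssubst \<sigma> t)) (ssubst (\<lambda>y. ssubst \<rho> (\<sigma> y)) t)) \<subseteq> fvs \<Gamma>"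
    then show "\<Gamma> ||- Eq (ssubst \<rho> (ssubst \<sigma> t)) (ssubst (\<lambda>y. ssubst \<rho> (\<sigma> y)) t)"
      using ty by (intro assms(2)) (auto simp: composable_def later_def fv_ssubst UN_subset_iff)
  qed (simp add: stage_def)
qed

lemma composes_forces:
  assumes "composes t" "stage \<Gamma>" "composable \<Gamma> \<sigma> \<rho> (fv t)"
  shows "\<Gamma> ||- Eq (ssubst \<rho> (ssubst \<sigma> t)) (ssubst (\<lambda>y. ssubst \<rho> (\<sigma> y)) t)"
  using assms unfolding composable_def
  by (intro forces_theorem composesD) (auto simp: fv_ssubst UN_subset_iff)

lemma composable_ty_of:
  assumes "wf_trm L t" "composable \<Gamma> \<sigma> \<rho> (fv t)"
  shows "ty_of (ssubst \<rho> (ssubst \<sigma> t)) = ty_of t"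
  using assms wf_ssubst_typed[of t \<sigma>] wf_ssubst_typed(2)[of "ssubst \<sigma> t" \<rho>]
  by (simp add: composable_def fv_ssubst)

lemma composes_wf: "wf_trm L t \<Longrightarrow> composes t"
proof (induction t)
  case (Compr x \<phi>)
  then show ?case by (intro composes_Compr) (simp_all add: wf_fm_def)
next
  case (Var x)
  then show ?case unfolding composes_def typed_def by (auto intro!: derives_refl wf_ssubst)
next
  case Star
  then show ?case by (simp add: composes_def derives_refl)
next
  case (App f A B t)
  show ?case
  proof (rule composesI[OF App.prems])
    fix \<Gamma> \<sigma> \<rho> assume *: "stage \<Gamma>" "composable \<Gamma> \<sigma> \<rho> (fv (App f A B t))"
    then show "\<Gamma> ||- Eq (ssubst \<rho> (ssubst \<sigma> (App f A B t))) (ssubst (\<lambda>y. ssubst \<rho> (\<sigma> y)) (App f A B t))"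
      using App forces_cong_App[OF composes_forces[of t \<Gamma> \<sigma> \<rho>], of f B] composable_ty_of[of t \<Gamma> \<sigma> \<rho>]
      by simp
  qed
next
  case (Tup ts)
  show ?case
  proof (rule composesI[OF Tup.prems])
    fix \<Gamma> \<sigma> \<rho> assume *: "stage \<Gamma>" "composable \<Gamma> \<sigma> \<rho> (fv (Tup ts))"
    have "\<Gamma> ||- Eq (ssubst \<rho> (ssubst \<sigma> t)) (ssubst (\<lambda>y. ssubst \<rho> (\<sigma> y)) t)" if "t \<in> set ts" for t
      using that Tup.prems *(1) by (intro composes_forces Tup.IH composable_subset[OF *(2)]) auto
    then show "\<Gamma> ||- Eq (ssubst \<rho> (ssubst \<sigma> (Tup ts))) (ssubst (\<lambda>y. ssubst \<rho> (\<sigma> y)) (Tup ts))"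
      using Tup.prems by (auto intro!: forces_cong_Tup)
  qed
next
  case (Proj i t)
  show ?case
  proof (rule composesI[OF Proj.prems])
    fix \<Gamma> \<sigma> \<rho> assume *: "stage \<Gamma>" "composable \<Gamma> \<sigma> \<rho> (fv (Proj i t))"
    then show "\<Gamma> ||- Eq (ssubst \<rho> (ssubst \<sigma> (Proj i t))) (ssubst (\<lambda>y. ssubst \<rho> (\<sigma> y)) (Proj i t))"
      using Proj forces_cong_Proj[OF composes_forces[of t \<Gamma> \<sigma> \<rho>], of _ i] composable_ty_of[of t \<Gamma> \<sigma> \<rho>]
      by auto
  qed
next
  case (Eq s t)
  show ?case
  proof (rule composesI[OF Eq.prems])
    fix \<Gamma> \<sigma> \<rho> assume *: "stage \<Gamma>" "composable \<Gamma> \<sigma> \<rho> (fv (Eq s t))"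
    then have "composable \<Gamma> \<sigma> \<rho> (fv s)" "composable \<Gamma> \<sigma> \<rho> (fv t)"
      by (auto elim: composable_subset)
    with * Eq show "\<Gamma> ||- Eq (ssubst \<rho> (ssubst \<sigma> (Eq s t))) (ssubst (\<lambda>y. ssubst \<rho> (\<sigma> y)) (Eq s t))"
      by (simp add: forces_cong_Eq composes_forces composable_ty_of)
  qed
next
  case (Mem s t)
  show ?case
  proof (rule composesI[OF Mem.prems])
    fix \<Gamma> \<sigma> \<rho> assume *: "stage \<Gamma>" "composable \<Gamma> \<sigma> \<rho> (fv (Mem s t))"
    then have "composable \<Gamma> \<sigma> \<rho> (fv s)" "composable \<Gamma> \<sigma> \<rho> (fv t)"
      by (auto elim: composable_subset)
    with * Mem show "\<Gamma> ||- Eq (ssubst \<rho> (ssubst \<sigma> (Mem s t))) (ssubst (\<lambda>y. ssubst \<rho> (\<sigma> y)) (Mem s t))"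
      by (simp add: forces_cong_Mem composes_forces composable_ty_of)
  qed
qed

section \<open>Kripke-Joyal clauses\<close>

lemma forces_Mem_ssubst_Compr:
  assumes "stage \<Gamma>" "wf_fm L \<phi>" "env \<Gamma> \<sigma> (fv \<phi> - {x})" "elt \<Gamma> (snd x) s"
  shows "\<Gamma> ||- Mem s (ssubst \<sigma> (Compr x \<phi>)) \<longleftrightarrow> \<Gamma> ||- ssubst (\<sigma>(x := s)) \<phi>"
  using assms composes_wf[of \<phi>] forces_Mem_ssubst_Compr_composes by (simp add: wf_fm_def)

text \<open>Replacement of equals without restriction on binders. In an abstraction the two sets are
  compared by their members, and the instances of the body fall under the induction hypothesis
  because both environments send the bound variable to the same element.\<close>

lemma forces_ssubst_cong:
  assumes "wf_trm L t" "stage \<Gamma>" "\<forall>y \<in> fv t. \<Gamma> ||- Eq (\<sigma> y) (\<rho> y) \<and> ty_of (\<sigma> y) = snd y"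
  shows "\<Gamma> ||- Eq (ssubst \<sigma> t) (ssubst \<rho> t)"
  using assms
proof (induction t arbitrary: \<Gamma> \<sigma> \<rho>)
  case (Var x)
  then show ?case by simp
next
  case Star
  then show ?case by (auto intro!: forces_refl simp: elt_def)
next
  case (Compr x \<phi>)
  have wf: "wf_var L x" "wf_fm L \<phi>" using Compr.prems(1) by auto
  have envs: "env \<Gamma> \<sigma> (fv (Compr x \<phi>))" "env \<Gamma> \<rho> (fv (Compr x \<phi>))"
    unfolding env_def using Compr.prems(3) forces_elt_Eq by metis+
  have elts: "elt \<Gamma> (Pow (snd x)) (ssubst \<sigma> (Compr x \<phi>))" "elt \<Gamma> (Pow (snd x)) (ssubst \<rho> (Compr x \<phi>))"
    using elt_ssubst[OF Compr.prems(1) envs(1)] elt_ssubst[OF Compr.prems(1) envs(2)] by simp_all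
  show ?case
    unfolding forces_set_eq_iff[OF Compr.prems(2) elts]
  proof (intro allI impI)
    fix \<Delta> s assume \<Delta>: "\<Gamma> \<preceq> \<Delta>" and s: "elt \<Delta> (snd x) s"
    note st = later_stage[OF \<Delta>]
    have "\<forall>y \<in> fv \<phi>. \<Delta> ||- Eq ((\<sigma>(x := s)) y) ((\<rho>(x := s)) y) \<and> ty_of ((\<sigma>(x := s)) y) = snd y"
      using Compr.prems(3) forces_mono[OF _ \<Delta>] forces_refl[OF st s] s by (auto simp: elt_def)
    then have "\<Delta> ||- Eq (ssubst (\<sigma>(x := s)) \<phi>) (ssubst (\<rho>(x := s)) \<phi>)"
      using wf st by (intro Compr.IH) (simp_all add: wf_fm_def)
    then have "\<Delta> ||- ssubst (\<sigma>(x := s)) \<phi> \<longleftrightarrow> \<Delta> ||- ssubst (\<rho>(x := s)) \<phi>"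
      using forces_eqD forces_sym by blast
    then show "\<Delta> ||- Mem s (ssubst \<sigma> (Compr x \<phi>)) \<longleftrightarrow> \<Delta> ||- Mem s (ssubst \<rho> (Compr x \<phi>))"
      using envs[THEN env_mono, OF \<Delta>] st wf s by (simp add: forces_Mem_ssubst_Compr)
  qed
next
  case (App f A B t)
  have "ty_of (ssubst \<sigma> t) = ty_of t" using App.prems by (intro ty_of_ssubst) auto
  with App show ?case using forces_cong_App[of \<Gamma> "ssubst \<sigma> t" "ssubst \<rho> t" f B] by simp
next
  case (Tup ts)
  have "\<Gamma> ||- Eq (ssubst \<sigma> t) (ssubst \<rho> t)" if "t \<in> set ts" for t
    using that Tup.prems by (intro Tup.IH) auto
  then show ?case using Tup.prems by (auto intro!: forces_cong_Tup)
next
  case (Proj i t)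
  have "ty_of (ssubst \<sigma> t) = ty_of t" using Proj.prems by (intro ty_of_ssubst) auto
  with Proj show ?case using forces_cong_Proj[of \<Gamma> "ssubst \<sigma> t" "ssubst \<rho> t" _ i] by auto
next
  case (Eq s t)
  have "ty_of (ssubst \<sigma> s) = ty_of s" "ty_of (ssubst \<sigma> t) = ty_of t"
    using Eq.prems by (simp_all add: ty_of_ssubst)
  with Eq show ?case by (simp add: forces_cong_Eq)
next
  case (Mem s t)
  have "ty_of (ssubst \<sigma> s) = ty_of s" "ty_of (ssubst \<sigma> t) = ty_of t"
    using Mem.prems by (simp_all add: ty_of_ssubst)
  with Mem show ?case by (simp add: forces_cong_Mem)
qed

end

section \<open>Syntax of the defined connectives, and updates along lists\<close>

lemma fv_logic [simp]:
  "fv Tru = {}" "fv (And \<phi> \<psi>) = fv \<phi> \<union> fv \<psi>" "fv (Imp \<phi> \<psi>) = fv \<phi> \<union> fv \<psi>"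
  "fv (Iff \<phi> \<psi>) = fv \<phi> \<union> fv \<psi>" "fv (Forall x \<phi>) = fv \<phi> - {x}" "fv Fls = {}"
  "fv (Neg \<phi>) = fv \<phi>"
  by (auto simp: Tru_def And_def Imp_def Iff_def Forall_def Fls_def Neg_def)

lemma fv_Or [simp]: "fv (Or \<phi> \<psi>) = fv \<phi> \<union> fv \<psi>"
  using fresh_notin[of "fv \<phi> \<union> fv \<psi>" Omega] by (auto simp: Or_def Let_def)

lemma fv_Exists [simp]: "fv (Exists x \<phi>) = fv \<phi> - {x}"
  using fresh_notin[of "insert x (fv \<phi>)" Omega] by (auto simp: Exists_def Let_def)

lemma fv_Conj [simp]: "fv (Conj \<phi>s) = (\<Union>\<phi> \<in> set \<phi>s. fv \<phi>)"
  by (induction \<phi>s rule: Conj.induct) auto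

lemma wf_fm_logic [simp]:
  "wf_fm L Tru" "wf_fm L (And \<phi> \<psi>) \<longleftrightarrow> wf_fm L \<phi> \<and> wf_fm L \<psi>"
  "wf_fm L (Imp \<phi> \<psi>) \<longleftrightarrow> wf_fm L \<phi> \<and> wf_fm L \<psi>"
  "wf_fm L (Forall x \<phi>) \<longleftrightarrow> wf_var L x \<and> wf_fm L \<phi>"
  "wf_fm L Fls" "wf_fm L (Neg \<phi>) \<longleftrightarrow> wf_fm L \<phi>"
  "wf_fm L (Or \<phi> \<psi>) \<longleftrightarrow> wf_fm L \<phi> \<and> wf_fm L \<psi>"
  "wf_fm L (Exists x \<phi>) \<longleftrightarrow> wf_var L x \<and> wf_fm L \<phi>"
  by (auto simp: Tru_def And_def Imp_def Iff_def Forall_def Fls_def Neg_def Or_def Exists_def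
      Let_def wf_fm_def wf_trm.simps(3) simp del: wf_trm_Compr)

lemma wf_fm_Iff: "wf_fm L \<phi> \<Longrightarrow> wf_fm L \<psi> \<Longrightarrow> wf_fm L (Iff \<phi> \<psi>)"
  by (simp add: Iff_def wf_fm_def)

lemma wf_fm_Conj [simp]: "wf_fm L (Conj \<phi>s) \<longleftrightarrow> (\<forall>\<phi> \<in> set \<phi>s. wf_fm L \<phi>)"
  by (induction \<phi>s rule: Conj.induct) auto

text \<open>\<open>Or\<close> and \<open>Exists\<close> are absent: their auxiliary variable depends
  on the free variables of the parts, which a substitution may change, so no literal equation can be
  expected for them.\<close>

lemma ssubst_logic [simp]:
  "ssubst \<sigma> Tru = Tru" "ssubst \<sigma> (And \<phi> \<psi>) = And (ssubst \<sigma> \<phi>) (ssubst \<sigma> \<psi>)"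
  "ssubst \<sigma> (Imp \<phi> \<psi>) = Imp (ssubst \<sigma> \<phi>) (ssubst \<sigma> \<psi>)"
  "ssubst \<sigma> (Iff \<phi> \<psi>) = Iff (ssubst \<sigma> \<phi>) (ssubst \<sigma> \<psi>)" "ssubst \<sigma> Fls = Fls"
  "ssubst \<sigma> (Neg \<phi>) = Neg (ssubst \<sigma> \<phi>)"
proof -
  show F: "ssubst \<sigma> Fls = Fls" by (rule ssubst_closed) simp
  show "ssubst \<sigma> (Neg \<phi>) = Neg (ssubst \<sigma> \<phi>)"
    by (simp add: Neg_def Imp_def And_def Iff_def Tru_def F)
qed (simp_all add: Tru_def And_def Imp_def Iff_def)

lemma ssubst_Conj [simp]: "ssubst \<sigma> (Conj \<phi>s) = Conj (map (ssubst \<sigma>) \<phi>s)"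
  by (induction \<phi>s rule: Conj.induct) auto

text \<open>Updates run from left to right, in the order in which \<open>foldr Exists\<close> peels
  off its quantifiers.\<close>

fun upds :: "('a \<Rightarrow> 'b) \<Rightarrow> 'a list \<Rightarrow> 'b list \<Rightarrow> 'a \<Rightarrow> 'b" where
  "upds \<sigma> (x # xs) (t # ts) = upds (\<sigma>(x := t)) xs ts"
| "upds \<sigma> _ _ = \<sigma>"

lemma upds_notin: "y \<notin> set xs \<Longrightarrow> upds \<sigma> xs ts y = \<sigma> y"
  by (induction \<sigma> xs ts rule: upds.induct) auto

lemma upds_in:
  "length ts = length xs \<Longrightarrow> y \<in> set xs \<Longrightarrow> upds \<sigma> xs ts y = upds \<rho> xs ts y"
proof (induction \<sigma> xs ts arbitrary: \<rho> rule: upds.induct)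
  case (1 \<sigma> x xs t ts)
  show ?case
  proof (cases "y \<in> set xs")
    case True
    then show ?thesis using 1 by (simp del: fun_upd_apply)
  next
    case False
    then have "y = x" using 1 by simp
    with False show ?thesis by (simp add: upds_notin)
  qed
qed auto

lemma upds_nth:
  "length ts = length xs \<Longrightarrow> distinct xs \<Longrightarrow> i < length xs \<Longrightarrow> upds \<sigma> xs ts (xs ! i) = ts ! i"
proof (induction \<sigma> xs ts arbitrary: i rule: upds.induct)
  case (1 \<sigma> x xs t ts)
  then show ?case by (cases i) (simp_all add: upds_notin del: fun_upd_apply, simp)
qed auto

lemma map_upds: "length ts = length xs \<Longrightarrow> distinct xs \<Longrightarrow> map (upds \<sigma> xs ts) xs = ts"
  by (rule nth_equalityI) (simp_all add: upds_nth)

context local_set_theory_in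
begin

section \<open>Clauses for the connectives and quantifiers\<close>

lemma elt_Omega_iff: "elt \<Gamma> Omega \<phi> \<longleftrightarrow> wf_fm L \<phi> \<and> fv \<phi> \<subseteq> fvs \<Gamma>"
  by (auto simp: elt_def wf_fm_def)

lemma forces_Tru: "stage \<Gamma> \<Longrightarrow> \<Gamma> ||- Tru"
  unfolding Tru_def by (rule forces_refl[of _ One]) (simp_all add: elt_def)

lemma forces_eq_Tru_iff:
  assumes "stage \<Gamma>" "elt \<Gamma> Omega \<phi>"
  shows "\<Gamma> ||- Eq \<phi> Tru \<longleftrightarrow> \<Gamma> ||- \<phi>"
  using forces_eq_Omega_iff[OF assms, of Tru] forces_Tru forces_mono later_stage assms(1)
  by (auto simp: elt_Omega_iff)

text \<open>A conjunction is an equation of pairs, so it splits into two equations with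
  \<open>Tru\<close>.\<close>

lemma forces_And_iff:
  assumes "stage \<Gamma>" "elt \<Gamma> Omega \<phi>" "elt \<Gamma> Omega \<psi>"
  shows "\<Gamma> ||- And \<phi> \<psi> \<longleftrightarrow> \<Gamma> ||- \<phi> \<and> \<Gamma> ||- \<psi>"
proof -
  have elts: "elt \<Gamma> (Prod [Omega, Omega]) (Tup [\<phi>, \<psi>])" "elt \<Gamma> (Prod [Omega, Omega]) (Tup [Tru, Tru])"
    using assms elt_Omega_iff[of \<Gamma> Tru] by (simp_all add: elt_Tup)
  have "\<Gamma> ||- And \<phi> \<psi> \<longleftrightarrow> \<Gamma> ||- Eq \<phi> Tru \<and> \<Gamma> ||- Eq \<psi> Tru"
    unfolding And_def forces_Tup_eq_iff[OF assms(1) elts] by (auto simp: All_less_Suc)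
  then show ?thesis using assms by (simp add: forces_eq_Tru_iff)
qed

lemma forces_Conj_iff:
  assumes "stage \<Gamma>" "\<forall>\<phi> \<in> set \<phi>s. elt \<Gamma> Omega \<phi>"
  shows "\<Gamma> ||- Conj \<phi>s \<longleftrightarrow> (\<forall>\<phi> \<in> set \<phi>s. \<Gamma> ||- \<phi>)"
  using assms(2)
proof (induction \<phi>s rule: Conj.induct)
  case 1
  show ?case by (simp add: forces_Tru assms(1))
next
  case (3 \<phi> \<psi> \<phi>s)
  have "elt \<Gamma> Omega (Conj (\<psi> # \<phi>s))"
    using 3(2) by (auto simp: elt_Omega_iff)
  then show ?case using 3 assms(1) by (simp add: forces_And_iff)
qed simp

lemma forces_Imp_iff:
  assumes "stage \<Gamma>" "elt \<Gamma> Omega \<phi>" "elt \<Gamma> Omega \<psi>"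
  shows "\<Gamma> ||- Imp \<phi> \<psi> \<longleftrightarrow> (\<forall>\<Delta>. \<Gamma> \<preceq> \<Delta> \<longrightarrow> \<Delta> ||- \<phi> \<longrightarrow> \<Delta> ||- \<psi>)"
proof -
  have "elt \<Gamma> Omega (And \<phi> \<psi>)" using assms by (simp add: elt_Omega_iff)
  then have "\<Gamma> ||- Imp \<phi> \<psi> \<longleftrightarrow> (\<forall>\<Delta>. \<Gamma> \<preceq> \<Delta> \<longrightarrow> (\<Delta> ||- And \<phi> \<psi> \<longleftrightarrow> \<Delta> ||- \<phi>))"
    unfolding Imp_def Iff_def using assms by (simp add: forces_eq_Omega_iff)
  also have "\<dots> \<longleftrightarrow> (\<forall>\<Delta>. \<Gamma> \<preceq> \<Delta> \<longrightarrow> \<Delta> ||- \<phi> \<longrightarrow> \<Delta> ||- \<psi>)"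
    using forces_And_iff[OF later_stage elt_mono[OF assms(2)] elt_mono[OF assms(3)]] by blast
  finally show ?thesis .
qed

text \<open>\<open>Forall\<close> equates two sets, and comparing them by their members produces
  exactly the range over later stages and their elements. The environment stays explicit because the
  body has to be read at arbitrary elements.\<close>

lemma forces_ssubst_Forall_iff:
  assumes "stage \<Gamma>" "wf_fm L \<phi>" "wf_var L x" "env \<Gamma> \<sigma> (fv \<phi> - {x})"
  shows "\<Gamma> ||- ssubst \<sigma> (Forall x \<phi>) \<longleftrightarrow>
    (\<forall>\<Delta> t. \<Gamma> \<preceq> \<Delta> \<longrightarrow> elt \<Delta> (snd x) t \<longrightarrow> \<Delta> ||- ssubst (\<sigma>(x := t)) \<phi>)"
proof -
  have elts: "elt \<Gamma> (Pow (snd x)) (ssubst \<sigma> (Compr x \<phi>))" "elt \<Gamma> (Pow (snd x)) (ssubst \<sigma> (Compr x Tru))"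
    using elt_ssubst[of "Compr x \<phi>" \<Gamma> \<sigma>] elt_ssubst[of "Compr x Tru" \<Gamma> \<sigma>] assms
    by (simp_all add: env_def)
  have "\<Gamma> ||- ssubst \<sigma> (Forall x \<phi>) \<longleftrightarrow> (\<forall>\<Delta> t. \<Gamma> \<preceq> \<Delta> \<longrightarrow> elt \<Delta> (snd x) t \<longrightarrow>
      (\<Delta> ||- Mem t (ssubst \<sigma> (Compr x \<phi>)) \<longleftrightarrow> \<Delta> ||- Mem t (ssubst \<sigma> (Compr x Tru))))"
    using forces_set_eq_iff[OF assms(1) elts] by (simp add: Forall_def)
  also have "\<dots> \<longleftrightarrow> (\<forall>\<Delta> t. \<Gamma> \<preceq> \<Delta> \<longrightarrow> elt \<Delta> (snd x) t \<longrightarrow> \<Delta> ||- ssubst (\<sigma>(x := t)) \<phi>)"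
  proof (intro all_cong1 imp_cong refl)
    fix \<Delta> t assume \<Delta>: "\<Gamma> \<preceq> \<Delta>" and t: "elt \<Delta> (snd x) t"
    show "(\<Delta> ||- Mem t (ssubst \<sigma> (Compr x \<phi>)) \<longleftrightarrow> \<Delta> ||- Mem t (ssubst \<sigma> (Compr x Tru))) \<longleftrightarrow>
        \<Delta> ||- ssubst (\<sigma>(x := t)) \<phi>"
      using forces_Mem_ssubst_Compr[OF later_stage[OF \<Delta>] assms(2) env_mono[OF assms(4) \<Delta>] t]
        forces_Mem_ssubst_Compr[OF later_stage[OF \<Delta>] _ _ t, of Tru \<sigma>] forces_Tru[OF later_stage[OF \<Delta>]]
      by (simp add: env_def)
  qed
  finally show ?thesis .
qed

text \<open>No witness is available at \<open>\<Gamma>\<close> itself: the quantification over truth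
  values in the definition becomes an elimination principle with an arbitrary goal
  \<open>\<chi>\<close>.\<close>

lemma forces_ssubst_Exists_iff:
  assumes "stage \<Gamma>" "wf_fm L \<phi>" "wf_var L x" "env \<Gamma> \<sigma> (fv \<phi> - {x})"
  shows "\<Gamma> ||- ssubst \<sigma> (Exists x \<phi>) \<longleftrightarrow>
    (\<forall>\<Delta> \<chi>. \<Gamma> \<preceq> \<Delta> \<longrightarrow> elt \<Delta> Omega \<chi> \<longrightarrow>
      (\<forall>\<Theta> t. \<Delta> \<preceq> \<Theta> \<longrightarrow> elt \<Theta> (snd x) t \<longrightarrow> \<Theta> ||- ssubst (\<sigma>(x := t)) \<phi> \<longrightarrow> \<Theta> ||- \<chi>) \<longrightarrow> \<Delta> ||- \<chi>)"
proof -
  define w where "w = (fresh (insert x (fv \<phi>)), Omega :: 'g ty)"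
  have "w \<notin> insert x (fv \<phi>)" unfolding w_def by (rule fresh_notin) simp
  then have w: "w \<noteq> x" "x \<noteq> w" "w \<notin> fv \<phi>" "snd w = Omega" by (auto simp: w_def)
  let ?A = "Forall x (Imp \<phi> (Var w))"
  have ex: "Exists x \<phi> = Forall w (Imp ?A (Var w))" by (simp add: Exists_def Let_def w_def)
  have A: "\<Delta> ||- ssubst (\<sigma>(w := \<chi>)) ?A \<longleftrightarrow>
      (\<forall>\<Theta> t. \<Delta> \<preceq> \<Theta> \<longrightarrow> elt \<Theta> (snd x) t \<longrightarrow> \<Theta> ||- ssubst (\<sigma>(x := t)) \<phi> \<longrightarrow> \<Theta> ||- \<chi>)"
    if \<Delta>: "\<Gamma> \<preceq> \<Delta>" and \<chi>: "elt \<Delta> Omega \<chi>" for \<Delta> \<chi>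
  proof -
    have env: "env \<Delta> (\<sigma>(w := \<chi>)) (fv (Imp \<phi> (Var w)) - {x})"
      using env_mono[OF assms(4) \<Delta>] \<chi> w by (auto simp: env_def)
    have "\<Delta> ||- ssubst (\<sigma>(w := \<chi>)) ?A \<longleftrightarrow> (\<forall>\<Theta> t. \<Delta> \<preceq> \<Theta> \<longrightarrow> elt \<Theta> (snd x) t \<longrightarrow>
        \<Theta> ||- ssubst (\<sigma>(w := \<chi>, x := t)) (Imp \<phi> (Var w)))"
      using later_stage[OF \<Delta>] assms(2,3) w env by (intro forces_ssubst_Forall_iff) simp_all
    also have "\<dots> \<longleftrightarrow> (\<forall>\<Theta> t. \<Delta> \<preceq> \<Theta> \<longrightarrow> elt \<Theta> (snd x) t \<longrightarrow>
        (\<forall>\<Xi>. \<Theta> \<preceq> \<Xi> \<longrightarrow> \<Xi> ||- ssubst (\<sigma>(x := t)) \<phi> \<longrightarrow> \<Xi> ||- \<chi>))"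
    proof (intro all_cong1 imp_cong refl)
      fix \<Theta> t assume \<Theta>: "\<Delta> \<preceq> \<Theta>" and t: "elt \<Theta> (snd x) t"
      have eq: "ssubst (\<sigma>(w := \<chi>, x := t)) \<phi> = ssubst (\<sigma>(x := t)) \<phi>"
        using w by (intro ssubst_cong) auto
      have "elt \<Theta> Omega (ssubst (\<sigma>(x := t)) \<phi>)"
        using assms(2) env_upd[OF env_mono[OF assms(4) later_trans[OF \<Delta> \<Theta>]] t] by (rule elt_ssubst_fm)
      then show "\<Theta> ||- ssubst (\<sigma>(w := \<chi>, x := t)) (Imp \<phi> (Var w)) \<longleftrightarrow>
          (\<forall>\<Xi>. \<Theta> \<preceq> \<Xi> \<longrightarrow> \<Xi> ||- ssubst (\<sigma>(x := t)) \<phi> \<longrightarrow> \<Xi> ||- \<chi>)"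
        using forces_Imp_iff[OF later_stage[OF \<Theta>] _ elt_mono[OF \<chi> \<Theta>]] w eq by simp
    qed
    \<comment> \<open>An implication below a universal quantifier ranges over later stages twice;
      reflexivity and transitivity of the order merge the two ranges.\<close>
    also have "\<dots> \<longleftrightarrow> (\<forall>\<Theta> t. \<Delta> \<preceq> \<Theta> \<longrightarrow> elt \<Theta> (snd x) t \<longrightarrow>
        \<Theta> ||- ssubst (\<sigma>(x := t)) \<phi> \<longrightarrow> \<Theta> ||- \<chi>)"
      using later_trans elt_mono later_refl later_stage by meson
    finally show ?thesis .
  qed
  have "env \<Gamma> \<sigma> (fv (Imp ?A (Var w)) - {w})"
    using assms(4) by (auto simp: env_def)
  then have "\<Gamma> ||- ssubst \<sigma> (Exists x \<phi>) \<longleftrightarrow> (\<forall>\<Delta> \<chi>. \<Gamma> \<preceq> \<Delta> \<longrightarrow> elt \<Delta> Omega \<chi> \<longrightarrow>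
      \<Delta> ||- Imp (ssubst (\<sigma>(w := \<chi>)) ?A) \<chi>)"
    unfolding ex using assms(1-3) w by (subst forces_ssubst_Forall_iff) simp_all
  also have "\<dots> \<longleftrightarrow> (\<forall>\<Delta> \<chi>. \<Gamma> \<preceq> \<Delta> \<longrightarrow> elt \<Delta> Omega \<chi> \<longrightarrow>
      (\<forall>\<Xi>. \<Delta> \<preceq> \<Xi> \<longrightarrow> \<Xi> ||- ssubst (\<sigma>(w := \<chi>)) ?A \<longrightarrow> \<Xi> ||- \<chi>))"
  proof (intro all_cong1 imp_cong refl)
    fix \<Delta> \<chi> assume \<Delta>: "\<Gamma> \<preceq> \<Delta>" and \<chi>: "elt \<Delta> Omega \<chi>"
    have "env \<Delta> (\<sigma>(w := \<chi>)) (fv ?A)"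
      using env_mono[OF assms(4) \<Delta>] \<chi> w by (auto simp: env_def)
    then have "elt \<Delta> Omega (ssubst (\<sigma>(w := \<chi>)) ?A)"
      using assms(2,3) w by (intro elt_ssubst_fm) simp_all
    then show "\<Delta> ||- Imp (ssubst (\<sigma>(w := \<chi>)) ?A) \<chi> \<longleftrightarrow>
        (\<forall>\<Xi>. \<Delta> \<preceq> \<Xi> \<longrightarrow> \<Xi> ||- ssubst (\<sigma>(w := \<chi>)) ?A \<longrightarrow> \<Xi> ||- \<chi>)"
      using forces_Imp_iff[OF later_stage[OF \<Delta>] _ \<chi>] by blast
  qed
  also have "\<dots> \<longleftrightarrow> (\<forall>\<Delta> \<chi>. \<Gamma> \<preceq> \<Delta> \<longrightarrow> elt \<Delta> Omega \<chi> \<longrightarrow> \<Delta> ||- ssubst (\<sigma>(w := \<chi>)) ?A \<longrightarrow> \<Delta> ||- \<chi>)"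
    using later_trans elt_mono later_refl later_stage by meson
  also have "\<dots> \<longleftrightarrow> (\<forall>\<Delta> \<chi>. \<Gamma> \<preceq> \<Delta> \<longrightarrow> elt \<Delta> Omega \<chi> \<longrightarrow>
      (\<forall>\<Theta> t. \<Delta> \<preceq> \<Theta> \<longrightarrow> elt \<Theta> (snd x) t \<longrightarrow> \<Theta> ||- ssubst (\<sigma>(x := t)) \<phi> \<longrightarrow> \<Theta> ||- \<chi>) \<longrightarrow> \<Delta> ||- \<chi>)"
    using A by simp
  finally show ?thesis .
qed

text \<open>As for existence, the encoding over truth values permits a case distinction only at
  later stages and towards a goal formula.\<close>

lemma forces_ssubst_Or_iff:
  assumes "stage \<Gamma>" "wf_fm L \<phi>" "wf_fm L \<psi>" "env \<Gamma> \<sigma> (fv \<phi> \<union> fv \<psi>)"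
  shows "\<Gamma> ||- ssubst \<sigma> (Or \<phi> \<psi>) \<longleftrightarrow>
    (\<forall>\<Delta> \<chi>. \<Gamma> \<preceq> \<Delta> \<longrightarrow> elt \<Delta> Omega \<chi> \<longrightarrow>
      (\<forall>\<Theta>. \<Delta> \<preceq> \<Theta> \<longrightarrow> \<Theta> ||- ssubst \<sigma> \<phi> \<or> \<Theta> ||- ssubst \<sigma> \<psi> \<longrightarrow> \<Theta> ||- \<chi>) \<longrightarrow> \<Delta> ||- \<chi>)"
proof -
  define w where "w = (fresh (fv \<phi> \<union> fv \<psi>), Omega :: 'g ty)"
  have "w \<notin> fv \<phi> \<union> fv \<psi>" unfolding w_def by (rule fresh_notin) simp
  then have w: "w \<notin> fv \<phi>" "w \<notin> fv \<psi>" "snd w = Omega" by (auto simp: w_def)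
  let ?A = "And (Imp \<phi> (Var w)) (Imp \<psi> (Var w))"
  have or: "Or \<phi> \<psi> = Forall w (Imp ?A (Var w))" by (simp add: Or_def Let_def w_def)
  have eq: "ssubst (\<sigma>(w := \<chi>)) \<phi> = ssubst \<sigma> \<phi>" "ssubst (\<sigma>(w := \<chi>)) \<psi> = ssubst \<sigma> \<psi>" for \<chi>
    using w by (auto intro!: ssubst_cong)
  have elts: "elt \<Gamma> Omega (ssubst \<sigma> \<phi>)" "elt \<Gamma> Omega (ssubst \<sigma> \<psi>)"
    using assms by (auto intro!: elt_ssubst_fm elim: env_subset)
  have "env \<Gamma> \<sigma> (fv (Imp ?A (Var w)) - {w})"
    using assms(4) by (auto simp: env_def)
  then have "\<Gamma> ||- ssubst \<sigma> (Or \<phi> \<psi>) \<longleftrightarrow> (\<forall>\<Delta> \<chi>. \<Gamma> \<preceq> \<Delta> \<longrightarrow> elt \<Delta> Omega \<chi> \<longrightarrow>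
      \<Delta> ||- Imp (And (Imp (ssubst \<sigma> \<phi>) \<chi>) (Imp (ssubst \<sigma> \<psi>) \<chi>)) \<chi>)"
    unfolding or using assms(1-3) w by (subst forces_ssubst_Forall_iff) (simp_all add: eq)
  also have "\<dots> \<longleftrightarrow> (\<forall>\<Delta> \<chi>. \<Gamma> \<preceq> \<Delta> \<longrightarrow> elt \<Delta> Omega \<chi> \<longrightarrow> (\<forall>\<Xi>. \<Delta> \<preceq> \<Xi> \<longrightarrow>
      (\<forall>\<Theta>. \<Xi> \<preceq> \<Theta> \<longrightarrow> \<Theta> ||- ssubst \<sigma> \<phi> \<or> \<Theta> ||- ssubst \<sigma> \<psi> \<longrightarrow> \<Theta> ||- \<chi>) \<longrightarrow> \<Xi> ||- \<chi>))"
  proof (intro all_cong1 imp_cong refl)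
    fix \<Delta> \<chi> assume \<Delta>: "\<Gamma> \<preceq> \<Delta>" and \<chi>: "elt \<Delta> Omega \<chi>"
    note elts' = elts[THEN elt_mono, OF \<Delta>]
    have imps: "elt \<Delta> Omega (Imp (ssubst \<sigma> \<phi>) \<chi>)" "elt \<Delta> Omega (Imp (ssubst \<sigma> \<psi>) \<chi>)"
      using elts' \<chi> by (simp_all add: elt_Omega_iff)
    then have "elt \<Delta> Omega (And (Imp (ssubst \<sigma> \<phi>) \<chi>) (Imp (ssubst \<sigma> \<psi>) \<chi>))"
      by (simp add: elt_Omega_iff)
    then have "\<Delta> ||- Imp (And (Imp (ssubst \<sigma> \<phi>) \<chi>) (Imp (ssubst \<sigma> \<psi>) \<chi>)) \<chi> \<longleftrightarrow>
        (\<forall>\<Xi>. \<Delta> \<preceq> \<Xi> \<longrightarrow> \<Xi> ||- And (Imp (ssubst \<sigma> \<phi>) \<chi>) (Imp (ssubst \<sigma> \<psi>) \<chi>) \<longrightarrow> \<Xi> ||- \<chi>)"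
      using forces_Imp_iff[OF later_stage[OF \<Delta>] _ \<chi>] by blast
    also have "\<dots> \<longleftrightarrow> (\<forall>\<Xi>. \<Delta> \<preceq> \<Xi> \<longrightarrow>
      (\<forall>\<Theta>. \<Xi> \<preceq> \<Theta> \<longrightarrow> \<Theta> ||- ssubst \<sigma> \<phi> \<or> \<Theta> ||- ssubst \<sigma> \<psi> \<longrightarrow> \<Theta> ||- \<chi>) \<longrightarrow> \<Xi> ||- \<chi>)"
    proof (intro all_cong1 imp_cong refl)
      fix \<Xi> assume \<Xi>: "\<Delta> \<preceq> \<Xi>"
      show "\<Xi> ||- And (Imp (ssubst \<sigma> \<phi>) \<chi>) (Imp (ssubst \<sigma> \<psi>) \<chi>) \<longleftrightarrow>
          (\<forall>\<Theta>. \<Xi> \<preceq> \<Theta> \<longrightarrow> \<Theta> ||- ssubst \<sigma> \<phi> \<or> \<Theta> ||- ssubst \<sigma> \<psi> \<longrightarrow> \<Theta> ||- \<chi>)"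
        using forces_And_iff[OF later_stage[OF \<Xi>] imps[THEN elt_mono, OF \<Xi>]]
          forces_Imp_iff[OF later_stage[OF \<Xi>] elts'(1)[THEN elt_mono, OF \<Xi>] elt_mono[OF \<chi> \<Xi>]]
          forces_Imp_iff[OF later_stage[OF \<Xi>] elts'(2)[THEN elt_mono, OF \<Xi>] elt_mono[OF \<chi> \<Xi>]]
        by blast
    qed
    finally show "\<Delta> ||- Imp (And (Imp (ssubst \<sigma> \<phi>) \<chi>) (Imp (ssubst \<sigma> \<psi>) \<chi>)) \<chi> \<longleftrightarrow>
      (\<forall>\<Xi>. \<Delta> \<preceq> \<Xi> \<longrightarrow>
      (\<forall>\<Theta>. \<Xi> \<preceq> \<Theta> \<longrightarrow> \<Theta> ||- ssubst \<sigma> \<phi> \<or> \<Theta> ||- ssubst \<sigma> \<psi> \<longrightarrow> \<Theta> ||- \<chi>) \<longrightarrow> \<Xi> ||- \<chi>)" .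
  qed
  also have "\<dots> \<longleftrightarrow> (\<forall>\<Delta> \<chi>. \<Gamma> \<preceq> \<Delta> \<longrightarrow> elt \<Delta> Omega \<chi> \<longrightarrow>
      (\<forall>\<Theta>. \<Delta> \<preceq> \<Theta> \<longrightarrow> \<Theta> ||- ssubst \<sigma> \<phi> \<or> \<Theta> ||- ssubst \<sigma> \<psi> \<longrightarrow> \<Theta> ||- \<chi>) \<longrightarrow> \<Delta> ||- \<chi>)"
    using later_trans elt_mono later_refl later_stage by meson
  finally show ?thesis .
qed

lemma forces_ssubst_ExistsI:
  assumes "stage \<Gamma>" "wf_fm L \<phi>" "env \<Gamma> \<sigma> (fv \<phi> - {x})"
    and "elt \<Gamma> (snd x) t" "\<Gamma> ||- ssubst (\<sigma>(x := t)) \<phi>"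
  shows "\<Gamma> ||- ssubst \<sigma> (Exists x \<phi>)"
  unfolding forces_ssubst_Exists_iff[OF assms(1,2) wf_ty_elt[OF assms(4)] assms(3)]
  using assms(4,5) elt_mono forces_mono later_refl later_stage by blast

lemma forces_ssubst_ExistsE:
  assumes "\<Gamma> ||- ssubst \<sigma> (Exists x \<phi>)" "wf_fm L \<phi>" "wf_var L x" "env \<Gamma> \<sigma> (fv \<phi> - {x})"
    and "elt \<Gamma> Omega \<chi>"
    and "\<And>\<Delta> t. \<Gamma> \<preceq> \<Delta> \<Longrightarrow> elt \<Delta> (snd x) t \<Longrightarrow> \<Delta> ||- ssubst (\<sigma>(x := t)) \<phi> \<Longrightarrow> \<Delta> ||- \<chi>"
  shows "\<Gamma> ||- \<chi>"
  using assms(1) unfolding forces_ssubst_Exists_iff[OF forces_stage[OF assms(1)] assms(2-4)]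
  using forces_stage[OF assms(1)] assms(5,6) by simp

lemma wf_fm_foldr_Exists [simp]:
  "wf_fm L (foldr Exists xs \<phi>) \<longleftrightarrow> (\<forall>x \<in> set xs. wf_var L x) \<and> wf_fm L \<phi>"
  by (induction xs) auto

lemma fv_foldr_Exists [simp]: "fv (foldr Exists xs \<phi>) = fv \<phi> - set xs"
  by (induction xs) auto

abbreviation elts :: "('g, 'f) trm set \<Rightarrow> 'g var list \<Rightarrow> ('g, 'f) trm list \<Rightarrow> bool" where
  "elts \<Gamma> \<equiv> list_all2 (\<lambda>x. elt \<Gamma> (snd x))"

lemma wf_var_elts: "elts \<Gamma> xs ts \<Longrightarrow> \<forall>x \<in> set xs. wf_var L x"
  by (induction rule: list_all2_induct) (simp_all, blast dest: wf_ty_elt)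

lemma env_upds: "elts \<Gamma> xs ts \<Longrightarrow> env \<Gamma> \<sigma> (W - set xs) \<Longrightarrow> env \<Gamma> (upds \<sigma> xs ts) W"
proof (induction arbitrary: \<sigma> rule: list_all2_induct)
  case (Cons x xs t ts)
  then have "env \<Gamma> (\<sigma>(x := t)) (W - set xs)" by (auto simp: env_def)
  then show ?case using Cons.IH by simp
qed simp

lemma forces_ssubst_foldr_ExistsI:
  "elts \<Gamma> xs ts \<Longrightarrow> stage \<Gamma> \<Longrightarrow> wf_fm L \<phi> \<Longrightarrow> env \<Gamma> \<sigma> (fv \<phi> - set xs) \<Longrightarrow>
    \<Gamma> ||- ssubst (upds \<sigma> xs ts) \<phi> \<Longrightarrow> \<Gamma> ||- ssubst \<sigma> (foldr Exists xs \<phi>)"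
proof (induction arbitrary: \<sigma> rule: list_all2_induct)
  case (Cons x xs t ts)
  have "env \<Gamma> (\<sigma>(x := t)) (fv \<phi> - set xs)"
    using Cons.prems(3) Cons.hyps by (auto simp: env_def)
  then have "\<Gamma> ||- ssubst (\<sigma>(x := t)) (foldr Exists xs \<phi>)"
    using Cons by simp
  moreover have "wf_fm L (foldr Exists xs \<phi>)"
    using wf_var_elts[OF Cons.hyps(2)] Cons.prems(2) by simp
  moreover have "env \<Gamma> \<sigma> (fv (foldr Exists xs \<phi>) - {x})"
    using Cons.prems(3) by (auto simp: env_def)
  ultimately show ?case
    using Cons by (simp add: forces_ssubst_ExistsI)
qed simp

lemma forces_ssubst_foldr_ExistsE:
  assumes "\<Gamma> ||- ssubst \<sigma> (foldr Exists xs \<phi>)" "wf_fm L \<phi>" "\<forall>x \<in> set xs. wf_var L x"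
    "env \<Gamma> \<sigma> (fv \<phi> - set xs)" "elt \<Gamma> Omega \<chi>"
    and "\<And>\<Delta> ts. \<Gamma> \<preceq> \<Delta> \<Longrightarrow> elts \<Delta> xs ts \<Longrightarrow> \<Delta> ||- ssubst (upds \<sigma> xs ts) \<phi> \<Longrightarrow> \<Delta> ||- \<chi>"
  shows "\<Gamma> ||- \<chi>"
  using assms
proof (induction xs arbitrary: \<Gamma> \<sigma>)
  case Nil
  show ?case using Nil.prems(6)[of \<Gamma> "[]"] Nil.prems(1) forces_stage by simp
next
  case (Cons x xs)
  have ex: "\<Gamma> ||- ssubst \<sigma> (Exists x (foldr Exists xs \<phi>))" using Cons.prems(1) by simp
  show ?case
  proof (rule forces_ssubst_ExistsE[OF ex])
    show "env \<Gamma> \<sigma> (fv (foldr Exists xs \<phi>) - {x})"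
      using Cons.prems(4) by (auto simp: env_def)
    fix \<Delta> t assume \<Delta>: "\<Gamma> \<preceq> \<Delta>" and t: "elt \<Delta> (snd x) t"
      and f: "\<Delta> ||- ssubst (\<sigma>(x := t)) (foldr Exists xs \<phi>)"
    show "\<Delta> ||- \<chi>"
    proof (rule Cons.IH[OF f])
      show "env \<Delta> (\<sigma>(x := t)) (fv \<phi> - set xs)"
        using env_mono[OF Cons.prems(4) \<Delta>] t by (auto simp: env_def)
      fix \<Theta> ts assume "\<Delta> \<preceq> \<Theta>" "elts \<Theta> xs ts" "\<Theta> ||- ssubst (upds (\<sigma>(x := t)) xs ts) \<phi>"
      then show "\<Theta> ||- \<chi>"
        using Cons.prems(6)[of \<Theta> "t # ts"] later_trans[OF \<Delta>] elt_mono[OF t] by simp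
    qed (use Cons.prems elt_mono[OF _ \<Delta>] in auto)
  qed (use Cons.prems in auto)
qed

end

section \<open>Relations between elements at a stage\<close>

lemma ssubst_tup [simp]: "ssubst \<sigma> (tup ts) = tup (map (ssubst \<sigma>) ts)"
  by (induction ts rule: tup.induct) simp_all

lemma fv_tup [simp]: "fv (tup ts) = (\<Union>t \<in> set ts. fv t)"
  by (induction ts rule: tup.induct) auto

lemma wf_trm_tup: "\<forall>t \<in> set ts. wf_trm L t \<Longrightarrow> wf_trm L (tup ts)"
  by (induction ts rule: tup.induct) auto

lemma ty_of_tup [simp]: "ty_of (tup ts) = prod_ty (map ty_of ts)"
  by (induction ts rule: tup.induct) auto

lemma fresh_vars_props:
  shows "length (fresh_vars V As) = length As" "distinct (fresh_vars V As)"
    "map snd (fresh_vars V As) = As"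
  by (simp_all add: fresh_vars_def distinct_zipI1)

context local_set_theory_in
begin

lemma elt_tup: "stage \<Gamma> \<Longrightarrow> list_all2 (elt \<Gamma>) As ts \<Longrightarrow> elt \<Gamma> (prod_ty As) (tup ts)"
  by (induction ts arbitrary: As rule: tup.induct)
    (auto simp: list_all2_Cons2 elt_Tup elt_def[of _ One])

text \<open>A tuple with one component is that component, and then the equation is already the
  claim; only from two components on is there something to project from.\<close>

lemma forces_tup_eqD:
  assumes "\<Gamma> ||- Eq (tup ss) (tup ts)" "length ss = length ts" "i < length ss"
  shows "\<Gamma> ||- Eq (ss ! i) (ts ! i)"
proof (cases ss rule: tup.cases)
  case (2 s)
  with assms show ?thesis by (cases ts rule: tup.cases) auto
next
  case (3 s s' ss')
  then obtain t t' ts' where "ts = t # t' # ts'"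
    using assms(2) by (cases ts rule: tup.cases) auto
  with 3 have "\<Gamma> ||- Eq (Tup ss) (Tup ts)" using assms(1) by simp
  with forces_Tup_eq_iff[OF forces_stage[OF this] forces_elt_Eq[OF this, simplified]] assms(3)
  show ?thesis by simp
qed (use assms in simp)

lemma forces_pair_eqD:
  assumes "\<Gamma> ||- Eq (Tup [a, b]) (Tup [c, d])"
  shows "\<Gamma> ||- Eq a c" "\<Gamma> ||- Eq b d"
  using forces_tup_eqD[of \<Gamma> "[a, b]" "[c, d]" 0] forces_tup_eqD[of \<Gamma> "[a, b]" "[c, d]" 1] assms by simp_all

lemma forces_pair_eqI: "\<Gamma> ||- Eq a c \<Longrightarrow> \<Gamma> ||- Eq b d \<Longrightarrow> \<Gamma> ||- Eq (Tup [a, b]) (Tup [c, d])"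
  by (rule forces_cong_Tup) (auto simp: less_Suc_eq)

abbreviation related :: "('g, 'f) trm set \<Rightarrow> ('g, 'f) trm \<Rightarrow> ('g, 'f) trm \<Rightarrow> ('g, 'f) trm \<Rightarrow> bool" where
  "related \<Gamma> G a b \<equiv> \<Gamma> ||- Mem (Tup [a, b]) G"

lemma related_cong:
  assumes "related \<Gamma> G a b" "\<Gamma> ||- Eq a a'" "\<Gamma> ||- Eq b b'"
  shows "related \<Gamma> G a' b'"
proof -
  have "elt \<Gamma> (ty_of G) G" using forces_elt[OF assms(1)] by (simp add: elt_def)
  with assms show ?thesis
    by (meson forces_Mem_cong forces_pair_eqI forces_refl forces_stage)
qed

definition closed_graph :: "'g ty \<Rightarrow> 'g ty \<Rightarrow> ('g, 'f) trm \<Rightarrow> bool" where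
  "closed_graph A B G \<longleftrightarrow> wf_trm L G \<and> fv G = {} \<and> ty_of G = Pow (Prod [A, B])"

abbreviation sgraph :: "('g, 'f) sfun \<Rightarrow> bool" where
  "sgraph f \<equiv> closed_graph (elem_ty (src f)) (elem_ty (tgt f)) (graph f)"

lemma related_elt:
  assumes "related \<Gamma> G a b" "closed_graph A B G"
  shows "elt \<Gamma> A a" "elt \<Gamma> B b"
  using forces_elt[OF assms(1)] assms(2) by (auto simp: elt_def closed_graph_def)

lemma wf_ty_closed_graph:
  assumes "closed_graph A B G"
  shows "wf_ty L A" "wf_ty L B"
  using assms wf_ty_ty_of[OF local_language, of G] by (auto simp: closed_graph_def)

section \<open>Membership in sets of the form {t : \<phi>}\<close>

definition closed_set_of :: "'g var list \<Rightarrow> ('g, 'f) trm \<Rightarrow> ('g, 'f) trm \<Rightarrow> bool" where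
  "closed_set_of xs t \<phi> \<longleftrightarrow> (\<forall>x \<in> set xs. wf_var L x) \<and> wf_trm L t \<and> wf_fm L \<phi> \<and>
    fv t \<subseteq> set xs \<and> fv \<phi> \<subseteq> set xs"

lemma Set_of_closed:
  assumes "closed_set_of xs t \<phi>"
  shows "wf_trm L (Set_of xs t \<phi>)" "fv (Set_of xs t \<phi>) = {}" "ty_of (Set_of xs t \<phi>) = Pow (ty_of t)"
  using assms wf_ty_ty_of[OF local_language, of t]
  by (auto simp: Set_of_def Let_def closed_set_of_def)

lemma upds_base: "fv t \<subseteq> set xs \<Longrightarrow> elts \<Gamma> xs ts \<Longrightarrow> ssubst (upds \<sigma> xs ts) t = ssubst (upds \<rho> xs ts) t"
  by (intro ssubst_cong ballI upds_in) (auto dest: list_all2_lengthD)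

context
  fixes xs t \<phi>
  assumes closed: "closed_set_of xs t \<phi>"
begin

text \<open>The bound variable of \<open>Set_of\<close> is a particular fresh choice; obtaining it
  hides the choice and keeps only its freshness, its type and the unfolded membership.\<close>

lemma Mem_Set_of_iff:
  assumes "stage \<Gamma>" "elt \<Gamma> (ty_of t) p"
  obtains z where "z \<notin> set xs" "z \<notin> fv t" "z \<notin> fv \<phi>" "snd z = ty_of t" "env \<Gamma> (Var(z := p)) {z}"
    "\<Gamma> ||- Mem p (Set_of xs t \<phi>) \<longleftrightarrow>
      \<Gamma> ||- ssubst (Var(z := p)) (foldr Exists xs (And (Eq (Var z) t) \<phi>))"
proof -
  let ?V = "set xs \<union> fv t \<union> fv \<phi>"
  define z where "z = (fresh ?V, ty_of t)"
  have "z \<notin> ?V" unfolding z_def by (rule fresh_notin) simp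
  moreover have "Set_of xs t \<phi> = Compr z (foldr Exists xs (And (Eq (Var z) t) \<phi>))"
    by (simp add: Set_of_def Let_def z_def)
  moreover have "wf_fm L (foldr Exists xs (And (Eq (Var z) t) \<phi>))"
    using closed wf_ty_ty_of[OF local_language, of t] by (simp add: closed_set_of_def z_def)
  moreover have "fv (foldr Exists xs (And (Eq (Var z) t) \<phi>)) - {z} \<subseteq> fvs \<Gamma>"
    using closed by (auto simp: closed_set_of_def)
  ultimately show ?thesis
    using assms by (intro that[of z]) (auto simp: forces_Mem_Compr_iff subst_def env_def z_def)
qed

lemma Mem_Set_ofI:
  assumes "stage \<Gamma>" "elts \<Gamma> xs ts" "\<Gamma> ||- Eq p (ssubst (upds Var xs ts) t)"
    and "\<Gamma> ||- ssubst (upds Var xs ts) \<phi>"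
  shows "\<Gamma> ||- Mem p (Set_of xs t \<phi>)"
proof -
  have sub: "fv t \<subseteq> set xs" "fv \<phi> \<subseteq> set xs" and wf: "wf_trm L t" "wf_fm L \<phi>"
    using closed by (auto simp: closed_set_of_def)
  have "env \<Gamma> (upds Var xs ts) (fv t)"
    using assms(2) sub by (intro env_upds) (auto simp: env_def)
  then have "elt \<Gamma> (ty_of t) (ssubst (upds Var xs ts) t)" by (rule elt_ssubst[OF wf(1)])
  then have p: "elt \<Gamma> (ty_of t) p"
    using forces_elt_Eq[OF assms(3)] by (simp add: elt_def)
  from Mem_Set_of_iff[OF assms(1) p] obtain z where z: "z \<notin> set xs" "z \<notin> fv t" "z \<notin> fv \<phi>"
    "snd z = ty_of t" "env \<Gamma> (Var(z := p)) {z}"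
    and iff: "\<Gamma> ||- Mem p (Set_of xs t \<phi>) \<longleftrightarrow>
      \<Gamma> ||- ssubst (Var(z := p)) (foldr Exists xs (And (Eq (Var z) t) \<phi>))" .
  show ?thesis
    unfolding iff
  proof (rule forces_ssubst_foldr_ExistsI[OF assms(2,1)])
    show "wf_fm L (And (Eq (Var z) t) \<phi>)"
      using wf z wf_ty_elt[OF p] by simp
    show "env \<Gamma> (Var(z := p)) (fv (And (Eq (Var z) t) \<phi>) - set xs)"
      using z(5) by (rule env_subset) (use sub in auto)
    \<comment> \<open>All free variables of \<open>t\<close> and \<open>\<phi>\<close> are listed in
      \<open>xs\<close>, so the binding of \<open>z\<close> is seen only by the equation, where it
      yields \<open>p\<close>.\<close>
    have "ssubst (upds (Var(z := p)) xs ts) (And (Eq (Var z) t) \<phi>) =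
        And (Eq p (ssubst (upds Var xs ts) t)) (ssubst (upds Var xs ts) \<phi>)"
      using upds_base[OF sub(1) assms(2), of "Var(z := p)" Var] upds_base[OF sub(2) assms(2), of "Var(z := p)" Var] z(1) by (simp add: upds_notin)
    then show "\<Gamma> ||- ssubst (upds (Var(z := p)) xs ts) (And (Eq (Var z) t) \<phi>)"
      using assms by (simp add: forces_And_iff forces_elt)
  qed
qed

lemma Mem_Set_ofE:
  assumes mem: "\<Gamma> ||- Mem p (Set_of xs t \<phi>)" and \<chi>: "elt \<Gamma> Omega \<chi>"
    and E: "\<And>\<Delta> ts. \<Gamma> \<preceq> \<Delta> \<Longrightarrow> elts \<Delta> xs ts \<Longrightarrow> \<Delta> ||- Eq p (ssubst (upds Var xs ts) t) \<Longrightarrow>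
      \<Delta> ||- ssubst (upds Var xs ts) \<phi> \<Longrightarrow> \<Delta> ||- \<chi>"
  shows "\<Gamma> ||- \<chi>"
proof -
  have sub: "fv t \<subseteq> set xs" "fv \<phi> \<subseteq> set xs" and wf: "wf_trm L t" "wf_fm L \<phi>"
    using closed by (auto simp: closed_set_of_def)
  note st = forces_stage[OF mem]
  have p: "elt \<Gamma> (ty_of t) p"
    using forces_elt[OF mem] Set_of_closed(3)[OF closed] by (simp add: elt_def)
  from Mem_Set_of_iff[OF st p] obtain z where z: "z \<notin> set xs" "z \<notin> fv t" "z \<notin> fv \<phi>"
    "snd z = ty_of t" "env \<Gamma> (Var(z := p)) {z}"
    and iff: "\<Gamma> ||- Mem p (Set_of xs t \<phi>) \<longleftrightarrow>
      \<Gamma> ||- ssubst (Var(z := p)) (foldr Exists xs (And (Eq (Var z) t) \<phi>))" .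
  show ?thesis
  proof (rule forces_ssubst_foldr_ExistsE[OF mem[unfolded iff] _ _ _ \<chi>])
    show "wf_fm L (And (Eq (Var z) t) \<phi>)"
      using wf z wf_ty_elt[OF p] by simp
    show "\<forall>x \<in> set xs. wf_var L x"
      using closed by (auto simp: closed_set_of_def)
    show "env \<Gamma> (Var(z := p)) (fv (And (Eq (Var z) t) \<phi>) - set xs)"
      using z(5) by (rule env_subset) (use sub in auto)
    fix \<Delta> ts assume \<Delta>: "\<Gamma> \<preceq> \<Delta>" and ts: "elts \<Delta> xs ts"
      and f: "\<Delta> ||- ssubst (upds (Var(z := p)) xs ts) (And (Eq (Var z) t) \<phi>)"
    have "ssubst (upds (Var(z := p)) xs ts) (And (Eq (Var z) t) \<phi>) =
        And (Eq p (ssubst (upds Var xs ts) t)) (ssubst (upds Var xs ts) \<phi>)"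
      using upds_base[OF sub(1) ts, of "Var(z := p)" Var] upds_base[OF sub(2) ts, of "Var(z := p)" Var] z(1) by (simp add: upds_notin)
    with f have f': "\<Delta> ||- And (Eq p (ssubst (upds Var xs ts) t)) (ssubst (upds Var xs ts) \<phi>)"
      by simp
    then have "elt \<Delta> Omega (Eq p (ssubst (upds Var xs ts) t))" "elt \<Delta> Omega (ssubst (upds Var xs ts) \<phi>)"
      using forces_elt[OF f'] unfolding elt_Omega_iff by simp_all
    with f' show "\<Delta> ||- \<chi>"
      using E[OF \<Delta> ts] by (simp add: forces_And_iff[OF later_stage[OF \<Delta>]])
  qed
qed

end

section \<open>Graphs of explicitly given maps\<close>

lemma Mem_Univ: "stage \<Gamma> \<Longrightarrow> elt \<Gamma> A t \<Longrightarrow> \<Gamma> ||- Mem t (Univ A)"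
  unfolding Univ_def using forces_Mem_Compr_iff[of \<Gamma> Tru "(0, A)" t] forces_Tru by (simp add: subst_def)

lemma Univ_closed: "wf_ty L A \<Longrightarrow> wf_trm L (Univ A)" "fv (Univ A) = {}" "ty_of (Univ A) = Pow A"
  by (simp_all add: Univ_def)

lemma graph_maps_to:
  "graph (maps_to xs t X Y) = Set_of xs (Tup [tup (map Var xs), t]) (Mem (tup (map Var xs)) X)"
  "src (maps_to xs t X Y) = X" "tgt (maps_to xs t X Y) = Y"
  by (simp_all add: maps_to_def)

lemma closed_set_of_maps_to:
  assumes "\<forall>x \<in> set xs. wf_var L x" "wf_trm L t" "fv t \<subseteq> set xs"
    and "wf_trm L X" "fv X = {}" "ty_of X = Pow (prod_ty (map snd xs))"
  shows "closed_set_of xs (Tup [tup (map Var xs), t]) (Mem (tup (map Var xs)) X)"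
  using assms wf_trm_tup[of "map Var xs" L] by (simp add: closed_set_of_def comp_def)

lemma maps_to_closed_graph:
  assumes "closed_set_of xs (Tup [tup (map Var xs), t]) (Mem (tup (map Var xs)) X)"
  shows "closed_graph (prod_ty (map snd xs)) (ty_of t) (graph (maps_to xs t X Y))"
  using Set_of_closed[OF assms] by (simp add: closed_graph_def graph_maps_to comp_def)

lemma related_maps_toI:
  assumes "closed_set_of xs (Tup [tup (map Var xs), t]) (Mem (tup (map Var xs)) X)"
    and "distinct xs" "fv X = {}" "elts \<Gamma> xs ts" "\<Gamma> ||- Mem (tup ts) X"
    and "\<Gamma> ||- Eq a (tup ts)" "\<Gamma> ||- Eq b (ssubst (upds Var xs ts) t)"
  shows "related \<Gamma> (graph (maps_to xs t X Y)) a b"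
  unfolding graph_maps_to
  using assms
  by (intro Mem_Set_ofI[OF assms(1) _ assms(4)])
    (auto simp: comp_def map_upds[OF list_all2_lengthD[OF assms(4), symmetric]] ssubst_closed
      intro: forces_pair_eqI forces_stage)

lemma related_maps_toE:
  assumes "closed_set_of xs (Tup [tup (map Var xs), t]) (Mem (tup (map Var xs)) X)"
    and "distinct xs" "fv X = {}" and rel: "related \<Gamma> (graph (maps_to xs t X Y)) a b"
    and "elt \<Gamma> Omega \<chi>"
    and E: "\<And>\<Delta> ts. \<Gamma> \<preceq> \<Delta> \<Longrightarrow> elts \<Delta> xs ts \<Longrightarrow> \<Delta> ||- Eq a (tup ts) \<Longrightarrow>
      \<Delta> ||- Eq b (ssubst (upds Var xs ts) t) \<Longrightarrow> \<Delta> ||- Mem (tup ts) X \<Longrightarrow> \<Delta> ||- \<chi>"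
  shows "\<Gamma> ||- \<chi>"
proof (rule Mem_Set_ofE[OF assms(1) rel[unfolded graph_maps_to] assms(5)])
  fix \<Delta> ts
  assume \<Delta>: "\<Gamma> \<preceq> \<Delta>" and ts: "elts \<Delta> xs ts"
    and eq: "\<Delta> ||- Eq (Tup [a, b]) (ssubst (upds Var xs ts) (Tup [tup (map Var xs), t]))"
    and mem: "\<Delta> ||- ssubst (upds Var xs ts) (Mem (tup (map Var xs)) X)"
  note m = map_upds[OF list_all2_lengthD[OF ts, symmetric] assms(2)]
  have "\<Delta> ||- Eq (Tup [a, b]) (Tup [tup ts, ssubst (upds Var xs ts) t])"
    using eq by (simp add: comp_def m)
  moreover have "\<Delta> ||- Mem (tup ts) X"
    using mem by (simp add: comp_def m ssubst_closed[OF assms(3)])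
  ultimately show "\<Delta> ||- \<chi>" using E[OF \<Delta> ts] forces_pair_eqD by blast
qed

text \<open>Identities and inclusions are built in the same way and differ only in the codomain
  \<open>Y\<close>, so this serves both.\<close>

lemma related_identity_iff:
  assumes "wf_trm L X" "fv X = {}" "ty_of X = Pow (snd x)"
  shows "related \<Gamma> (graph (maps_to [x] (Var x) X Y)) a b \<longleftrightarrow> \<Gamma> ||- Eq a b \<and> \<Gamma> ||- Mem a X"
proof
  have wx: "wf_var L x" using wf_ty_ty_of[OF local_language assms(1)] assms(3) by simp
  have c: "closed_set_of [x] (Tup [tup (map Var [x]), Var x]) (Mem (tup (map Var [x])) X)"
    by (rule closed_set_of_maps_to) (use assms wx in auto)
  show "\<Gamma> ||- Eq a b \<and> \<Gamma> ||- Mem a X" if rel: "related \<Gamma> (graph (maps_to [x] (Var x) X Y)) a b"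
  proof -
    note ab = related_elt[OF rel maps_to_closed_graph[OF c]]
    have el: "elt \<Gamma> Omega (And (Eq a b) (Mem a X))"
      unfolding elt_Omega_iff using ab assms by (simp add: elt_def)
    \<comment> \<open>The two claims are packed into one formula since the elimination rule needs a
      single goal.\<close>
    have "\<Gamma> ||- And (Eq a b) (Mem a X)"
    proof (rule related_maps_toE[OF c _ assms(2) rel el])
      fix \<Delta> ts
      assume \<Delta>: "\<Gamma> \<preceq> \<Delta>" and ts: "elts \<Delta> [x] ts" and eq: "\<Delta> ||- Eq a (tup ts)"
        "\<Delta> ||- Eq b (ssubst (upds Var [x] ts) (Var x))" and mem: "\<Delta> ||- Mem (tup ts) X"
      from ts obtain t where t: "ts = [t]" by (auto simp: list_all2_Cons1)
      have eq': "\<Delta> ||- Eq a t" "\<Delta> ||- Eq b t" and mem': "\<Delta> ||- Mem t X"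
        using eq mem by (simp_all add: t)
      have "\<Delta> ||- Eq a b" by (rule forces_trans[OF eq'(1) forces_sym[OF eq'(2)]])
      moreover have "\<Delta> ||- Mem a X"
        using forces_refl[OF later_stage[OF \<Delta>], of _ X] assms
        by (intro forces_Mem_cong[OF mem' forces_sym[OF eq'(1)]]) (simp add: elt_def)
      ultimately show "\<Delta> ||- And (Eq a b) (Mem a X)"
        using later_stage[OF \<Delta>] by (simp add: forces_And_iff forces_elt)
    qed simp
    moreover have "elt \<Gamma> Omega (Eq a b)" "elt \<Gamma> Omega (Mem a X)"
      using ab assms by (auto simp: elt_Omega_iff elt_def)
    ultimately show ?thesis using forces_And_iff forces_stage[OF rel] by blast
  qed
  show "related \<Gamma> (graph (maps_to [x] (Var x) X Y)) a b" if "\<Gamma> ||- Eq a b \<and> \<Gamma> ||- Mem a X"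
  proof (rule related_maps_toI[OF c _ assms(2), of _ "[a]"])
    have "elt \<Gamma> (snd x) a" using that forces_elt[of \<Gamma> "Mem a X"] assms by (simp add: elt_def)
    then show "elts \<Gamma> [x] [a]" "\<Gamma> ||- Eq a (tup [a])"
      using forces_refl[OF forces_stage] that by auto
    show "\<Gamma> ||- Eq b (ssubst (upds Var [x] [a]) (Var x))"
      using forces_sym[of \<Gamma> a b] that by simp
  qed (use that in auto)
qed


section \<open>Composites of graphs\<close>

abbreviation comp_fm ::
  "'g var \<Rightarrow> 'g var \<Rightarrow> 'g var \<Rightarrow> ('g, 'f) sfun \<Rightarrow> ('g, 'f) sfun \<Rightarrow> ('g, 'f) trm" where
  "comp_fm x y z f g \<equiv> And (Mem (Tup [Var x, Var y]) (graph f)) (Mem (Tup [Var y, Var z]) (graph g))"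

lemma s_comp_Set_of:
  assumes f: "sgraph f" and g: "sgraph g" and ty: "elem_ty (src g) = elem_ty (tgt f)"
  obtains x y z where "snd x = elem_ty (src f)" "snd y = elem_ty (tgt f)" "snd z = elem_ty (tgt g)"
    "x \<noteq> y" "y \<noteq> z" "x \<noteq> z"
    "graph (s_comp g f) = Set_of [x, z] (Tup [Var x, Var z])
      (Exists y (comp_fm x y z f g))"
    "closed_set_of [x, z] (Tup [Var x, Var z])
      (Exists y (comp_fm x y z f g))"
proof -
  define n where "n = fresh (fv (graph f) \<union> fv (graph g))"
  show ?thesis
  proof (rule that[of "(n, elem_ty (src f))" "(n + 1, elem_ty (tgt f))" "(n + 2, elem_ty (tgt g))"])
    let ?x = "(n, elem_ty (src f))" and ?y = "(n + 1, elem_ty (tgt f))" and ?z = "(n + 2, elem_ty (tgt g))"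
    show "closed_set_of [?x, ?z] (Tup [Var ?x, Var ?z])
        (Exists ?y (comp_fm ?x ?y ?z f g))"
      using f g ty wf_ty_closed_graph[OF f] wf_ty_closed_graph[OF g]
      by (auto simp: closed_set_of_def closed_graph_def)
  qed (simp_all add: s_comp_def Let_def n_def)
qed

lemma s_comp_simps [simp]: "src (s_comp g f) = src f" "tgt (s_comp g f) = tgt g"
  by (simp_all add: s_comp_def Let_def)

lemma s_comp_sgraph:
  assumes f: "sgraph f" and g: "sgraph g" and ty: "elem_ty (src g) = elem_ty (tgt f)"
  shows "sgraph (s_comp g f)"
proof -
  from s_comp_Set_of[OF assms] obtain x y z where
    "snd x = elem_ty (src f)" "snd z = elem_ty (tgt g)" and
    eq: "graph (s_comp g f) = Set_of [x, z] (Tup [Var x, Var z])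
      (Exists y (comp_fm x y z f g))" and
    c: "closed_set_of [x, z] (Tup [Var x, Var z])
      (Exists y (comp_fm x y z f g))"
    by metis
  with Set_of_closed[OF c] show ?thesis by (simp add: closed_graph_def)
qed

lemma related_s_compI:
  assumes f: "sgraph f" and g: "sgraph g" and ty: "elem_ty (src g) = elem_ty (tgt f)"
    and ab: "related \<Gamma> (graph f) a b" and bc: "related \<Gamma> (graph g) b c"
  shows "related \<Gamma> (graph (s_comp g f)) a c"
proof -
  from s_comp_Set_of[OF f g ty] obtain x y z where
    xyz: "snd x = elem_ty (src f)" "snd y = elem_ty (tgt f)" "snd z = elem_ty (tgt g)"
    "x \<noteq> y" "y \<noteq> z" "x \<noteq> z" and
    eq: "graph (s_comp g f) = Set_of [x, z] (Tup [Var x, Var z])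
      (Exists y (comp_fm x y z f g))" and
    c: "closed_set_of [x, z] (Tup [Var x, Var z])
      (Exists y (comp_fm x y z f g))"
    by metis
  let ?\<phi> = "comp_fm x y z f g"
  note ab' = related_elt[OF ab f] and bc' = related_elt[OF bc g]
  note st = forces_stage[OF ab]
  have cl: "fv (graph f) = {}" "fv (graph g) = {}" using f g by (auto simp: closed_graph_def)
  let ?\<sigma> = "upds Var [x, z] [a, c]"
  have el: "elts \<Gamma> [x, z] [a, c]" using ab' bc' xyz by simp
  show ?thesis unfolding eq
  proof (rule Mem_Set_ofI[OF c st el])
    show "\<Gamma> ||- Eq (Tup [a, c]) (ssubst ?\<sigma> (Tup [Var x, Var z]))"
      using forces_pair_eqI[OF forces_refl[OF st ab'(1)] forces_refl[OF st bc'(2)]] xyz by simp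
    show "\<Gamma> ||- ssubst ?\<sigma> (Exists y ?\<phi>)"
    proof (rule forces_ssubst_ExistsI[OF st, of _ _ _ b])
      show "wf_fm L ?\<phi>" using c by (simp add: closed_set_of_def)
      have "fv ?\<phi> - {y} \<subseteq> {x, z}" using cl by auto
      then show "env \<Gamma> ?\<sigma> (fv ?\<phi> - {y})"
        using ab' bc' xyz by (auto simp: env_def)
      show "elt \<Gamma> (snd y) b" using ab' xyz by simp
      show "\<Gamma> ||- ssubst (?\<sigma>(y := b)) ?\<phi>"
        using ab bc cl xyz st by (simp add: ssubst_closed forces_And_iff forces_elt)
    qed
  qed
qed

text \<open>The intermediate point comes from an existential formula, hence only at later stages and
  for a goal formula. The pair found by opening the set is merely equal to the given one, so both
  memberships are carried back along the equations of the components.\<close>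

lemma related_s_compE:
  assumes f: "sgraph f" and g: "sgraph g" and ty: "elem_ty (src g) = elem_ty (tgt f)"
    and rel: "related \<Gamma> (graph (s_comp g f)) a c" and \<chi>: "elt \<Gamma> Omega \<chi>"
    and E: "\<And>\<Delta> b. \<Gamma> \<preceq> \<Delta> \<Longrightarrow> related \<Delta> (graph f) a b \<Longrightarrow> related \<Delta> (graph g) b c \<Longrightarrow> \<Delta> ||- \<chi>"
  shows "\<Gamma> ||- \<chi>"
proof -
  from s_comp_Set_of[OF f g ty] obtain x y z where
    xyz: "snd x = elem_ty (src f)" "snd y = elem_ty (tgt f)" "snd z = elem_ty (tgt g)"
    "x \<noteq> y" "y \<noteq> z" "x \<noteq> z" and
    eq: "graph (s_comp g f) = Set_of [x, z] (Tup [Var x, Var z])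
      (Exists y (comp_fm x y z f g))" and
    c: "closed_set_of [x, z] (Tup [Var x, Var z])
      (Exists y (comp_fm x y z f g))"
    by metis
  let ?\<phi> = "comp_fm x y z f g"
  have cl: "fv (graph f) = {}" "fv (graph g) = {}" using f g by (auto simp: closed_graph_def)
  show ?thesis
  proof (rule Mem_Set_ofE[OF c rel[unfolded eq] \<chi>])
    fix \<Delta> ts
    assume \<Delta>: "\<Gamma> \<preceq> \<Delta>" and ts: "elts \<Delta> [x, z] ts"
      and p: "\<Delta> ||- Eq (Tup [a, c]) (ssubst (upds Var [x, z] ts) (Tup [Var x, Var z]))"
      and ex: "\<Delta> ||- ssubst (upds Var [x, z] ts) (Exists y ?\<phi>)"
    from ts obtain a' c' where t: "ts = [a', c']" and el: "elt \<Delta> (snd x) a'" "elt \<Delta> (snd z) c'"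
      by (auto simp: list_all2_Cons1)
    have "\<Delta> ||- Eq (Tup [a, c]) (Tup [a', c'])" using p xyz by (simp add: t)
    note ac = forces_pair_eqD[OF this]
    show "\<Delta> ||- \<chi>"
    proof (rule forces_ssubst_ExistsE[OF ex])
      show "wf_fm L ?\<phi>" using c by (simp add: closed_set_of_def)
      show "wf_var L y" using wf_ty_closed_graph[OF f] xyz by simp
      have "fv ?\<phi> - {y} \<subseteq> {x, z}" using cl by auto
      then show "env \<Delta> (upds Var [x, z] ts) (fv ?\<phi> - {y})"
        using el xyz by (auto simp: env_def t)
      show "elt \<Delta> Omega \<chi>" using \<chi> \<Delta> by (rule elt_mono)
      fix \<Theta> b
      assume \<Theta>: "\<Delta> \<preceq> \<Theta>" and b: "elt \<Theta> (snd y) b" and "\<Theta> ||- ssubst ((upds Var [x, z] ts)(y := b)) ?\<phi>"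
      then have and_f: "\<Theta> ||- And (Mem (Tup [a', b]) (graph f)) (Mem (Tup [b, c']) (graph g))"
        using xyz cl by (simp add: t ssubst_closed)
      then have "elt \<Theta> Omega (Mem (Tup [a', b]) (graph f))" "elt \<Theta> Omega (Mem (Tup [b, c']) (graph g))"
        using forces_elt[OF and_f] unfolding elt_Omega_iff by simp_all
      then have "related \<Theta> (graph f) a' b" "related \<Theta> (graph g) b c'"
        using and_f by (simp_all add: forces_And_iff[OF later_stage[OF \<Theta>]])
      moreover have "\<Theta> ||- Eq a' a" "\<Theta> ||- Eq c' c" "\<Theta> ||- Eq b b"
        using ac \<Theta> b by (auto intro: forces_sym forces_mono forces_refl later_stage)
      ultimately have "related \<Theta> (graph f) a b" "related \<Theta> (graph g) b c"
        using related_cong by blast+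
      then show "\<Theta> ||- \<chi>" using E later_trans[OF \<Delta> \<Theta>] by blast
    qed
  qed
qed

section \<open>Products of graphs\<close>

lemma ty_of_Prod_set: "ty_of (Prod_set Xs) = Pow (prod_ty (map elem_ty Xs))"
  using fresh_vars_props(3)[of "\<Union>X \<in> set Xs. fv X" "map elem_ty Xs"]
  by (simp add: Prod_set_def Set_of_def Let_def comp_def)

lemma s_prod_simps: "src (s_prod fs) = Prod_set (map src fs)" "tgt (s_prod fs) = Prod_set (map tgt fs)"
  by (simp_all add: s_prod_def Let_def)

abbreviation tup_pair :: "'g var list \<Rightarrow> 'g var list \<Rightarrow> ('g, 'f) trm" where
  "tup_pair xs ys \<equiv> Tup [tup (map Var xs), tup (map Var ys)]"

abbreviation prod_fm :: "'g var list \<Rightarrow> 'g var list \<Rightarrow> ('g, 'f) sfun list \<Rightarrow> ('g, 'f) trm" where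
  "prod_fm xs ys fs \<equiv>
    Conj (map2 (\<lambda>(x, y) f. Mem (Tup [Var x, Var y]) (graph f)) (zip xs ys) fs)"

context
  fixes fs :: "('g, 'f) sfun list"
  assumes sgraphs: "\<forall>f \<in> set fs. sgraph f"
begin

lemma s_prod_Set_of:
  obtains xs ys where "length xs = length fs" "length ys = length fs" "distinct (xs @ ys)"
    "map snd xs = map (\<lambda>f. elem_ty (src f)) fs" "map snd ys = map (\<lambda>f. elem_ty (tgt f)) fs"
    "graph (s_prod fs) = Set_of (xs @ ys) (tup_pair xs ys)
      (prod_fm xs ys fs)"
    "closed_set_of (xs @ ys) (tup_pair xs ys)
      (prod_fm xs ys fs)"
proof -
  define As where "As = map (\<lambda>f. elem_ty (src f)) fs"
  define Bs where "Bs = map (\<lambda>f. elem_ty (tgt f)) fs"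
  define vs where "vs = fresh_vars (\<Union>f \<in> set fs. fv (graph f)) (As @ Bs)"
  define xs ys where "xs = take (length fs) vs" and "ys = drop (length fs) vs"
  have vs: "length vs = length fs + length fs" "distinct vs" "map snd vs = As @ Bs"
    using fresh_vars_props[of "\<Union>f \<in> set fs. fv (graph f)" "As @ Bs"]
    by (simp_all add: vs_def As_def Bs_def)
  have len: "length xs = length fs" "length ys = length fs"
    using vs by (simp_all add: xs_def ys_def)
  have xy: "xs @ ys = vs" by (simp add: xs_def ys_def)
  have ty: "map snd xs = As" "map snd ys = Bs"
    using vs(3) unfolding xs_def ys_def
    by (simp_all add: take_map[symmetric] drop_map[symmetric] As_def Bs_def)
  have nth: "snd (xs ! i) = elem_ty (src (fs ! i))" "snd (ys ! i) = elem_ty (tgt (fs ! i))"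
    if "i < length fs" for i
    using that ty len nth_map[of i xs snd] nth_map[of i ys snd] by (simp_all add: As_def Bs_def)
  have graphs: "sgraph (fs ! i)" if "i < length fs" for i
    using sgraphs that by simp
  have wf: "wf_var L v" if "v \<in> set (xs @ ys)" for v
    using that wf_ty_closed_graph[OF graphs] nth len by (auto simp: in_set_conv_nth; metis snd_conv)
  have conj: "wf_fm L \<phi> \<and> fv \<phi> \<subseteq> set (xs @ ys)"
    if "\<phi> \<in> set (map2 (\<lambda>(x, y) f. Mem (Tup [Var x, Var y]) (graph f)) (zip xs ys) fs)" for \<phi>
  proof -
    from that obtain i where i: "i < length fs"
      and \<phi>: "\<phi> = Mem (Tup [Var (xs ! i), Var (ys ! i)]) (graph (fs ! i))"
      using len by (auto simp: in_set_conv_nth)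
    have v: "xs ! i \<in> set (xs @ ys)" "ys ! i \<in> set (xs @ ys)"
      using i len by simp_all
    show ?thesis
      unfolding \<phi> using v wf[OF v(1)] wf[OF v(2)] graphs[OF i] nth[OF i] by (auto simp: closed_graph_def)
  qed
  show ?thesis
  proof (rule that[of xs ys])
    show "closed_set_of (xs @ ys) (tup_pair xs ys)
      (prod_fm xs ys fs)"
      unfolding closed_set_of_def wf_fm_Conj fv_Conj
    proof (intro conjI ballI UN_least)
      show "wf_trm L (tup_pair xs ys)"
        using wf by (simp add: wf_trm_tup)
    qed (use wf conj in auto)
    show "graph (s_prod fs) = Set_of (xs @ ys) (tup_pair xs ys)
      (prod_fm xs ys fs)"
      unfolding xy unfolding xs_def ys_def vs_def As_def Bs_def by (simp add: s_prod_def Let_def)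
  qed (use len ty vs xy in \<open>simp_all add: As_def Bs_def\<close>)
qed

lemma s_prod_sgraph: "sgraph (s_prod fs)"
proof -
  from s_prod_Set_of obtain xs ys where
    ty: "map snd xs = map (\<lambda>f. elem_ty (src f)) fs" "map snd ys = map (\<lambda>f. elem_ty (tgt f)) fs" and
    eq: "graph (s_prod fs) = Set_of (xs @ ys) (tup_pair xs ys)
      (prod_fm xs ys fs)" and
    c: "closed_set_of (xs @ ys) (tup_pair xs ys)
      (prod_fm xs ys fs)"
    by metis
  have "map (ty_of \<circ> Var) xs = map snd xs" "map (ty_of \<circ> Var) ys = map snd ys" by simp_all
  then show ?thesis
    using Set_of_closed[OF c] by (simp add: closed_graph_def eq s_prod_simps ty_of_Prod_set ty comp_def)
qed

lemma related_s_prodI: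
  assumes len: "length as = length fs" "length bs = length fs"
    and rel: "\<And>i. i < length fs \<Longrightarrow> related \<Gamma> (graph (fs ! i)) (as ! i) (bs ! i)"
    and a: "\<Gamma> ||- Eq a (tup as)" and b: "\<Gamma> ||- Eq b (tup bs)"
  shows "related \<Gamma> (graph (s_prod fs)) a b"
proof -
  from s_prod_Set_of obtain xs ys where
    lx: "length xs = length fs" "length ys = length fs" and d: "distinct (xs @ ys)" and
    ty: "map snd xs = map (\<lambda>f. elem_ty (src f)) fs" "map snd ys = map (\<lambda>f. elem_ty (tgt f)) fs" and
    eq: "graph (s_prod fs) = Set_of (xs @ ys) (tup_pair xs ys)
      (prod_fm xs ys fs)" and
    c: "closed_set_of (xs @ ys) (tup_pair xs ys)
      (prod_fm xs ys fs)"
    by metis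
  note st = forces_stage[OF a]
  have graphs: "sgraph (fs ! i)" if "i < length fs" for i using sgraphs that by simp
  have nth: "snd (xs ! i) = elem_ty (src (fs ! i))" "snd (ys ! i) = elem_ty (tgt (fs ! i))"
    if "i < length fs" for i
    using that ty lx nth_map[of i xs snd] nth_map[of i ys snd] by simp_all
  let ?\<sigma> = "upds Var (xs @ ys) (as @ bs)"
  have "map ?\<sigma> (xs @ ys) = as @ bs" using lx len d by (intro map_upds) simp_all
  then have m: "map ?\<sigma> xs = as" "map ?\<sigma> ys = bs" using lx len by simp_all
  have el: "elts \<Gamma> (xs @ ys) (as @ bs)"
    using related_elt[OF rel graphs] lx len nth
    by (intro list_all2_appendI) (simp_all add: list_all2_conv_all_nth)
  show ?thesis unfolding eq
  proof (rule Mem_Set_ofI[OF c st el])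
    show "\<Gamma> ||- Eq (Tup [a, b]) (ssubst ?\<sigma> (tup_pair xs ys))"
      using forces_pair_eqI[OF a b] by (simp add: comp_def m)
    have "\<Gamma> ||- \<phi>"
      if mem: "\<phi> \<in> set (map (ssubst ?\<sigma>) (map2 (\<lambda>(x, y) f. Mem (Tup [Var x, Var y]) (graph f)) (zip xs ys) fs))" for \<phi>
    proof -
      from mem obtain i where i: "i < length fs"
        and "\<phi> = ssubst ?\<sigma> (Mem (Tup [Var (xs ! i), Var (ys ! i)]) (graph (fs ! i)))"
        using lx by (auto simp: in_set_conv_nth)
      then have "\<phi> = Mem (Tup [as ! i, bs ! i]) (graph (fs ! i))"
        using graphs[OF i] lx len m nth_map[of i xs ?\<sigma>] nth_map[of i ys ?\<sigma>]
        by (simp add: closed_graph_def ssubst_closed)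
      with rel[OF i] show ?thesis by simp
    qed
    then show "\<Gamma> ||- ssubst ?\<sigma> (prod_fm xs ys fs)"
      unfolding ssubst_Conj using st by (subst forces_Conj_iff) (blast intro: forces_elt)+
  qed
qed

lemma related_s_prodE:
  assumes rel: "related \<Gamma> (graph (s_prod fs)) a b" and \<chi>: "elt \<Gamma> Omega \<chi>"
    and E: "\<And>\<Delta> as bs. \<Gamma> \<preceq> \<Delta> \<Longrightarrow> length as = length fs \<Longrightarrow> length bs = length fs \<Longrightarrow>
      (\<And>i. i < length fs \<Longrightarrow> related \<Delta> (graph (fs ! i)) (as ! i) (bs ! i)) \<Longrightarrow>
      \<Delta> ||- Eq a (tup as) \<Longrightarrow> \<Delta> ||- Eq b (tup bs) \<Longrightarrow> \<Delta> ||- \<chi>"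
  shows "\<Gamma> ||- \<chi>"
proof -
  from s_prod_Set_of obtain xs ys where
    lx: "length xs = length fs" "length ys = length fs" and d: "distinct (xs @ ys)" and
    eq: "graph (s_prod fs) = Set_of (xs @ ys) (tup_pair xs ys)
      (prod_fm xs ys fs)" and
    c: "closed_set_of (xs @ ys) (tup_pair xs ys)
      (prod_fm xs ys fs)"
    by metis
  have graphs: "sgraph (fs ! i)" if "i < length fs" for i using sgraphs that by simp
  show ?thesis
  proof (rule Mem_Set_ofE[OF c rel[unfolded eq] \<chi>])
    fix \<Delta> and ts :: "('g, 'f) trm list"
    let ?\<sigma> = "upds Var (xs @ ys) ts"
    let ?\<phi>s = "map2 (\<lambda>(x, y) f. Mem (Tup [Var x, Var y]) (graph f)) (zip xs ys) fs"
    assume \<Delta>: "\<Gamma> \<preceq> \<Delta>" and ts: "elts \<Delta> (xs @ ys) ts"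
      and p: "\<Delta> ||- Eq (Tup [a, b]) (ssubst ?\<sigma> (tup_pair xs ys))"
      and q: "\<Delta> ||- ssubst ?\<sigma> (Conj ?\<phi>s)"
    define as bs where "as = map ?\<sigma> xs" and "bs = map ?\<sigma> ys"
    have "\<Delta> ||- Eq (Tup [a, b]) (Tup [tup as, tup bs])"
      using p by (simp add: comp_def as_def bs_def)
    note ab = forces_pair_eqD[OF this]
    have q': "\<Delta> ||- Conj (map (ssubst ?\<sigma>) ?\<phi>s)" using q by (simp only: ssubst_Conj)
    have "\<forall>\<phi> \<in> set (map (ssubst ?\<sigma>) ?\<phi>s). elt \<Delta> Omega \<phi>"
      using forces_elt[OF q'] unfolding elt_Omega_iff wf_fm_Conj fv_Conj by blast
    then have all: "\<forall>\<phi> \<in> set (map (ssubst ?\<sigma>) ?\<phi>s). \<Delta> ||- \<phi>"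
      using q' forces_Conj_iff[OF later_stage[OF \<Delta>]] by blast
    have "related \<Delta> (graph (fs ! i)) (as ! i) (bs ! i)" if i: "i < length fs" for i
    proof -
      have "map (ssubst ?\<sigma>) ?\<phi>s ! i \<in> set (map (ssubst ?\<sigma>) ?\<phi>s)"
        using i lx by (intro nth_mem) simp
      with all have "\<Delta> ||- map (ssubst ?\<sigma>) ?\<phi>s ! i" by blast
      then show ?thesis
        using i lx graphs[OF i] by (simp add: as_def bs_def closed_graph_def ssubst_closed)
    qed
    then show "\<Delta> ||- \<chi>" using E[OF \<Delta>, of as bs] ab lx by (simp add: as_def bs_def)
  qed
qed

end


section \<open>Identities and inclusions\<close>

lemma s_id_maps_to:
  obtains x where "snd x = elem_ty X" "s_id X = maps_to [x] (Var x) X X"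
  by (rule that[of "(fresh (fv X), elem_ty X)"]) (simp_all add: s_id_def Let_def)

lemma incl_maps_to:
  obtains x where "snd x = elem_ty X" "incl X = maps_to [x] (Var x) X (Univ (elem_ty X))"
  by (rule that[of "(fresh (fv X), elem_ty X)"]) (simp_all add: incl_def Let_def)

lemma s_id_simps [simp]: "src (s_id X) = X" "tgt (s_id X) = X"
  by (simp_all add: s_id_def maps_to_def Let_def)

lemma incl_simps [simp]: "src (incl X) = X" "tgt (incl X) = Univ (elem_ty X)"
  by (simp_all add: incl_def maps_to_def Let_def)

lemma closed_graph_identity:
  assumes "wf_trm L X" "fv X = {}" "ty_of X = Pow (snd x)"
  shows "closed_graph (snd x) (snd x) (graph (maps_to [x] (Var x) X Y))"
proof -
  have "wf_var L x" using wf_ty_ty_of[OF local_language assms(1)] assms(3) by simp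
  then have "closed_set_of [x] (Tup [tup (map Var [x]), Var x]) (Mem (tup (map Var [x])) X)"
    by (intro closed_set_of_maps_to) (use assms in auto)
  from maps_to_closed_graph[OF this] show ?thesis by simp
qed

lemma
  assumes "wf_trm L X" "fv X = {}" "ty_of X = Pow A"
  shows sgraph_s_id: "sgraph (s_id X)"
    and sgraph_incl: "sgraph (incl X)"
    and related_s_id_iff: "related \<Gamma> (graph (s_id X)) a b \<longleftrightarrow> \<Gamma> ||- Eq a b \<and> \<Gamma> ||- Mem a X"
    and related_incl_iff: "related \<Gamma> (graph (incl X)) a b \<longleftrightarrow> \<Gamma> ||- Eq a b \<and> \<Gamma> ||- Mem a X"
proof -
  obtain x where x: "snd x = elem_ty X" "s_id X = maps_to [x] (Var x) X X" by (rule s_id_maps_to)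
  obtain y where y: "snd y = elem_ty X" "incl X = maps_to [y] (Var y) X (Univ (elem_ty X))"
    by (rule incl_maps_to)
  have ty: "ty_of X = Pow (snd x)" "ty_of X = Pow (snd y)" using assms(3) x y by simp_all
  show "sgraph (s_id X)"
    using closed_graph_identity[OF assms(1,2) ty(1), of X] unfolding x graph_maps_to(2,3) .
  show "sgraph (incl X)"
    using closed_graph_identity[OF assms(1,2) ty(2), of "Univ (elem_ty X)"]
    unfolding y graph_maps_to(2,3) Univ_closed(3) ty.sel .
  show "related \<Gamma> (graph (s_id X)) a b \<longleftrightarrow> \<Gamma> ||- Eq a b \<and> \<Gamma> ||- Mem a X"
    unfolding x(2) by (rule related_identity_iff[OF assms(1,2) ty(1)])
  show "related \<Gamma> (graph (incl X)) a b \<longleftrightarrow> \<Gamma> ||- Eq a b \<and> \<Gamma> ||- Mem a X"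
    unfolding y(2) by (rule related_identity_iff[OF assms(1,2) ty(2)])
qed

section \<open>Preimage translation\<close>

context
  fixes xs :: "'g var list" and q p :: "'g var" and h :: "('g, 'f) sfun" and \<theta> :: "('g, 'f) trm"
  assumes h: "sgraph h" and srch: "elem_ty (src h) = snd p" and tgth: "tgt h = Univ (snd q)"
    and wf\<theta>: "wf_fm L \<theta>" and vl: "var_list L xs q \<theta>"
begin

definition "ids = map (\<lambda>y. s_id (Univ (snd y)) :: ('g, 'f) sfun) xs"
definition "id_h = s_prod (ids @ [h])"
definition "id_incl = s_prod (ids @ [incl (tgt h)])"
definition "char_map = maps_to (xs @ [q]) \<theta> (Univ (prod_ty (map snd (xs @ [q])))) (Univ Omega)"

lemma preimage_eq:
  "preimage xs q p h \<theta> =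
    Mem (Tup [tup (map Var (xs @ [p])), Tru]) (graph (s_comp (s_comp char_map id_incl) id_h))"
  by (simp add: preimage_def Let_def natural_def ids_def id_h_def id_incl_def char_map_def)

lemma wf_xs_q: "\<forall>y \<in> set (xs @ [q]). wf_var L y" and dist: "distinct (xs @ [q])"
  and fv\<theta>: "fv \<theta> \<subseteq> set (xs @ [q])" and wf_trm_\<theta>: "wf_trm L \<theta>"
  using vl wf\<theta> by (auto simp: var_list_def wf_fm_def)

lemma Univ_xs_q:
  assumes "y \<in> set (xs @ [q])"
  shows "wf_trm L (Univ (snd y))" "fv (Univ (snd y)) = {}" "ty_of (Univ (snd y)) = Pow (snd y)"
  using Univ_closed wf_xs_q assms by blast+

lemma sgraphs_id_h: "\<forall>f \<in> set (ids @ [h]). sgraph f"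
  using sgraph_s_id[OF Univ_xs_q] h by (auto simp: ids_def)

lemma sgraphs_id_incl: "\<forall>f \<in> set (ids @ [incl (tgt h)]). sgraph f"
  using sgraph_s_id[OF Univ_xs_q] sgraph_incl[OF Univ_xs_q[of q]] by (auto simp: ids_def tgth)

lemma prod_ty_wf: "wf_ty L (prod_ty (map snd (xs @ [q])))"
proof -
  have "wf_trm L (tup (map Var (xs @ [q])))"
    using wf_xs_q by (intro wf_trm_tup) auto
  from wf_ty_ty_of[OF local_language this] show ?thesis by (simp add: comp_def)
qed

lemma closed_char_map:
  "closed_set_of (xs @ [q]) (Tup [tup (map Var (xs @ [q])), \<theta>])
    (Mem (tup (map Var (xs @ [q]))) (Univ (prod_ty (map snd (xs @ [q])))))"
  using wf_xs_q wf\<theta> fv\<theta> prod_ty_wf Univ_closed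
  by (intro closed_set_of_maps_to) (simp_all add: wf_fm_def)

lemma elem_ty_maps:
  "elem_ty (src char_map) = prod_ty (map snd (xs @ [q]))"
  "elem_ty (tgt id_incl) = prod_ty (map snd (xs @ [q]))"
  "elem_ty (src id_incl) = prod_ty (map snd (xs @ [q]))"
  "elem_ty (tgt id_h) = prod_ty (map snd (xs @ [q]))"
  "elem_ty (src id_h) = prod_ty (map snd (xs @ [p]))"
  by (simp_all add: s_prod_simps char_map_def id_h_def id_incl_def graph_maps_to Univ_closed ty_of_Prod_set
      ids_def tgth srch comp_def)

lemma sgraph_maps: "sgraph id_h" "sgraph id_incl" "sgraph char_map"
  using s_prod_sgraph[OF sgraphs_id_h] s_prod_sgraph[OF sgraphs_id_incl]
    maps_to_closed_graph[OF closed_char_map, of "Univ Omega"] wf\<theta> elem_ty_maps(1)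
  by (simp_all add: id_h_def id_incl_def char_map_def graph_maps_to Univ_closed wf_fm_def)

lemma sgraph_inner: "sgraph (s_comp char_map id_incl)"
  using sgraph_maps elem_ty_maps by (intro s_comp_sgraph) simp_all

lemma sgraph_total: "sgraph (s_comp (s_comp char_map id_incl) id_h)"
  using sgraph_maps sgraph_inner elem_ty_maps by (intro s_comp_sgraph) simp_all

text \<open>The tuple is built from the whole list, so even a listed variable that is not free in
  \<open>\<theta>\<close> becomes free in the translation. This governs which variables a stage has
  to declare.\<close>

lemma fv_preimage: "fv (preimage xs q p h \<theta>) = insert p (set xs)"
  using sgraph_total by (auto simp: preimage_eq closed_graph_def)

lemma wf_preimage: "wf_fm L (preimage xs q p h \<theta>)"
proof -
  have "wf_var L p" using wf_ty_closed_graph[OF h] srch by simp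
  then have "wf_trm L (tup (map Var (xs @ [p])))"
    using wf_xs_q by (intro wf_trm_tup) auto
  moreover have "wf_trm L Tru" "ty_of (Tru :: ('g, 'f) trm) = Omega"
    by (simp_all add: Tru_def)
  ultimately show ?thesis
    using sgraph_total elem_ty_maps(5) by (simp add: preimage_eq closed_graph_def comp_def char_map_def graph_maps_to Univ_closed)
qed

lemma ssubst_preimage:
  "ssubst \<sigma> (preimage xs q p h \<theta>) =
    Mem (Tup [tup (map \<sigma> (xs @ [p])), Tru]) (graph (s_comp (s_comp char_map id_incl) id_h))"
  using sgraph_total by (simp add: preimage_eq closed_graph_def ssubst_closed comp_def)

lemma length_ids [simp]: "length ids = length xs"
  by (simp add: ids_def)

lemma nth_id_h: "i < length xs \<Longrightarrow> (ids @ [h]) ! i = s_id (Univ (snd (xs ! i)))" "(ids @ [h]) ! length xs = h"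
  "length (ids @ [h]) = Suc (length xs)"
  by (simp_all add: ids_def nth_append)

lemma nth_id_incl: "i < length xs \<Longrightarrow> (ids @ [incl (tgt h)]) ! i = s_id (Univ (snd (xs ! i)))"
  "(ids @ [incl (tgt h)]) ! length xs = incl (Univ (snd q))"
  "length (ids @ [incl (tgt h)]) = Suc (length xs)"
  by (simp_all add: ids_def nth_append tgth)

lemma related_id_iff:
  assumes "y \<in> set (xs @ [q])"
  shows "related \<Gamma> (graph (s_id (Univ (snd y)))) a b \<longleftrightarrow> \<Gamma> ||- Eq a b \<and> elt \<Gamma> (snd y) a"
    and "related \<Gamma> (graph (incl (Univ (snd y)))) a b \<longleftrightarrow> \<Gamma> ||- Eq a b \<and> elt \<Gamma> (snd y) a"
proof -
  have "elt \<Gamma> (snd y) a" if "\<Gamma> ||- Mem a (Univ (snd y))"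
    using forces_elt[OF that] by (simp add: elt_def Univ_closed)
  moreover have "\<Gamma> ||- Mem a (Univ (snd y))" if "\<Gamma> ||- Eq a b" "elt \<Gamma> (snd y) a"
    using forces_stage[OF that(1)] that(2) by (rule Mem_Univ)
  ultimately show "related \<Gamma> (graph (s_id (Univ (snd y)))) a b \<longleftrightarrow> \<Gamma> ||- Eq a b \<and> elt \<Gamma> (snd y) a"
    "related \<Gamma> (graph (incl (Univ (snd y)))) a b \<longleftrightarrow> \<Gamma> ||- Eq a b \<and> elt \<Gamma> (snd y) a"
    using related_s_id_iff[OF Univ_xs_q[OF assms]] related_incl_iff[OF Univ_xs_q[OF assms]] by blast+
qed

text \<open>An explicit path through the three graphs: the identities keep the first components,
  \<open>h\<close> sends the last one to \<open>v\<close>, the inclusion keeps \<open>v\<close>, and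
  the characteristic map sends the resulting tuple to the truth value of \<open>\<theta>\<close>,
  which is \<open>Tru\<close>.\<close>

lemma forces_preimageI:
  assumes "env \<Gamma> \<sigma> (insert p (set xs))" and rel: "related \<Gamma> (graph h) (\<sigma> p) v"
    and f: "\<Gamma> ||- ssubst (\<sigma>(q := v)) \<theta>"
  shows "\<Gamma> ||- ssubst \<sigma> (preimage xs q p h \<theta>)"
proof -
  note st = forces_stage[OF rel]
  define as bs where "as = map \<sigma> (xs @ [p])" and "bs = map \<sigma> xs @ [v]"
  have len: "length as = Suc (length xs)" "length bs = Suc (length xs)" by (simp_all add: as_def bs_def)
  have v: "elt \<Gamma> (snd q) v" using related_elt(2)[OF rel h] by (simp add: tgth Univ_closed)
  have nth: "as ! i = \<sigma> (xs ! i)" "bs ! i = \<sigma> (xs ! i)" "elt \<Gamma> (snd (xs ! i)) (\<sigma> (xs ! i))"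
    if "i < length xs" for i
    using that assms(1) by (simp_all add: as_def bs_def nth_append env_def)
  have last: "as ! length xs = \<sigma> p" "bs ! length xs = v" by (simp_all add: as_def bs_def nth_append)
  have els: "elts \<Gamma> (xs @ [q]) bs"
    unfolding bs_def using assms(1) v
    by (intro list_all2_appendI) (simp_all add: list_all2_map2 list_all2_same env_def)
  have ela: "list_all2 (elt \<Gamma>) (map snd (xs @ [p])) as"
    unfolding as_def list_all2_map1 list_all2_map2 list_all2_same using assms(1) by (auto simp: env_def)
  have elb: "list_all2 (elt \<Gamma>) (map snd (xs @ [q])) bs"
    using els by (simp only: list_all2_map1)
  note ta = elt_tup[OF st ela] and tb = elt_tup[OF st elb]
  have "related \<Gamma> (graph id_h) (tup as) (tup bs)"
    unfolding id_h_def
  proof (rule related_s_prodI[OF sgraphs_id_h])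
    fix i assume "i < length (ids @ [h])"
    then consider "i < length xs" | "i = length xs" by (auto simp: less_Suc_eq)
    then show "related \<Gamma> (graph ((ids @ [h]) ! i)) (as ! i) (bs ! i)"
    proof cases
      case 1
      then show ?thesis
        using nth[OF 1] forces_refl[OF st nth(3)[OF 1]] related_id_iff(1)[of "xs ! i"]
        by (simp only: nth_id_h) simp
    next
      case 2
      then show ?thesis using rel last by (simp only: nth_id_h)
    qed
  qed (use len nth_id_h forces_refl[OF st ta] forces_refl[OF st tb] in simp_all)
  moreover have "related \<Gamma> (graph id_incl) (tup bs) (tup bs)"
    unfolding id_incl_def
  proof (rule related_s_prodI[OF sgraphs_id_incl])
    fix i assume "i < length (ids @ [incl (tgt h)])"
    then consider "i < length xs" | "i = length xs" by (auto simp: less_Suc_eq)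
    then show "related \<Gamma> (graph ((ids @ [incl (tgt h)]) ! i)) (bs ! i) (bs ! i)"
    proof cases
      case 1
      then show ?thesis
        using nth[OF 1] forces_refl[OF st nth(3)[OF 1]] related_id_iff(1)[of "xs ! i"]
        by (simp only: nth_id_incl) simp
    next
      case 2
      then show ?thesis
        using last v forces_refl[OF st v] related_id_iff(2)[of q] by (simp only: nth_id_incl) simp
    qed
  qed (use len nth_id_incl forces_refl[OF st tb] in simp_all)
  moreover have "related \<Gamma> (graph char_map) (tup bs) Tru"
    unfolding char_map_def
  proof (rule related_maps_toI[OF closed_char_map dist _ els])
    show "\<Gamma> ||- Mem (tup bs) (Univ (prod_ty (map snd (xs @ [q]))))"
      using Mem_Univ[OF st tb] .
    \<comment> \<open>The environment read off from the tuple agrees with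
      \<open>\<sigma>(q := v)\<close> on the list, since \<open>q\<close> does not occur in
      \<open>xs\<close>; this suffices because the list contains all free variables of
      \<open>\<theta>\<close>.\<close>
    have "map (upds Var (xs @ [q]) bs) (xs @ [q]) = map (\<sigma>(q := v)) (xs @ [q])"
      using dist len by (subst map_upds) (auto simp: bs_def)
    then have "\<forall>y \<in> set (xs @ [q]). upds Var (xs @ [q]) bs y = (\<sigma>(q := v)) y"
      by (simp only: map_eq_conv)
    then have "ssubst (upds Var (xs @ [q]) bs) \<theta> = ssubst (\<sigma>(q := v)) \<theta>"
      using fv\<theta> by (intro ssubst_cong) blast
    then show "\<Gamma> ||- Eq Tru (ssubst (upds Var (xs @ [q]) bs) \<theta>)"
      using f forces_eq_Tru_iff[OF st forces_elt[OF f]] forces_sym by metis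
  qed (use forces_refl[OF st tb] Univ_closed in simp_all)
  ultimately have "related \<Gamma> (graph (s_comp (s_comp char_map id_incl) id_h)) (tup as) Tru"
    using sgraph_maps sgraph_inner elem_ty_maps by (intro related_s_compI) simp_all
  then show ?thesis unfolding ssubst_preimage as_def .
qed

text \<open>Each graph is opened with its own list of components, so the lists met along the path
  agree only up to provable equality. Replacement of equals in \<open>\<theta>\<close> finally leads
  from the last list to \<open>\<sigma>(q := v)\<close>, where \<open>v\<close> is the value found
  for \<open>h\<close>.\<close>

lemma forces_preimageE:
  assumes pre: "\<Gamma> ||- ssubst \<sigma> (preimage xs q p h \<theta>)" and env: "env \<Gamma> \<sigma> (insert p (set xs))"
    and \<chi>: "elt \<Gamma> Omega \<chi>"
    and E: "\<And>\<Delta> v. \<Gamma> \<preceq> \<Delta> \<Longrightarrow> related \<Delta> (graph h) (\<sigma> p) v \<Longrightarrow> \<Delta> ||- ssubst (\<sigma>(q := v)) \<theta> \<Longrightarrow> \<Delta> ||- \<chi>"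
  shows "\<Gamma> ||- \<chi>"
proof (rule related_s_compE[OF sgraph_maps(1) sgraph_inner _ pre[unfolded ssubst_preimage] \<chi>])
  let ?a = "map \<sigma> (xs @ [p])"
  fix \<Gamma>\<^sub>1 b
  assume l1: "\<Gamma> \<preceq> \<Gamma>\<^sub>1" and b: "related \<Gamma>\<^sub>1 (graph id_h) (tup ?a) b"
    and b': "related \<Gamma>\<^sub>1 (graph (s_comp char_map id_incl)) b Tru"
  show "\<Gamma>\<^sub>1 ||- \<chi>"
  proof (rule related_s_compE[OF sgraph_maps(2,3) _ b' elt_mono[OF \<chi> l1]])
    fix \<Gamma>\<^sub>2 c
    assume "\<Gamma>\<^sub>1 \<preceq> \<Gamma>\<^sub>2" and c: "related \<Gamma>\<^sub>2 (graph id_incl) b c" and c': "related \<Gamma>\<^sub>2 (graph char_map) c Tru"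
    then have l2: "\<Gamma> \<preceq> \<Gamma>\<^sub>2" and b2: "related \<Gamma>\<^sub>2 (graph id_h) (tup ?a) b"
      using later_trans[OF l1] forces_mono[OF b] by blast+
    show "\<Gamma>\<^sub>2 ||- \<chi>"
    proof (rule related_s_prodE[OF sgraphs_id_h b2[unfolded id_h_def] elt_mono[OF \<chi> l2]])
      fix \<Gamma>\<^sub>3 as bs
      assume l23: "\<Gamma>\<^sub>2 \<preceq> \<Gamma>\<^sub>3" and len1: "length as = length (ids @ [h])" "length bs = length (ids @ [h])"
        and r1: "\<And>i. i < length (ids @ [h]) \<Longrightarrow> related \<Gamma>\<^sub>3 (graph ((ids @ [h]) ! i)) (as ! i) (bs ! i)"
        and e1: "\<Gamma>\<^sub>3 ||- Eq (tup ?a) (tup as)" "\<Gamma>\<^sub>3 ||- Eq b (tup bs)"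
      note l3 = later_trans[OF l2 l23]
      show "\<Gamma>\<^sub>3 ||- \<chi>"
      proof (rule related_s_prodE[OF sgraphs_id_incl forces_mono[OF c l23, unfolded id_incl_def] elt_mono[OF \<chi> l3]])
        fix \<Gamma>\<^sub>4 bs' cs
        assume l34: "\<Gamma>\<^sub>3 \<preceq> \<Gamma>\<^sub>4"
          and len2: "length bs' = length (ids @ [incl (tgt h)])" "length cs = length (ids @ [incl (tgt h)])"
          and r2: "\<And>i. i < length (ids @ [incl (tgt h)]) \<Longrightarrow>
            related \<Gamma>\<^sub>4 (graph ((ids @ [incl (tgt h)]) ! i)) (bs' ! i) (cs ! i)"
          and e2: "\<Gamma>\<^sub>4 ||- Eq b (tup bs')" "\<Gamma>\<^sub>4 ||- Eq c (tup cs)"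
        note l4 = later_trans[OF l3 l34] and l24 = later_trans[OF l23 l34]
        have fU: "fv (Univ (prod_ty (map snd (xs @ [q])))) = {}" by (rule Univ_closed)
        show "\<Gamma>\<^sub>4 ||- \<chi>"
        proof (rule related_maps_toE[OF closed_char_map dist fU forces_mono[OF c' l24, unfolded char_map_def]
              elt_mono[OF \<chi> l4]])
          fix \<Delta> ts
          assume l45: "\<Gamma>\<^sub>4 \<preceq> \<Delta>" and ts: "elts \<Delta> (xs @ [q]) ts" and e3: "\<Delta> ||- Eq c (tup ts)"
            "\<Delta> ||- Eq Tru (ssubst (upds Var (xs @ [q]) ts) \<theta>)"
          note l5 = later_trans[OF l4 l45] and l35 = later_trans[OF l34 l45]
          note st = later_stage[OF l5]
          let ?n = "length xs"
          have len: "length as = Suc ?n" "length bs = Suc ?n" "length bs' = Suc ?n" "length cs = Suc ?n"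
            "length ts = Suc ?n" "length ?a = Suc ?n"
            using len1 len2 nth_id_h(3) nth_id_incl(3) list_all2_lengthD[OF ts] by simp_all
          have a_as: "\<Delta> ||- Eq (?a ! i) (as ! i)" if "i < Suc ?n" for i
            using that len by (intro forces_tup_eqD forces_mono[OF e1(1) l35]) simp_all
          have bs_bs': "\<Delta> ||- Eq (bs ! i) (bs' ! i)" if "i < Suc ?n" for i
            using that len forces_trans[OF forces_sym[OF forces_mono[OF e1(2) l35]] forces_mono[OF e2(1) l45]]
            by (intro forces_tup_eqD) simp_all
          have cs_ts: "\<Delta> ||- Eq (cs ! i) (ts ! i)" if "i < Suc ?n" for i
            using that len forces_trans[OF forces_sym[OF forces_mono[OF e2(2) l45]] e3(1)]
            by (intro forces_tup_eqD) simp_all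
          have bs'_cs: "\<Delta> ||- Eq (bs' ! i) (cs ! i)" if "i < Suc ?n" for i
          proof -
            have r: "related \<Delta> (graph ((ids @ [incl (tgt h)]) ! i)) (bs' ! i) (cs ! i)"
              using that nth_id_incl(3) by (intro forces_mono[OF r2 l45]) simp
            from that consider "i < ?n" | "i = ?n" by linarith
            then show ?thesis
            proof cases
              case 1
              with r related_id_iff(1)[of "xs ! i"] show ?thesis by (simp only: nth_id_incl) simp
            next
              case 2
              with r related_id_iff(2)[of q] show ?thesis by (simp only: nth_id_incl) simp
            qed
          qed
          have as_bs: "\<Delta> ||- Eq (as ! i) (bs ! i)" if "i < ?n" for i
          proof -
            have "related \<Delta> (graph ((ids @ [h]) ! i)) (as ! i) (bs ! i)"
              using that nth_id_h(3) by (intro forces_mono[OF r1 l35]) simp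
            with that related_id_iff(1)[of "xs ! i"] show ?thesis by (simp only: nth_id_h) simp
          qed
          define v where "v = bs ! ?n"
          have "related \<Delta> (graph ((ids @ [h]) ! ?n)) (as ! ?n) (bs ! ?n)"
            using nth_id_h(3) by (intro forces_mono[OF r1 l35]) simp
          then have rh: "related \<Delta> (graph h) (as ! ?n) v" by (simp only: nth_id_h v_def)
          have v: "\<Delta> ||- Eq v v"
            using forces_refl[OF st related_elt(2)[OF rh h]] .
          have "\<Delta> ||- Eq (as ! ?n) (\<sigma> p)"
            using forces_sym[OF a_as[of ?n]] by (simp add: nth_append)
          from related_cong[OF rh this v] have rel: "related \<Delta> (graph h) (\<sigma> p) v" .
          have bs_ts: "\<Delta> ||- Eq (bs ! i) (ts ! i)" if "i < Suc ?n" for i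
            using forces_trans[OF bs_bs'[OF that] forces_trans[OF bs'_cs[OF that] cs_ts[OF that]]] .
          \<comment> \<open>Only the last position is special: there \<open>h\<close> acts instead
            of an identity, and \<open>v\<close> is by definition the component it produces.
            Elsewhere the chain of equations runs back to \<open>\<sigma>\<close>.\<close>
          have nth_eq: "\<Delta> ||- Eq (ts ! i) ((\<sigma>(q := v)) ((xs @ [q]) ! i))" if i: "i < Suc ?n" for i
          proof (cases "i < ?n")
            case True
            have "\<Delta> ||- Eq (\<sigma> (xs ! i)) (as ! i)" using a_as[OF i] True by (simp add: nth_append)
            from forces_trans[OF this forces_trans[OF as_bs[OF True] bs_ts[OF i]]]
            have "\<Delta> ||- Eq (ts ! i) (\<sigma> (xs ! i))" by (rule forces_sym)
            moreover have "xs ! i \<noteq> q" using True dist by (metis distinct_append nth_mem disjoint_iff list.set_intros(1))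
            ultimately show ?thesis using True by (simp add: nth_append)
          next
            case False
            with i have "i = ?n" by simp
            with forces_sym[OF bs_ts[OF i]] show ?thesis by (simp add: v_def)
          qed
          have "\<Delta> ||- ssubst (upds Var (xs @ [q]) ts) \<theta>"
            using forces_eqD[OF e3(2) forces_Tru[OF st]] .
          moreover have "\<Delta> ||- Eq (ssubst (upds Var (xs @ [q]) ts) \<theta>) (ssubst (\<sigma>(q := v)) \<theta>)"
          proof (rule forces_ssubst_cong[OF wf_trm_\<theta> st], intro ballI)
            fix y assume "y \<in> fv \<theta>"
            with fv\<theta> obtain i where i: "i < Suc ?n" "y = (xs @ [q]) ! i"
              by (metis in_set_conv_nth length_append_singleton subsetD)
            have "upds Var (xs @ [q]) ts y = ts ! i"
              unfolding i(2) using dist len i(1) by (intro upds_nth) simp_all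
            moreover have "elt \<Delta> (snd y) (ts ! i)"
              using list_all2_nthD[OF ts, of i] i by simp
            ultimately show "\<Delta> ||- Eq (upds Var (xs @ [q]) ts y) ((\<sigma>(q := v)) y) \<and>
                ty_of (upds Var (xs @ [q]) ts y) = snd y"
              using nth_eq[OF i(1)] i(2) by (simp add: elt_def)
          qed
          ultimately have "\<Delta> ||- ssubst (\<sigma>(q := v)) \<theta>" using forces_eqD by blast
          with E[OF l5 rel] show "\<Delta> ||- \<chi>" .
        qed
      qed
    qed
  qed (simp add: elem_ty_maps)
qed (simp add: elem_ty_maps)

text \<open>With a value \<open>v\<close> given at the stage the local witness disappears: any later
  value equals \<open>v\<close>, so truth of \<open>\<theta>\<close> at it transfers to
  \<open>v\<close>, and the right side is itself a formula that may serve as goal.\<close>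

lemma forces_preimage_iff:
  assumes env: "env \<Gamma> \<sigma> (insert p (set xs))" and rel: "related \<Gamma> (graph h) (\<sigma> p) v"
    and unique: "\<And>\<Delta> w. \<Gamma> \<preceq> \<Delta> \<Longrightarrow> related \<Delta> (graph h) (\<sigma> p) w \<Longrightarrow> \<Delta> ||- Eq w v"
  shows "\<Gamma> ||- ssubst \<sigma> (preimage xs q p h \<theta>) \<longleftrightarrow> \<Gamma> ||- ssubst (\<sigma>(q := v)) \<theta>"
proof
  have v: "elt \<Gamma> (snd q) v" using related_elt(2)[OF rel h] by (simp add: tgth Univ_closed)
  have env\<theta>: "env \<Gamma> (\<sigma>(q := v)) (fv \<theta>)"
    using env v fv\<theta> by (auto simp: env_def)
  show "\<Gamma> ||- ssubst (\<sigma>(q := v)) \<theta>" if pre: "\<Gamma> ||- ssubst \<sigma> (preimage xs q p h \<theta>)"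
  proof (rule forces_preimageE[OF pre env elt_ssubst_fm[OF wf\<theta> env\<theta>]])
    fix \<Delta> w assume \<Delta>: "\<Gamma> \<preceq> \<Delta>" and w: "related \<Delta> (graph h) (\<sigma> p) w"
      and f: "\<Delta> ||- ssubst (\<sigma>(q := w)) \<theta>"
    have "\<Delta> ||- Eq (ssubst (\<sigma>(q := w)) \<theta>) (ssubst (\<sigma>(q := v)) \<theta>)"
    proof (rule forces_ssubst_cong[OF wf_trm_\<theta> later_stage[OF \<Delta>]], intro ballI)
      fix y assume y: "y \<in> fv \<theta>"
      show "\<Delta> ||- Eq ((\<sigma>(q := w)) y) ((\<sigma>(q := v)) y) \<and> ty_of ((\<sigma>(q := w)) y) = snd y"
      proof (cases "y = q")
        case True
        then show ?thesis
          using unique[OF \<Delta> w] related_elt(2)[OF w h] by (simp add: tgth Univ_closed elt_def)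
      next
        case False
        with y fv\<theta> have "elt \<Gamma> (snd y) (\<sigma> y)" using env by (auto simp: env_def)
        with False forces_refl[OF later_stage[OF \<Delta>] elt_mono[OF _ \<Delta>]] show ?thesis
          by (simp add: elt_def)
      qed
    qed
    with f show "\<Delta> ||- ssubst (\<sigma>(q := v)) \<theta>" using forces_eqD by blast
  qed
  show "\<Gamma> ||- ssubst \<sigma> (preimage xs q p h \<theta>)" if "\<Gamma> ||- ssubst (\<sigma>(q := v)) \<theta>"
    using env rel that by (rule forces_preimageI)
qed

end


section \<open>Functions, and connectives determined by later stages\<close>

lemma ty_of_Fun_set: "ty_of (Fun_set X Y) = Pow (Pow (Prod [elem_ty X, elem_ty Y]))"
  by (simp add: Fun_set_def Let_def)

text \<open>The membership formula is derivable, hence well formed, and this fixes the type of the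
  graph.\<close>

lemma s_function_sgraph:
  assumes "s_function L S f"
  shows "sgraph f"
proof -
  have "derives L S {} (Mem (graph f) (Fun_set (src f) (tgt f)))" "s_set L (graph f)"
    using assms by (simp_all add: s_function_def)
  with derives_wf(2)[OF this(1)] show ?thesis
    by (simp add: closed_graph_def s_set_def ty_of_Fun_set)
qed

text \<open>Either membership supplies a stage and a well-formed element; as closed terms have no
  variables to declare, the theorem holds at that stage.\<close>

lemma forces_Mem_theorem_cong:
  assumes eq: "derives L S {} (Eq X Y)" and closed: "fv X = {}" "fv Y = {}"
  shows "\<Gamma> ||- Mem a X \<longleftrightarrow> \<Gamma> ||- Mem a Y"
proof -
  have "\<Gamma> ||- Eq X Y" "\<Gamma> ||- Eq a a" if "\<Gamma> ||- Mem a Z" for Z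
  proof -
    note st = forces_stage[OF that]
    have "elt \<Gamma> (ty_of a) a" using forces_elt[OF that] by (simp add: elt_def)
    then show "\<Gamma> ||- Eq a a" using forces_refl[OF st] by blast
    show "\<Gamma> ||- Eq X Y" using closed by (intro forces_theorem[OF eq st]) simp
  qed
  then show ?thesis using forces_Mem_cong forces_sym by blast
qed

lemma env_Var: "\<forall>v \<in> W. wf_var L v \<Longrightarrow> W \<subseteq> fvs \<Gamma> \<Longrightarrow> env \<Gamma> Var W"
  by (auto simp: env_def elt_def)

text \<open>Two environments and two pairs of formulae are compared because \<open>\<theta>\<close>
  will be read at \<open>u := v\<close> and its translation at \<open>x\<close>. The compound is
  substituted as a whole since \<open>Or\<close> does not commute literally with
  substitution.\<close>

definition truth_functional :: "(('g, 'f) trm \<Rightarrow> ('g, 'f) trm \<Rightarrow> ('g, 'f) trm) \<Rightarrow> bool" where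
  "truth_functional c \<longleftrightarrow> (\<forall>\<phi> \<psi>. wf_fm L \<phi> \<longrightarrow> wf_fm L \<psi> \<longrightarrow> wf_fm L (c \<phi> \<psi>)) \<and>
    (\<forall>\<phi> \<psi>. fv (c \<phi> \<psi>) = fv \<phi> \<union> fv \<psi>) \<and>
    (\<forall>\<Gamma> \<sigma> \<rho> \<phi> \<psi> \<phi>' \<psi>'. stage \<Gamma> \<longrightarrow> wf_fm L \<phi> \<longrightarrow> wf_fm L \<psi> \<longrightarrow> wf_fm L \<phi>' \<longrightarrow> wf_fm L \<psi>' \<longrightarrow>
      env \<Gamma> \<sigma> (fv \<phi> \<union> fv \<psi>) \<longrightarrow> env \<Gamma> \<rho> (fv \<phi>' \<union> fv \<psi>') \<longrightarrow>
      (\<forall>\<Delta>. \<Gamma> \<preceq> \<Delta> \<longrightarrow> (\<Delta> ||- ssubst \<sigma> \<phi> \<longleftrightarrow> \<Delta> ||- ssubst \<rho> \<phi>')) \<longrightarrow>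
      (\<forall>\<Delta>. \<Gamma> \<preceq> \<Delta> \<longrightarrow> (\<Delta> ||- ssubst \<sigma> \<psi> \<longleftrightarrow> \<Delta> ||- ssubst \<rho> \<psi>')) \<longrightarrow>
      (\<Gamma> ||- ssubst \<sigma> (c \<phi> \<psi>) \<longleftrightarrow> \<Gamma> ||- ssubst \<rho> (c \<phi>' \<psi>')))"

lemma elt_ssubst_Un:
  assumes "env \<Gamma> \<sigma> (fv \<phi> \<union> fv \<psi>)" "wf_fm L \<phi>" "wf_fm L \<psi>"
  shows "elt \<Gamma> Omega (ssubst \<sigma> \<phi>)" "elt \<Gamma> Omega (ssubst \<sigma> \<psi>)"
  using assms by (auto intro!: elt_ssubst_fm elim: env_subset)

lemma truth_functional_And: "truth_functional And"
  unfolding truth_functional_def by (simp add: forces_And_iff elt_ssubst_Un)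

lemma truth_functional_Imp: "truth_functional Imp"
  unfolding truth_functional_def by (simp add: forces_Imp_iff elt_ssubst_Un)

lemma truth_functional_Iff: "truth_functional Iff"
  unfolding truth_functional_def
  by (simp add: wf_fm_Iff) (simp add: Iff_def forces_eq_Omega_iff elt_ssubst_Un)

lemma truth_functional_Or: "truth_functional Or"
proof -
  have "\<Gamma> ||- ssubst \<sigma> (Or \<phi> \<psi>) \<longleftrightarrow> \<Gamma> ||- ssubst \<rho> (Or \<phi>' \<psi>')"
    if "stage \<Gamma>" "wf_fm L \<phi>" "wf_fm L \<psi>" "wf_fm L \<phi>'" "wf_fm L \<psi>'"
      "env \<Gamma> \<sigma> (fv \<phi> \<union> fv \<psi>)" "env \<Gamma> \<rho> (fv \<phi>' \<union> fv \<psi>')"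
      and *: "\<forall>\<Delta>. \<Gamma> \<preceq> \<Delta> \<longrightarrow> (\<Delta> ||- ssubst \<sigma> \<phi> \<longleftrightarrow> \<Delta> ||- ssubst \<rho> \<phi>')"
      "\<forall>\<Delta>. \<Gamma> \<preceq> \<Delta> \<longrightarrow> (\<Delta> ||- ssubst \<sigma> \<psi> \<longleftrightarrow> \<Delta> ||- ssubst \<rho> \<psi>')" for \<Gamma> \<sigma> \<rho> \<phi> \<psi> \<phi>' \<psi>'
    unfolding forces_ssubst_Or_iff[OF that(1,2,3,6)] forces_ssubst_Or_iff[OF that(1,4,5,7)]
    using * later_trans by (intro all_cong1 imp_cong refl) blast
  then show ?thesis unfolding truth_functional_def by (simp only: wf_fm_logic fv_Or simp_thms) blast
qed

text \<open>The elimination rule of disjunction, asked of \<open>c\<close>. It singles out the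
  connectives whose truth makes one of the parts true locally; if the parts are translations, such a
  part yields a value of the map. An implication or an equivalence may hold between false
  parts.\<close>

definition entails_Or :: "(('g, 'f) trm \<Rightarrow> ('g, 'f) trm \<Rightarrow> ('g, 'f) trm) \<Rightarrow> bool" where
  "entails_Or c \<longleftrightarrow> (\<forall>\<Gamma> \<phi> \<psi> \<chi>. \<Gamma> ||- c \<phi> \<psi> \<longrightarrow> elt \<Gamma> Omega \<phi> \<longrightarrow> elt \<Gamma> Omega \<psi> \<longrightarrow> elt \<Gamma> Omega \<chi> \<longrightarrow>
    (\<forall>\<Delta>. \<Gamma> \<preceq> \<Delta> \<longrightarrow> \<Delta> ||- \<phi> \<or> \<Delta> ||- \<psi> \<longrightarrow> \<Delta> ||- \<chi>) \<longrightarrow> \<Gamma> ||- \<chi>)"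

lemma entails_OrD:
  "entails_Or c \<Longrightarrow> \<Gamma> ||- c \<phi> \<psi> \<Longrightarrow> elt \<Gamma> Omega \<phi> \<Longrightarrow> elt \<Gamma> Omega \<psi> \<Longrightarrow> elt \<Gamma> Omega \<chi> \<Longrightarrow>
    (\<And>\<Delta>. \<Gamma> \<preceq> \<Delta> \<Longrightarrow> \<Delta> ||- \<phi> \<or> \<Delta> ||- \<psi> \<Longrightarrow> \<Delta> ||- \<chi>) \<Longrightarrow> \<Gamma> ||- \<chi>"
  unfolding entails_Or_def by blast

lemma entails_Or_And: "entails_Or And"
  unfolding entails_Or_def
proof (intro allI impI)
  fix \<Gamma> \<phi> \<psi> \<chi>
  assume f: "\<Gamma> ||- And \<phi> \<psi>" "elt \<Gamma> Omega \<phi>" "elt \<Gamma> Omega \<psi>"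
    and E: "\<forall>\<Delta>. \<Gamma> \<preceq> \<Delta> \<longrightarrow> \<Delta> ||- \<phi> \<or> \<Delta> ||- \<psi> \<longrightarrow> \<Delta> ||- \<chi>"
  show "\<Gamma> ||- \<chi>"
    using E f forces_stage[OF f(1)] by (simp add: forces_And_iff)
qed

lemma entails_Or_Or: "entails_Or Or"
  unfolding entails_Or_def
proof (intro allI impI)
  fix \<Gamma> \<phi> \<psi> \<chi>
  assume f: "\<Gamma> ||- Or \<phi> \<psi>" and el: "elt \<Gamma> Omega \<phi>" "elt \<Gamma> Omega \<psi>" "elt \<Gamma> Omega \<chi>"
    and E: "\<forall>\<Delta>. \<Gamma> \<preceq> \<Delta> \<longrightarrow> \<Delta> ||- \<phi> \<or> \<Delta> ||- \<psi> \<longrightarrow> \<Delta> ||- \<chi>"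
  note st = forces_stage[OF f]
  have wf: "wf_fm L \<phi>" "wf_fm L \<psi>" using el by (simp_all add: elt_Omega_iff)
  have "env \<Gamma> Var (fv \<phi> \<union> fv \<psi>)"
    using el wf_var_fv[of L \<phi>] wf_var_fv[of L \<psi>] by (intro env_Var) (auto simp: elt_def)
  from forces_ssubst_Or_iff[OF st wf this] show "\<Gamma> ||- \<chi>"
    using f el(3) E st by simp
qed

section \<open>Mutually inverse functions\<close>

context
  fixes f g :: "('g, 'f) sfun" and u x :: "'g var" and X :: "('g, 'f) trm"
  assumes inverse: "s_inverse L S f g"
    and srcf: "src f = Univ (snd u)" and tgtf: "tgt f = X"
    and X: "wf_trm L X" "fv X = {}" "ty_of X = Pow (snd x)" and wu: "wf_var L u"
begin

lemma src_tgt_inverse: "src g = X" "tgt g = Univ (snd u)"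
  using inverse srcf tgtf by (simp_all add: s_inverse_def)

lemma sgraph_inverse: "sgraph f" "sgraph g"
  using inverse s_function_sgraph unfolding s_inverse_def by blast+

lemma elem_ty_inverse:
  "elem_ty (src f) = snd u" "elem_ty (tgt f) = snd x" "elem_ty (src g) = snd x" "elem_ty (tgt g) = snd u"
  by (simp_all add: src_tgt_inverse srcf tgtf X Univ_closed)

lemma Univ_u: "wf_trm L (Univ (snd u))" "fv (Univ (snd u)) = {}" "ty_of (Univ (snd u)) = Pow (snd u)"
  using Univ_closed wu by blast+

lemma graph_g_f_iff:
  "\<Gamma> ||- Mem a (graph (s_comp g f)) \<longleftrightarrow> \<Gamma> ||- Mem a (graph (s_id (Univ (snd u))))"
proof -
  have eq: "derives L S {} (Eq (graph (s_comp g f)) (graph (s_id (Univ (snd u)))))"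
    using inverse srcf by (simp add: s_inverse_def s_eq_def)
  have "fv (graph (s_comp g f)) = {}" "fv (graph (s_id (Univ (snd u) :: ('g, 'f) trm))) = {}"
    using s_comp_sgraph[OF sgraph_inverse] sgraph_s_id[OF Univ_u]
    unfolding closed_graph_def by (simp_all add: elem_ty_inverse)
  with eq show ?thesis by (rule forces_Mem_theorem_cong)
qed

lemma graph_f_g_iff:
  "\<Gamma> ||- Mem a (graph (s_comp f g)) \<longleftrightarrow> \<Gamma> ||- Mem a (graph (s_id X))"
proof -
  have eq: "derives L S {} (Eq (graph (s_comp f g)) (graph (s_id X)))"
    using inverse tgtf by (simp add: s_inverse_def s_eq_def)
  have "fv (graph (s_comp f g)) = {}" "fv (graph (s_id X)) = {}"
    using s_comp_sgraph[OF sgraph_inverse(2,1)] sgraph_s_id[OF X] elem_ty_inverse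
    by (simp_all add: closed_graph_def)
  with eq show ?thesis by (rule forces_Mem_theorem_cong)
qed

text \<open>Going from \<open>v\<close> to \<open>a\<close> and on to \<open>w\<close> is a step of
  \<open>s_comp g f\<close>, whose graph has the same members as that of the identity.\<close>

lemma related_f_g_eq:
  assumes "related \<Gamma> (graph f) v a" "related \<Gamma> (graph g) a w"
  shows "\<Gamma> ||- Eq v w"
  using related_s_compI[OF sgraph_inverse _ assms] elem_ty_inverse related_s_id_iff[OF Univ_u]
  by (simp add: graph_g_f_iff)

lemma related_g_f_eq:
  assumes "related \<Gamma> (graph g) a v" "related \<Gamma> (graph f) v b"
  shows "\<Gamma> ||- Eq a b" "\<Gamma> ||- Mem a X"
  using related_s_compI[OF sgraph_inverse(2,1) _ assms] elem_ty_inverse related_s_id_iff[OF X]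
  by (simp_all add: graph_f_g_iff)

lemma related_g_elt:
  assumes "related \<Gamma> (graph g) a v"
  shows "elt \<Gamma> (snd x) a" "elt \<Gamma> (snd u) v"
  using related_elt[OF assms sgraph_inverse(2)] by (simp_all add: elem_ty_inverse)

text \<open>The pair of \<open>v\<close> with itself lies in the graph of the identity, hence in
  that of \<open>s_comp g f\<close>; opening the composite yields an image of \<open>v\<close>
  together with the way back.\<close>

lemma f_totalE:
  assumes "stage \<Gamma>" "elt \<Gamma> (snd u) v" "elt \<Gamma> Omega \<chi>"
    and "\<And>\<Delta> a. \<Gamma> \<preceq> \<Delta> \<Longrightarrow> related \<Delta> (graph f) v a \<Longrightarrow> related \<Delta> (graph g) a v \<Longrightarrow> \<Delta> ||- \<chi>"
  shows "\<Gamma> ||- \<chi>"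
proof (rule related_s_compE[OF sgraph_inverse _ _ assms(3,4)])
  show "related \<Gamma> (graph (s_comp g f)) v v"
    unfolding graph_g_f_iff related_s_id_iff[OF Univ_u]
    using assms(1,2) by (simp add: forces_refl Mem_Univ)
qed (simp_all add: elem_ty_inverse)

lemma g_totalE:
  assumes mem: "\<Gamma> ||- Mem a X" and "elt \<Gamma> Omega \<chi>"
    and "\<And>\<Delta> v. \<Gamma> \<preceq> \<Delta> \<Longrightarrow> related \<Delta> (graph g) a v \<Longrightarrow> \<Delta> ||- \<chi>"
  shows "\<Gamma> ||- \<chi>"
proof (rule related_s_compE[OF sgraph_inverse(2,1) _ _ assms(2,3)])
  have "elt \<Gamma> (snd x) a" using forces_elt[OF mem] X by (simp add: elt_def)
  then show "related \<Gamma> (graph (s_comp f g)) a a"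
    unfolding graph_f_g_iff related_s_id_iff[OF X]
    using mem forces_stage[OF mem] by (simp add: forces_refl)
qed (simp_all add: elem_ty_inverse)

text \<open>Totality of \<open>f\<close> gives some \<open>b\<close> to which \<open>f\<close> sends
  \<open>v\<close> and which \<open>g\<close> sends back to \<open>v\<close>; since
  \<open>s_comp f g\<close> is the identity, \<open>a = b\<close>. The claim is a formula, so it
  does not matter that \<open>b\<close> exists only locally.\<close>

lemma related_g_f:
  assumes rel: "related \<Gamma> (graph g) a v"
  shows "related \<Gamma> (graph f) v a"
proof -
  note st = forces_stage[OF rel]
  note el = related_g_elt[OF rel]
  have "elt \<Gamma> Omega (Mem (Tup [v, a]) (graph f))"
    using el sgraph_inverse(1) by (simp add: elt_def closed_graph_def elem_ty_inverse)
  with st el(2) show ?thesis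
  proof (rule f_totalE)
    fix \<Delta> b assume \<Delta>: "\<Gamma> \<preceq> \<Delta>" and b: "related \<Delta> (graph f) v b" "related \<Delta> (graph g) b v"
    have "\<Delta> ||- Eq a b" using related_g_f_eq(1)[OF forces_mono[OF rel \<Delta>] b(1)] .
    moreover have "\<Delta> ||- Eq v v" using forces_refl[OF later_stage[OF \<Delta>] elt_mono[OF el(2) \<Delta>]] .
    ultimately show "related \<Delta> (graph f) v a" using related_cong[OF b(1)] forces_sym by blast
  qed
qed

text \<open>Turning one of the two arrows around makes a step of \<open>s_comp g f\<close> from one
  value to the other.\<close>

lemma related_g_unique: "related \<Gamma> (graph g) a v \<Longrightarrow> related \<Gamma> (graph g) a w \<Longrightarrow> \<Gamma> ||- Eq w v"
  using related_f_g_eq related_g_f by blast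

lemma related_g_Mem: "related \<Gamma> (graph g) a v \<Longrightarrow> \<Gamma> ||- Mem a X"
  using related_g_f_eq(2) related_g_f by blast

lemmas preimage_context = sgraph_inverse(2) elem_ty_inverse(3) src_tgt_inverse(2)

lemma forces_preimage_g_iff:
  assumes "wf_fm L \<theta>" "var_list L xs u \<theta>" "env \<Gamma> \<sigma> (insert x (set xs))" "related \<Gamma> (graph g) (\<sigma> x) v"
  shows "\<Gamma> ||- ssubst \<sigma> (preimage xs u x g \<theta>) \<longleftrightarrow> \<Gamma> ||- ssubst (\<sigma>(u := v)) \<theta>"
  using related_g_unique[OF forces_mono[OF assms(4)]]
  by (intro forces_preimage_iff[OF preimage_context assms]) blast

lemma wf_preimage_g:
  assumes "wf_fm L \<theta>" "var_list L xs u \<theta>"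
  shows "wf_fm L (preimage xs u x g \<theta>)" "fv (preimage xs u x g \<theta>) = insert x (set xs)"
  using wf_preimage[OF preimage_context assms] fv_preimage[OF preimage_context assms] by simp_all

lemma wx: "wf_var L x"
  using wf_ty_ty_of[OF local_language X(1)] X(3) by simp

lemma env_Var_preimage:
  assumes "var_list L xs u \<theta>" "insert x (set xs) \<subseteq> fvs \<Gamma>"
  shows "env \<Gamma> Var (insert x (set xs))"
  using assms wx by (intro env_Var) (auto simp: var_list_def)

text \<open>Once a value of \<open>g\<close> at \<open>x\<close> is fixed, it remains a value at
  later stages, and there translating means substituting it for \<open>u\<close>.\<close>

lemma preimage_eq_pointwise:
  assumes \<theta>: "wf_fm L \<theta>" "var_list L xs u \<theta>" and rel: "related \<Gamma> (graph g) (Var x) v"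
    and \<beta>: "elt \<Gamma> Omega \<beta>" and xs: "insert x (set xs) \<subseteq> fvs \<Gamma>"
    and iff: "\<And>\<Delta>. \<Gamma> \<preceq> \<Delta> \<Longrightarrow> \<Delta> ||- ssubst (Var(u := v)) \<theta> \<longleftrightarrow> \<Delta> ||- \<beta>"
  shows "\<Gamma> ||- Eq (preimage xs u x g \<theta>) \<beta>"
proof -
  note env = env_Var_preimage[OF \<theta>(2) xs]
  have "elt \<Gamma> Omega (preimage xs u x g \<theta>)"
    using wf_preimage_g[OF \<theta>] xs by (simp add: elt_Omega_iff)
  moreover have "\<Delta> ||- preimage xs u x g \<theta> \<longleftrightarrow> \<Delta> ||- \<beta>" if \<Delta>: "\<Gamma> \<preceq> \<Delta>" for \<Delta>
    using forces_preimage_g_iff[OF \<theta> env_mono[OF env \<Delta>] forces_mono[OF rel \<Delta>]] iff[OF \<Delta>] by simp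
  ultimately show ?thesis
    using forces_eq_Omega_iff[OF forces_stage[OF rel] _ \<beta>] by blast
qed

text \<open>The three lists may differ: at a stage with value \<open>v\<close> the truth of a
  translation does not depend on the list, provided that its variables are declared.\<close>

lemma connective_eq_pointwise:
  assumes c: "truth_functional c" and \<theta>: "wf_fm L \<theta>" and \<gamma>: "wf_fm L \<gamma>"
    and xs: "var_list L xs u (c \<theta> \<gamma>)" and ys: "var_list L ys u \<theta>" and zs: "var_list L zs u \<gamma>"
    and fv: "insert x (set xs \<union> set ys \<union> set zs) \<subseteq> fvs \<Gamma>" and rel: "related \<Gamma> (graph g) (Var x) v"
  shows "\<Gamma> ||- Eq (preimage xs u x g (c \<theta> \<gamma>)) (c (preimage ys u x g \<theta>) (preimage zs u x g \<gamma>))"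
    (is "_ ||- Eq _ (c ?\<theta> ?\<gamma>)")
proof -
  have wfc: "wf_fm L (c \<theta> \<gamma>)" "wf_fm L (c ?\<theta> ?\<gamma>)" and fvc: "fv (c ?\<theta> ?\<gamma>) = fv ?\<theta> \<union> fv ?\<gamma>"
    using c \<theta> \<gamma> wf_preimage_g[OF \<theta> ys] wf_preimage_g[OF \<gamma> zs] unfolding truth_functional_def by blast+
  note v = related_g_elt(2)[OF rel]
  have ey: "env \<Gamma> Var (insert x (set ys))" and ez: "env \<Gamma> Var (insert x (set zs))"
    using ys zs fv by (auto intro!: env_Var_preimage)
  have e1: "env \<Gamma> (Var(u := v)) (fv \<theta> \<union> fv \<gamma>)"
    using ey ez v ys zs by (fastforce simp: env_def var_list_def)
  have e2: "env \<Gamma> Var (fv ?\<theta> \<union> fv ?\<gamma>)"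
    using ey ez by (auto simp: env_def wf_preimage_g[OF \<theta> ys] wf_preimage_g[OF \<gamma> zs])
  show ?thesis
  proof (rule preimage_eq_pointwise[OF wfc(1) xs rel])
    show "elt \<Gamma> Omega (c ?\<theta> ?\<gamma>)"
      using wfc fvc fv by (auto simp: elt_Omega_iff wf_preimage_g[OF \<theta> ys] wf_preimage_g[OF \<gamma> zs])
    show "insert x (set xs) \<subseteq> fvs \<Gamma>" using fv by auto
    fix \<Delta> assume \<Delta>: "\<Gamma> \<preceq> \<Delta>"
    have "\<Theta> ||- ssubst (Var(u := v)) \<theta> \<longleftrightarrow> \<Theta> ||- ssubst Var ?\<theta>"
      "\<Theta> ||- ssubst (Var(u := v)) \<gamma> \<longleftrightarrow> \<Theta> ||- ssubst Var ?\<gamma>" if "\<Delta> \<preceq> \<Theta>" for \<Theta>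
      using forces_preimage_g_iff[OF \<theta> ys env_mono[OF ey] forces_mono[OF rel]]
        forces_preimage_g_iff[OF \<gamma> zs env_mono[OF ez] forces_mono[OF rel]] later_trans[OF \<Delta> that] by blast+
    with c \<theta> \<gamma> wf_preimage_g(1)[OF \<theta> ys] wf_preimage_g(1)[OF \<gamma> zs] later_stage[OF \<Delta>]
      env_mono[OF e1 \<Delta>] env_mono[OF e2 \<Delta>]
    have "\<Delta> ||- ssubst (Var(u := v)) (c \<theta> \<gamma>) \<longleftrightarrow> \<Delta> ||- ssubst Var (c ?\<theta> ?\<gamma>)"
      unfolding truth_functional_def by blast
    then show "\<Delta> ||- ssubst (Var(u := v)) (c \<theta> \<gamma>) \<longleftrightarrow> \<Delta> ||- c ?\<theta> ?\<gamma>" by simp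
  qed
qed

text \<open>The hypothesis \<open>x \<in> X\<close> makes \<open>g\<close> defined at
  \<open>x\<close> locally, and the equation to be proved is a formula, so a stage with a value may
  be assumed.\<close>

lemma derives_eq_within:
  assumes wf: "wf_fm L \<phi>" "wf_fm L \<psi>"
    and E: "\<And>\<Gamma> v. related \<Gamma> (graph g) (Var x) v \<Longrightarrow> fv \<phi> \<union> fv \<psi> \<subseteq> fvs \<Gamma> \<Longrightarrow> \<Gamma> ||- Eq \<phi> \<psi>"
  shows "derives L S {Mem (Var x) X} (Eq \<phi> \<psi>)"
proof (rule derives_forces)
  show "stage {Mem (Var x) X}" using X wx by (simp add: stage_def)
  show wfe: "wf_fm L (Eq \<phi> \<psi>)" using wf by (simp add: wf_fm_def)
  fix \<Gamma> assume \<Gamma>: "{Mem (Var x) X} \<preceq> \<Gamma>" and fv: "fv (Eq \<phi> \<psi>) \<subseteq> fvs \<Gamma>"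
  have "\<Gamma> ||- Mem (Var x) X" using \<Gamma> by (intro forces_hyp) (auto simp: later_def)
  then show "\<Gamma> ||- Eq \<phi> \<psi>"
  proof (rule g_totalE)
    show "elt \<Gamma> Omega (Eq \<phi> \<psi>)" using wfe fv unfolding elt_Omega_iff by blast
    fix \<Delta> v assume \<Delta>: "\<Gamma> \<preceq> \<Delta>" and rel: "related \<Delta> (graph g) (Var x) v"
    show "\<Delta> ||- Eq \<phi> \<psi>"
      using fv \<Delta> fvs_mono[of \<Gamma> \<Delta>] unfolding later_def by (intro E[OF rel]) auto
  qed
qed

lemma connective_preimage_within:
  assumes c: "truth_functional c" and \<theta>: "wf_fm L \<theta>" and \<gamma>: "wf_fm L \<gamma>"
    and xs: "var_list L xs u (c \<theta> \<gamma>)" and ys: "var_list L ys u \<theta>" and zs: "var_list L zs u \<gamma>"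
  shows "derives L S {Mem (Var x) X}
    (Eq (preimage xs u x g (c \<theta> \<gamma>)) (c (preimage ys u x g \<theta>) (preimage zs u x g \<gamma>)))"
    (is "derives L S _ (Eq ?l ?r)")
proof (rule derives_eq_within)
  have wfc: "wf_fm L (c \<theta> \<gamma>)" using c \<theta> \<gamma> unfolding truth_functional_def by blast
  note l = wf_preimage_g[OF wfc xs]
  show "wf_fm L ?l" by (rule l)
  have r: "wf_fm L ?r" "fv ?r = insert x (set ys \<union> set zs)"
    using c \<theta> \<gamma> wf_preimage_g[OF \<theta> ys] wf_preimage_g[OF \<gamma> zs] unfolding truth_functional_def by auto
  show "wf_fm L ?r" by (rule r)
  fix \<Gamma> v assume rel: "related \<Gamma> (graph g) (Var x) v" and fv: "fv ?l \<union> fv ?r \<subseteq> fvs \<Gamma>"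
  have "insert x (set xs \<union> set ys \<union> set zs) \<subseteq> fvs \<Gamma>" using fv l(2) r(2) by simp
  then show "\<Gamma> ||- Eq ?l ?r" using rel by (rule connective_eq_pointwise[OF assms])
qed

text \<open>
  A compound which entails the disjunction of its parts forces membership in the domain, so that the
  hypothesis can be dropped.
\<close>

lemma connective_preimage:
  assumes c: "truth_functional c" and \<theta>: "wf_fm L \<theta>" and \<gamma>: "wf_fm L \<gamma>"
    and xs: "var_list L xs u (c \<theta> \<gamma>)" and ys: "var_list L ys u \<theta>" and zs: "var_list L zs u \<gamma>"
    and strict: "entails_Or c"
  shows "derives L S {} (Eq (preimage xs u x g (c \<theta> \<gamma>)) (c (preimage ys u x g \<theta>) (preimage zs u x g \<gamma>)))"
    (is "derives L S _ (Eq ?l (c ?\<theta> ?\<gamma>))")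
proof (rule derives_forces)
  let ?r = "c ?\<theta> ?\<gamma>"
  have wfc: "wf_fm L (c \<theta> \<gamma>)" using c \<theta> \<gamma> unfolding truth_functional_def by blast
  note y = wf_preimage_g[OF \<theta> ys] and z = wf_preimage_g[OF \<gamma> zs]
  have r: "wf_fm L ?r" "fv ?r = insert x (set ys \<union> set zs)"
    using c \<theta> \<gamma> y z unfolding truth_functional_def by auto
  note l = wf_preimage_g[OF wfc xs]
  show wf: "wf_fm L (Eq ?l ?r)" using l(1) r(1) by (simp add: wf_fm_def)
  fix \<Gamma> assume "{} \<preceq> \<Gamma>" and fv: "fv (Eq ?l ?r) \<subseteq> fvs \<Gamma>"
  then have st: "stage \<Gamma>" by (simp add: later_def)
  have vars: "insert x (set xs \<union> set ys \<union> set zs) \<subseteq> fvs \<Gamma>" using fv l(2) r(2) by simp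
  have els: "elt \<Gamma> Omega ?l" "elt \<Gamma> Omega ?r" "elt \<Gamma> Omega ?\<theta>" "elt \<Gamma> Omega ?\<gamma>"
    using vars l r y z by (auto simp: elt_Omega_iff)
  have eq: "\<Delta> ||- ?l \<longleftrightarrow> \<Delta> ||- ?r" if \<Delta>: "\<Gamma> \<preceq> \<Delta>" and rel: "related \<Delta> (graph g) (Var x) v" for \<Delta> v
  proof -
    have "insert x (set xs \<union> set ys \<union> set zs) \<subseteq> fvs \<Delta>"
      using vars \<Delta> fvs_mono[of \<Gamma> \<Delta>] unfolding later_def by blast
    then have "\<Delta> ||- Eq ?l ?r" using rel by (rule connective_eq_pointwise[OF c \<theta> \<gamma> xs ys zs])
    then show ?thesis using forces_eqD forces_sym by blast
  qed
  have ev: "env \<Gamma> Var (insert x (set xs))" "env \<Gamma> Var (insert x (set ys))" "env \<Gamma> Var (insert x (set zs))"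
    using vars xs ys zs by (auto intro!: env_Var_preimage)
  \<comment> \<open>A forced translation already yields a local value of \<open>g\<close> at
    \<open>x\<close>; this takes the place of the hypothesis \<open>x \<in> X\<close>.\<close>
  have dom: "\<Delta> ||- \<chi>"
    if "\<Gamma> \<preceq> \<Delta>" "\<Delta> ||- preimage ws u x g \<phi>" "wf_fm L \<phi>" "var_list L ws u \<phi>" "env \<Gamma> Var (insert x (set ws))"
      "elt \<Delta> Omega \<chi>" "\<And>\<Theta> v. \<Delta> \<preceq> \<Theta> \<Longrightarrow> related \<Theta> (graph g) (Var x) v \<Longrightarrow> \<Theta> ||- \<chi>" for \<Delta> ws \<phi> \<chi>
    using forces_preimageE[OF preimage_context that(3,4) _ env_mono[OF that(5,1)] that(6)] that(2,7) by simp
  show "\<Gamma> ||- Eq ?l ?r"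
    unfolding forces_eq_Omega_iff[OF st els(1,2)]
  proof (intro allI impI iffI)
    fix \<Delta> assume \<Delta>: "\<Gamma> \<preceq> \<Delta>"
    show "\<Delta> ||- ?r" if "\<Delta> ||- ?l"
      using dom[OF \<Delta> that wfc xs ev(1) elt_mono[OF els(2) \<Delta>]] eq later_trans[OF \<Delta>] forces_mono[OF that] by blast
    show "\<Delta> ||- ?l" if r: "\<Delta> ||- ?r"
    proof (rule entails_OrD[OF strict r els(3,4,1)[THEN elt_mono, OF \<Delta>]])
      fix \<Theta> assume \<Theta>: "\<Delta> \<preceq> \<Theta>" and "\<Theta> ||- ?\<theta> \<or> \<Theta> ||- ?\<gamma>"
      note l\<Theta> = later_trans[OF \<Delta> \<Theta>]
      have *: "\<Xi> ||- ?l" if "\<Theta> \<preceq> \<Xi>" "related \<Xi> (graph g) (Var x) v" for \<Xi> v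
        using eq[OF later_trans[OF l\<Theta> that(1)] that(2)] forces_mono[OF r later_trans[OF \<Theta> that(1)]] by blast
      from \<open>\<Theta> ||- ?\<theta> \<or> \<Theta> ||- ?\<gamma>\<close> show "\<Theta> ||- ?l"
        using dom[OF l\<Theta> _ \<theta> ys ev(2) elt_mono[OF els(1) l\<Theta>]] dom[OF l\<Theta> _ \<gamma> zs ev(3) elt_mono[OF els(1) l\<Theta>]] *
        by blast
    qed
  qed
qed (simp add: stage_def)

text \<open>\<open>Fls\<close> is kept and not translated, so this is no instance of the case of
  \<open>Imp\<close>. At a stage with a value the antecedents of the two implications agree, and the
  consequent is \<open>Fls\<close> in both.\<close>

lemma preimage_Neg:
  assumes \<theta>: "wf_fm L \<theta>" and xs: "var_list L xs u (Neg \<theta>)" and ys: "var_list L ys u \<theta>"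
  shows "derives L S {Mem (Var x) X} (Eq (preimage xs u x g (Neg \<theta>)) (Neg (preimage ys u x g \<theta>)))"
    (is "derives L S _ (Eq ?l (Neg ?\<theta>))")
proof (rule derives_eq_within)
  note y = wf_preimage_g[OF \<theta> ys]
  have wfn: "wf_fm L (Neg \<theta>)" using \<theta> by simp
  note l = wf_preimage_g[OF wfn xs]
  show "wf_fm L ?l" by (rule l)
  show wr: "wf_fm L (Neg ?\<theta>)" using y by simp
  fix \<Gamma> v assume rel: "related \<Gamma> (graph g) (Var x) v" and fv: "fv ?l \<union> fv (Neg ?\<theta>) \<subseteq> fvs \<Gamma>"
  have vars: "insert x (set xs \<union> set ys) \<subseteq> fvs \<Gamma>" using fv l(2) y(2) by simp
  note v = related_g_elt(2)[OF rel]
  have ey: "env \<Gamma> Var (insert x (set ys))" using ys vars by (auto intro!: env_Var_preimage)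
  have e1: "env \<Gamma> (Var(u := v)) (fv \<theta>)"
    using ey v ys by (fastforce simp: env_def var_list_def)
  show "\<Gamma> ||- Eq ?l (Neg ?\<theta>)"
  proof (rule preimage_eq_pointwise[OF wfn xs rel])
    show "elt \<Gamma> Omega (Neg ?\<theta>)" using wr y vars by (simp add: elt_Omega_iff)
    show "insert x (set xs) \<subseteq> fvs \<Gamma>" using vars by auto
    fix \<Delta> assume \<Delta>: "\<Gamma> \<preceq> \<Delta>"
    have els: "elt \<Delta> Omega (ssubst (Var(u := v)) \<theta>)" "elt \<Delta> Omega ?\<theta>" "elt \<Delta> Omega Fls"
      using elt_ssubst_fm[OF \<theta> env_mono[OF e1 \<Delta>]] elt_mono[OF _ \<Delta>, of Omega ?\<theta>] y vars
      by (auto simp: elt_Omega_iff)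
    have "\<Theta> ||- ?\<theta> \<longleftrightarrow> \<Theta> ||- ssubst (Var(u := v)) \<theta>" if "\<Delta> \<preceq> \<Theta>" for \<Theta>
      using forces_preimage_g_iff[OF \<theta> ys env_mono[OF ey] forces_mono[OF rel]] later_trans[OF \<Delta> that]
      by simp
    then show "\<Delta> ||- ssubst (Var(u := v)) (Neg \<theta>) \<longleftrightarrow> \<Delta> ||- Neg ?\<theta>"
      using els later_stage[OF \<Delta>] by (simp add: Neg_def forces_Imp_iff)
  qed
qed

section \<open>Quantifiers\<close>

context
  fixes \<theta> xs
  assumes \<theta>: "wf_fm L \<theta>" and xs: "var_list L xs u \<theta>" and x_notin: "x \<notin> fv \<theta>"
begin

text \<open>The list may contain \<open>x\<close>, which the quantifier over \<open>X\<close> binds;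
  hence only \<open>set xs - {x}\<close> has to be declared.\<close>

lemma fv_\<theta>_sub: "fv \<theta> - {u} \<subseteq> set xs - {x}"
  using xs x_notin by (auto simp: var_list_def)

lemma env_quantifier:
  assumes "set xs - {x} \<subseteq> fvs \<Gamma>"
  shows "env \<Gamma> Var (fv \<theta> - {u})" "env \<Gamma> Var (set xs - {x})"
proof -
  show "env \<Gamma> Var (set xs - {x})" using assms xs by (intro env_Var) (auto simp: var_list_def)
  then show "env \<Gamma> Var (fv \<theta> - {u})" using fv_\<theta>_sub by (rule env_subset)
qed

text \<open>\<open>x\<close> is not free in \<open>\<theta>\<close>, so the element put for
  \<open>x\<close> reaches \<open>\<theta>\<close> only through its value \<open>v\<close>.\<close>

lemma preimage_instance_iff:
  assumes "set xs - {x} \<subseteq> fvs \<Gamma>" and rel: "related \<Gamma> (graph g) a v"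
  shows "\<Gamma> ||- ssubst (Var(x := a)) (preimage xs u x g \<theta>) \<longleftrightarrow> \<Gamma> ||- ssubst (Var(u := v)) \<theta>"
proof -
  have "elt \<Gamma> (snd x) a" by (rule related_g_elt[OF rel])
  then have "env \<Gamma> (Var(x := a)) (insert x (set xs))"
    using env_quantifier(2)[OF assms(1)] by (auto simp: env_def)
  moreover have "ssubst (Var(x := a, u := v)) \<theta> = ssubst (Var(u := v)) \<theta>"
    using x_notin by (intro ssubst_cong) auto
  ultimately show ?thesis
    using forces_preimage_g_iff[OF \<theta> xs, of \<Gamma> "Var(x := a)" v] rel by simp
qed

lemma elt_Mem_X: "elt \<Gamma> (snd x) a \<Longrightarrow> elt \<Gamma> Omega (Mem a X)"
  using X by (simp add: elt_def)

lemma elt_preimage_instance: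
  assumes "set xs - {x} \<subseteq> fvs \<Gamma>" "elt \<Gamma> (snd x) a"
  shows "elt \<Gamma> Omega (ssubst (Var(x := a)) (preimage xs u x g \<theta>))"
  using env_quantifier(2)[OF assms(1)] assms(2)
  by (intro elt_ssubst_fm[OF wf_preimage_g(1)[OF \<theta> xs]]) (auto simp: wf_preimage_g(2)[OF \<theta> xs] env_def)

text \<open>The correspondence between elements of type \<open>snd u\<close> and members of
  \<open>X\<close> carries instances to instances: every member has a value under \<open>g\<close>,
  and every element is such a value. Both choices are local, and an instance is a formula.\<close>

lemma preimage_Forall: "derives L S {} (Eq (Forall u \<theta>) (Forall_in x X (preimage xs u x g \<theta>)))"
  (is "derives L S _ (Eq ?l (Forall_in x X ?\<theta>))")
proof (rule derives_forces)
  let ?r = "Forall_in x X ?\<theta>"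
  note pre = wf_preimage_g[OF \<theta> xs]
  have wr: "wf_fm L ?r" "fv ?r = set xs - {x}" and wl: "wf_fm L ?l"
    using pre X wx wu \<theta> by (auto simp: Forall_in_def)
  show "wf_fm L (Eq ?l ?r)" using wr(1) wl by (simp add: wf_fm_def)
  fix \<Gamma> assume "{} \<preceq> \<Gamma>" and fv: "fv (Eq ?l ?r) \<subseteq> fvs \<Gamma>"
  then have st: "stage \<Gamma>" by (simp add: later_def)
  have vars: "set xs - {x} \<subseteq> fvs \<Delta>" if "\<Gamma> \<preceq> \<Delta>" for \<Delta>
    using fv wr(2) fvs_mono[of \<Gamma> \<Delta>] that unfolding later_def by auto
  have els: "elt \<Gamma> Omega ?l" "elt \<Gamma> Omega ?r"
    using wl wr fv unfolding elt_Omega_iff by simp_all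
  have L: "\<Delta> ||- ?l \<longleftrightarrow> (\<forall>\<Theta> v. \<Delta> \<preceq> \<Theta> \<longrightarrow> elt \<Theta> (snd u) v \<longrightarrow> \<Theta> ||- ssubst (Var(u := v)) \<theta>)"
    if \<Delta>: "\<Gamma> \<preceq> \<Delta>" for \<Delta>
    using forces_ssubst_Forall_iff[OF later_stage[OF \<Delta>] \<theta> wu env_quantifier(1)[OF vars[OF \<Delta>]]] by simp
  note elpre = elt_preimage_instance[OF vars]
  \<comment> \<open>The implication is absorbed into the range of the quantifier, which becomes that
    of members of \<open>X\<close> at later stages.\<close>
  have R: "\<Delta> ||- ?r \<longleftrightarrow> (\<forall>\<Theta> a. \<Delta> \<preceq> \<Theta> \<longrightarrow> \<Theta> ||- Mem a X \<longrightarrow> \<Theta> ||- ssubst (Var(x := a)) ?\<theta>)"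
    if \<Delta>: "\<Gamma> \<preceq> \<Delta>" for \<Delta>
  proof -
    have wfi: "wf_fm L (Imp (Mem (Var x) X) ?\<theta>)" using pre X wx by simp
    have "env \<Delta> Var (fv (Imp (Mem (Var x) X) ?\<theta>) - {x})"
      using env_quantifier(2)[OF vars[OF \<Delta>]] by (rule env_subset) (auto simp: pre(2) X(2))
    then have "\<Delta> ||- ?r \<longleftrightarrow> (\<forall>\<Theta> a. \<Delta> \<preceq> \<Theta> \<longrightarrow> elt \<Theta> (snd x) a \<longrightarrow>
        \<Theta> ||- Imp (Mem a X) (ssubst (Var(x := a)) ?\<theta>))"
      using forces_ssubst_Forall_iff[OF later_stage[OF \<Delta>] wfi wx, of Var]
      by (simp add: Forall_in_def ssubst_closed X(2))
    also have "\<dots> \<longleftrightarrow> (\<forall>\<Theta> a. \<Delta> \<preceq> \<Theta> \<longrightarrow> elt \<Theta> (snd x) a \<longrightarrow>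
        (\<forall>\<Xi>. \<Theta> \<preceq> \<Xi> \<longrightarrow> \<Xi> ||- Mem a X \<longrightarrow> \<Xi> ||- ssubst (Var(x := a)) ?\<theta>))"
      using forces_Imp_iff[OF later_stage elt_Mem_X elpre[OF later_trans[OF \<Delta>]]]
      by (intro all_cong1 imp_cong refl) blast
    also have "\<dots> \<longleftrightarrow> (\<forall>\<Theta> a. \<Delta> \<preceq> \<Theta> \<longrightarrow> \<Theta> ||- Mem a X \<longrightarrow> \<Theta> ||- ssubst (Var(x := a)) ?\<theta>)"
    proof -
      have "elt \<Theta> (snd x) a" if "\<Theta> ||- Mem a X" for \<Theta> a
        using forces_elt[OF that] X by (simp add: elt_def)
      then show ?thesis using later_trans later_refl later_stage by meson
    qed
    finally show ?thesis .
  qed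
  show "\<Gamma> ||- Eq ?l ?r"
    unfolding forces_eq_Omega_iff[OF st els]
  proof (intro allI impI)
    fix \<Delta> assume \<Delta>: "\<Gamma> \<preceq> \<Delta>"
    show "\<Delta> ||- ?l \<longleftrightarrow> \<Delta> ||- ?r"
      unfolding L[OF \<Delta>] R[OF \<Delta>]
    proof (intro iffI allI impI)
      fix \<Theta> a
      assume all: "\<forall>\<Theta> v. \<Delta> \<preceq> \<Theta> \<longrightarrow> elt \<Theta> (snd u) v \<longrightarrow> \<Theta> ||- ssubst (Var(u := v)) \<theta>"
        and \<Theta>: "\<Delta> \<preceq> \<Theta>" and mem: "\<Theta> ||- Mem a X"
      have a: "elt \<Theta> (snd x) a" using forces_elt[OF mem] X by (simp add: elt_def)
      note l\<Theta> = later_trans[OF \<Delta> \<Theta>]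
      from mem elpre[OF l\<Theta> a] show "\<Theta> ||- ssubst (Var(x := a)) ?\<theta>"
      proof (rule g_totalE)
        fix \<Xi> v assume \<Xi>: "\<Theta> \<preceq> \<Xi>" and rel: "related \<Xi> (graph g) a v"
        from related_g_elt(2)[OF rel] all later_trans[OF \<Theta> \<Xi>]
        show "\<Xi> ||- ssubst (Var(x := a)) ?\<theta>"
          using preimage_instance_iff[OF vars[OF later_trans[OF l\<Theta> \<Xi>]] rel] by blast
      qed
    next
      fix \<Theta> v
      assume all: "\<forall>\<Theta> a. \<Delta> \<preceq> \<Theta> \<longrightarrow> \<Theta> ||- Mem a X \<longrightarrow> \<Theta> ||- ssubst (Var(x := a)) ?\<theta>"
        and \<Theta>: "\<Delta> \<preceq> \<Theta>" and v: "elt \<Theta> (snd u) v"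
      note l\<Theta> = later_trans[OF \<Delta> \<Theta>]
      have "elt \<Theta> Omega (ssubst (Var(u := v)) \<theta>)"
        using env_upd[OF env_quantifier(1)[OF vars[OF l\<Theta>]] v] by (rule elt_ssubst_fm[OF \<theta>])
      with later_stage[OF \<Theta>] v show "\<Theta> ||- ssubst (Var(u := v)) \<theta>"
      proof (rule f_totalE)
        fix \<Xi> a assume \<Xi>: "\<Theta> \<preceq> \<Xi>" and rel: "related \<Xi> (graph g) a v"
        show "\<Xi> ||- ssubst (Var(u := v)) \<theta>"
          using all later_trans[OF \<Theta> \<Xi>] related_g_Mem[OF rel]
            preimage_instance_iff[OF vars[OF later_trans[OF l\<Theta> \<Xi>]] rel] by blast
      qed
    qed
  qed
qed (simp add: stage_def)

text \<open>As for \<open>Forall\<close>, but the correspondence now transports witnesses. From left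
  to right the new witness must also lie in \<open>X\<close>, which follows from its having a value
  under \<open>g\<close>.\<close>

lemma preimage_Exists: "derives L S {} (Eq (Exists u \<theta>) (Exists_in x X (preimage xs u x g \<theta>)))"
  (is "derives L S _ (Eq ?l (Exists_in x X ?\<theta>))")
proof (rule derives_forces)
  let ?r = "Exists_in x X ?\<theta>"
  let ?b = "And (Mem (Var x) X) ?\<theta>"
  note pre = wf_preimage_g[OF \<theta> xs]
  have wr: "wf_fm L ?r" "fv ?r = set xs - {x}" and wl: "wf_fm L ?l"
    using pre X wx wu \<theta> by (auto simp: Exists_in_def)
  show "wf_fm L (Eq ?l ?r)" using wr(1) wl by (simp add: wf_fm_def)
  fix \<Gamma> assume "{} \<preceq> \<Gamma>" and fv: "fv (Eq ?l ?r) \<subseteq> fvs \<Gamma>"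
  then have st: "stage \<Gamma>" by (simp add: later_def)
  have vars: "set xs - {x} \<subseteq> fvs \<Delta>" if "\<Gamma> \<preceq> \<Delta>" for \<Delta>
    using fv wr(2) fvs_mono[of \<Gamma> \<Delta>] that unfolding later_def by auto
  have els: "elt \<Gamma> Omega ?l" "elt \<Gamma> Omega ?r"
    using wl wr fv unfolding elt_Omega_iff by simp_all
  have wfb: "wf_fm L ?b" using pre X wx by simp
  have envb: "env \<Delta> Var (fv ?b - {x})" if "\<Gamma> \<preceq> \<Delta>" for \<Delta>
    using env_quantifier(2)[OF vars[OF that]] by (rule env_subset) (auto simp: pre(2) X(2))
  note elpre = elt_preimage_instance[OF vars]
  have sb: "ssubst (Var(x := a)) ?b = And (Mem a X) (ssubst (Var(x := a)) ?\<theta>)" for a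
    by (simp add: ssubst_closed X(2))
  show "\<Gamma> ||- Eq ?l ?r"
    unfolding forces_eq_Omega_iff[OF st els]
  proof (intro allI impI iffI)
    fix \<Delta> assume \<Delta>: "\<Gamma> \<preceq> \<Delta>" and l: "\<Delta> ||- ?l"
    show "\<Delta> ||- ?r"
    proof (rule forces_ssubst_ExistsE[of \<Delta> Var u \<theta>])
      fix \<Theta> v assume \<Theta>: "\<Delta> \<preceq> \<Theta>" and v: "elt \<Theta> (snd u) v" and f: "\<Theta> ||- ssubst (Var(u := v)) \<theta>"
      note l\<Theta> = later_trans[OF \<Delta> \<Theta>]
      from later_stage[OF \<Theta>] v elt_mono[OF els(2) l\<Theta>] show "\<Theta> ||- ?r"
      proof (rule f_totalE)
        fix \<Xi> a assume \<Xi>: "\<Theta> \<preceq> \<Xi>" and rel: "related \<Xi> (graph g) a v"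
        note l\<Xi> = later_trans[OF l\<Theta> \<Xi>]
        note a = related_g_elt(1)[OF rel]
        have "\<Xi> ||- And (Mem a X) (ssubst (Var(x := a)) ?\<theta>)"
          unfolding forces_And_iff[OF later_stage[OF \<Xi>] elt_Mem_X[OF a] elpre[OF l\<Xi> a]]
          using related_g_Mem[OF rel] preimage_instance_iff[OF vars[OF l\<Xi>] rel] forces_mono[OF f \<Xi>] by blast
        then have "\<Xi> ||- ssubst Var (Exists x ?b)"
          using forces_ssubst_ExistsI[OF later_stage[OF \<Xi>] wfb envb[OF l\<Xi>] a] unfolding sb by blast
        then show "\<Xi> ||- ?r" by (simp add: Exists_in_def)
      qed
    qed (use l \<theta> wu env_quantifier(1)[OF vars[OF \<Delta>]] elt_mono[OF els(2) \<Delta>] in simp_all)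
  next
    fix \<Delta> assume \<Delta>: "\<Gamma> \<preceq> \<Delta>" and r: "\<Delta> ||- ?r"
    show "\<Delta> ||- ?l"
    proof (rule forces_ssubst_ExistsE[of \<Delta> Var x ?b])
      fix \<Theta> a assume \<Theta>: "\<Delta> \<preceq> \<Theta>" and a: "elt \<Theta> (snd x) a" and f: "\<Theta> ||- ssubst (Var(x := a)) ?b"
      note l\<Theta> = later_trans[OF \<Delta> \<Theta>]
      have mem: "\<Theta> ||- Mem a X" and p: "\<Theta> ||- ssubst (Var(x := a)) ?\<theta>"
        using f unfolding sb forces_And_iff[OF later_stage[OF \<Theta>] elt_Mem_X[OF a] elpre[OF l\<Theta> a]] by blast+
      from mem elt_mono[OF els(1) l\<Theta>] show "\<Theta> ||- ?l"
      proof (rule g_totalE)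
        fix \<Xi> v assume \<Xi>: "\<Theta> \<preceq> \<Xi>" and rel: "related \<Xi> (graph g) a v"
        note l\<Xi> = later_trans[OF l\<Theta> \<Xi>]
        note v = related_g_elt(2)[OF rel]
        have "\<Xi> ||- ssubst (Var(u := v)) \<theta>"
          using preimage_instance_iff[OF vars[OF l\<Xi>] rel] forces_mono[OF p \<Xi>] by blast
        then have "\<Xi> ||- ssubst Var ?l"
          by (rule forces_ssubst_ExistsI[OF later_stage[OF \<Xi>] \<theta> env_quantifier(1)[OF vars[OF l\<Xi>]] v])
        then show "\<Xi> ||- ?l" by simp
      qed
    qed (use r wfb wx envb[OF \<Delta>] elt_mono[OF els(1) \<Delta>] in \<open>simp_all add: Exists_in_def\<close>)
  qed
qed (simp add: stage_def)

end

end

end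

theorem theorem2p20:
  fixes L :: "('g, 'f) language" and S :: "('g, 'f) sequent set"
    and x u :: "'g var" and \<alpha> X \<tau> \<theta> \<gamma> :: "('g, 'f) trm"
    and f finv :: "('g, 'f) sfun"
  assumes "local_language L" and "local_set_theory L S" and "well_termed L S"
    and "wf_fm L \<alpha>" and "fv \<alpha> = {x}" and "X = Compr x \<alpha>"
    and "wf_var L u"
    and "s_bijection L S f" and "src f = Univ (snd u)" and "tgt f = X"
    and "s_inverse L S f finv"
    and "wf_trm L \<tau>" and "ty_of \<tau> = snd x" and "fv \<tau> \<subseteq> {u}"
    and "s_eq L S (s_comp (incl X) f) (maps_to [u] \<tau> (Univ (snd u)) (Univ (snd x)))"
    and "wf_fm L \<theta>" and "wf_fm L \<gamma>"
  shows
    "(\<forall>c \<in> {And, Or}. \<forall>xs ys zs.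
        var_list L xs u (c \<theta> \<gamma>) \<and> var_list L ys u \<theta> \<and> var_list L zs u \<gamma> \<longrightarrow>
        derives L S {}
          (Eq (preimage xs u x finv (c \<theta> \<gamma>)) (c (preimage ys u x finv \<theta>) (preimage zs u x finv \<gamma>)))) \<and>
     (\<forall>c \<in> {Imp, Iff}. \<forall>xs ys zs.
        var_list L xs u (c \<theta> \<gamma>) \<and> var_list L ys u \<theta> \<and> var_list L zs u \<gamma> \<longrightarrow>
        derives L S {Mem (Var x) X}
          (Eq (preimage xs u x finv (c \<theta> \<gamma>)) (c (preimage ys u x finv \<theta>) (preimage zs u x finv \<gamma>)))) \<and>
     (\<forall>xs ys. var_list L xs u (Neg \<theta>) \<and> var_list L ys u \<theta> \<longrightarrow>
        derives L S {Mem (Var x) X}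
          (Eq (preimage xs u x finv (Neg \<theta>)) (Neg (preimage ys u x finv \<theta>)))) \<and>
     (u \<in> fv \<theta> \<and> x \<notin> fv \<theta> \<longrightarrow>
        (\<forall>xs. var_list L xs u \<theta> \<longrightarrow>
          derives L S {} (Eq (Forall u \<theta>) (Forall_in x X (preimage xs u x finv \<theta>))) \<and>
          derives L S {} (Eq (Exists u \<theta>) (Exists_in x X (preimage xs u x finv \<theta>)))))"
proof -
  interpret local_set_theory_in L S
    using assms(1,2) by unfold_locales
  have wx: "wf_var L x"
    using wf_var_fv[of L \<alpha> x] assms(4,5) by (simp add: wf_fm_def)
  have X: "wf_trm L X" "fv X = {}" "ty_of X = Pow (snd x)"
    using assms(4,5,6) wx by auto
  note ctxt = assms(11,9,10) X assms(7)
  note \<theta> = assms(16) and \<gamma> = assms(17)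
  show ?thesis
    using connective_preimage[OF ctxt truth_functional_And \<theta> \<gamma> _ _ _ entails_Or_And]
      connective_preimage[OF ctxt truth_functional_Or \<theta> \<gamma> _ _ _ entails_Or_Or]
      connective_preimage_within[OF ctxt truth_functional_Imp \<theta> \<gamma>]
      connective_preimage_within[OF ctxt truth_functional_Iff \<theta> \<gamma>]
      preimage_Neg[OF ctxt \<theta>] preimage_Forall[OF ctxt \<theta>] preimage_Exists[OF ctxt \<theta>]
    by blast
qed

end
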